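(* There exists an oracle $A$ with multilinear extension $\widetilde{A}$ such that $\mathsf{BPE}^{\widetilde{A}}\subseteq\mathsf{SIZE}^{A}[O(n)]$. That is, for every language $L\in\mathsf{BPE}^{\widetilde{A}}$ there is a constant $c$ such that, for every input length $n$, $L$ restricted to $\{0,1\}^n$ is computed by a circuit with $A$-oracle gates of size at most $cn$.
   Context: An oracle $A$ is a family of Boolean functions $A_m:\{0,1\}^m\to\{0,1\}$, one for each $m\in\mathbb{N}$. For a finite field $\mathbb{F}$, $\widetilde{A}_{m,\mathbb{F}}$ is the unique multilinear polynomial over $\mathbb{F}$ agreeing with $A_m$ on $\{0,1\}^m$. The multilinear extension $\widetilde{A}$ is the collection of all $\widetilde{A}_{m,\mathbb{F}}$. Oracle machines may query any $\widetilde{A}_{m,\mathbb{F}}$, each query costing time $O(m\log|\mathbb{F}|)$. $\mathsf{BPE}^{\widetilde{A}}$ is the class of languages decided by randomized $2^{O(n)}$-time machines with oracle access to $\widetilde{A}$ that, on every input, output the correct answer with probability at least $2/3$. *)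

theory Defs
  imports
    "HOL-Algebra.Polynomial_Divisibility"
    "HOL-Number_Theory.Residues"
    "HOL-Library.FuncSet"
    "HOL-Library.Landau_Symbols"
    "HOL-Probability.Probability_Mass_Function"
begin

section \<open>Oracles and their multilinear extensions\<close>

text \<open>The component \<open>A\<^sub>m\<close> of an oracle \<open>A\<close> is its restriction to the lists of length \<open>m\<close>.\<close>

type_synonym bool_oracle = "bool list \<Rightarrow> bool"

text \<open>A multilinear polynomial in \<open>m\<close> variables is given by its coefficients: \<open>c S\<close>, for
  \<open>S \<subseteq> {..<m}\<close>, is the coefficient of the monomial whose variables are those with index in \<open>S\<close>.\<close>

definition mlin_eval ::
  "('a, 'b) ring_scheme \<Rightarrow> nat \<Rightarrow> (nat set \<Rightarrow> 'a) \<Rightarrow> 'a list \<Rightarrow> 'a" where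
  "mlin_eval F m c x =
     (\<Oplus>\<^bsub>F\<^esub>S \<in> Pow {..<m}. c S \<otimes>\<^bsub>F\<^esub> (\<Otimes>\<^bsub>F\<^esub>i \<in> S. x ! i))"

definition bit_elem :: "('a, 'b) ring_scheme \<Rightarrow> bool \<Rightarrow> 'a" where
  "bit_elem F b = (if b then \<one>\<^bsub>F\<^esub> else \<zero>\<^bsub>F\<^esub>)"

definition is_mlin_extension ::
  "bool_oracle \<Rightarrow> nat \<Rightarrow> ('a, 'b) ring_scheme \<Rightarrow> (nat set \<Rightarrow> 'a) \<Rightarrow> bool" where
  "is_mlin_extension A m F c \<longleftrightarrow>
     c \<in> Pow {..<m} \<rightarrow>\<^sub>E carrier F \<and>
     (\<forall>b. length b = m \<longrightarrow> mlin_eval F m c (map (bit_elem F) b) = bit_elem F (A b))"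

definition mlin_extension ::
  "bool_oracle \<Rightarrow> nat \<Rightarrow> ('a, 'b) ring_scheme \<Rightarrow> nat set \<Rightarrow> 'a" where
  "mlin_extension A m F = (THE c. is_mlin_extension A m F c)"

context cring
begin

lemma mlin_eval_bits:
  assumes c: "c \<in> Pow {..<m} \<rightarrow> carrier R" and b: "length b = m"
  shows "mlin_eval R m c (map (bit_elem R) b) = (\<Oplus>S \<in> Pow {i. i < m \<and> b ! i}. c S)"
proof -
  let ?B = "{i. i < m \<and> b ! i}"
  have fin: "finite S" if "S \<in> Pow {..<m}" for S
    using that finite_subset by auto
  have elem: "bit_elem R d \<in> carrier R" for d by (simp add: bit_elem_def)
  have prod: "(\<Otimes>i \<in> S. map (bit_elem R) b ! i) = (if S \<subseteq> ?B then \<one> else \<zero>)"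
    if S: "S \<in> Pow {..<m}" for S
  proof (cases "S \<subseteq> ?B")
    case True
    have "(\<Otimes>i \<in> S. map (bit_elem R) b ! i) = (\<Otimes>i \<in> S. \<one>)"
      by (rule finprod_cong') (use True b in \<open>auto simp: bit_elem_def\<close>)
    then show ?thesis using True by simp
  next
    case False
    then obtain j where j: "j \<in> S" "\<not> b ! j" using S by auto
    have "(\<Otimes>i \<in> insert j (S - {j}). map (bit_elem R) b ! i)
      = map (bit_elem R) b ! j \<otimes> (\<Otimes>i \<in> S - {j}. map (bit_elem R) b ! i)"
      by (rule finprod_insert) (use S b fin j elem in \<open>auto simp: subset_iff\<close>)
    moreover have "map (bit_elem R) b ! j = \<zero>"
      using j S b by (auto simp: bit_elem_def)
    moreover have "(\<Otimes>i \<in> S - {j}. map (bit_elem R) b ! i) \<in> carrier R"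
      by (rule finprod_closed) (use S b elem in \<open>auto simp: subset_iff\<close>)
    ultimately show ?thesis using False j by (simp add: insert_absorb)
  qed
  have "mlin_eval R m c (map (bit_elem R) b)
      = (\<Oplus>S \<in> Pow {..<m}. if S \<subseteq> ?B then c S else \<zero>)"
    unfolding mlin_eval_def
    by (rule finsum_cong') (use c in \<open>auto simp: prod Pi_iff\<close>)
  also have "\<dots> = (\<Oplus>S \<in> Pow ?B. if S \<subseteq> ?B then c S else \<zero>)"
    by (rule add.finprod_mono_neutral_cong_right) (use c in auto)
  also have "\<dots> = (\<Oplus>S \<in> Pow ?B. c S)"
    by (rule finsum_cong') (use c in auto)
  finally show ?thesis .
qed

lemma subset_sum_split:
  assumes "finite S" "c \<in> Pow S \<rightarrow> carrier R"
  shows "(\<Oplus>T \<in> Pow S. c T) = c S \<oplus> (\<Oplus>T \<in> Pow S - {S}. c T)"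
proof -
  have "(\<Oplus>T \<in> insert S (Pow S - {S}). c T) = c S \<oplus> (\<Oplus>T \<in> Pow S - {S}. c T)"
    by (rule finsum_insert) (use assms in auto)
  then show ?thesis by (simp add: insert_absorb)
qed

lemma subset_sum_exists:
  fixes a :: "'c set \<Rightarrow> 'a"
  assumes a: "\<And>S. a S \<in> carrier R"
  shows "\<exists>c. (\<forall>S. c S \<in> carrier R) \<and>
    (\<forall>S. finite S \<and> card S < n \<longrightarrow> (\<Oplus>T \<in> Pow S. c T) = a S)"
proof (induction n)
  case 0
  then show ?case by (intro exI[of _ "\<lambda>_. \<zero>"]) auto
next
  case (Suc n)
  then obtain c where c: "\<And>S. c S \<in> carrier R"
    "\<And>S. finite S \<Longrightarrow> card S < n \<Longrightarrow> (\<Oplus>T \<in> Pow S. c T) = a S" by blast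
  define d where
    "d S = (if card S = n then a S \<ominus> (\<Oplus>T \<in> Pow S - {S}. c T) else c S)" for S :: "'c set"
  have sc: "(\<Oplus>T \<in> Y. c T) \<in> carrier R" for Y using c by (intro finsum_closed) auto
  have dc: "d S \<in> carrier R" for S by (simp add: d_def a c sc)
  have "(\<Oplus>T \<in> Pow S. d T) = a S" if S: "finite S" "card S < Suc n" for S
  proof (cases "card S = n")
    case False
    have "(\<Oplus>T \<in> Pow S. d T) = (\<Oplus>T \<in> Pow S. c T)"
    proof (rule finsum_cong')
      fix T assume "T \<in> Pow S"
      then have "card T \<le> card S" using S by (auto intro: card_mono)
      then show "d T = c T" using False S by (auto simp: d_def)
    qed (use c in auto)
    then show ?thesis using c(2)[of S] S False by simp
  next
    case True
    have "(\<Oplus>T \<in> Pow S - {S}. d T) = (\<Oplus>T \<in> Pow S - {S}. c T)"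
    proof (rule finsum_cong')
      fix T assume "T \<in> Pow S - {S}"
      then have "card T < card S" using S by (auto intro: psubset_card_mono)
      then show "d T = c T" using True by (auto simp: d_def)
    qed (use c in auto)
    then have "(\<Oplus>T \<in> Pow S. d T) = d S \<oplus> (\<Oplus>T \<in> Pow S - {S}. c T)"
      using subset_sum_split[of S d] S dc by auto
    also have "\<dots> = a S"
      using True a[of S] sc[of "Pow S - {S}"]
      by (simp add: d_def minus_eq a_assoc l_neg)
    finally show ?thesis .
  qed
  with dc show ?case by blast
qed

theorem mlin_extension_unique_exists: "\<exists>!c. is_mlin_extension A m R c"
proof -
  let ?str = "\<lambda>S. map (\<lambda>i. i \<in> S) [0..<m]"
  have supp: "{i. i < m \<and> ?str S ! i} = S" if "S \<subseteq> {..<m}" for S using that by auto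
  have iff: "is_mlin_extension A m R c \<longleftrightarrow> c \<in> Pow {..<m} \<rightarrow>\<^sub>E carrier R \<and>
      (\<forall>S \<subseteq> {..<m}. (\<Oplus>T \<in> Pow S. c T) = bit_elem R (A (?str S)))" for c
  proof -
    have "(\<forall>b. length b = m \<longrightarrow> mlin_eval R m c (map (bit_elem R) b) = bit_elem R (A b)) \<longleftrightarrow>
      (\<forall>S \<subseteq> {..<m}. (\<Oplus>T \<in> Pow S. c T) = bit_elem R (A (?str S)))"
      if c: "c \<in> Pow {..<m} \<rightarrow>\<^sub>E carrier R"
    proof (intro iffI allI impI)
      fix S assume *: "\<forall>b. length b = m \<longrightarrow>
        mlin_eval R m c (map (bit_elem R) b) = bit_elem R (A b)" and S: "S \<subseteq> {..<m}"
      have "c \<in> Pow {..<m} \<rightarrow> carrier R" using c by blast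
      from mlin_eval_bits[OF this, of "?str S"] *[rule_format, of "?str S"]
      show "(\<Oplus>T \<in> Pow S. c T) = bit_elem R (A (?str S))" by (simp only: supp[OF S]) simp
    next
      fix b :: "bool list"
      assume *: "\<forall>S \<subseteq> {..<m}. (\<Oplus>T \<in> Pow S. c T) = bit_elem R (A (?str S))"
        and b: "length b = m"
      let ?S = "{i. i < m \<and> b ! i}"
      have "?str ?S = b" using b by (auto intro!: nth_equalityI)
      moreover have "?S \<subseteq> {..<m}" by auto
      moreover have "c \<in> Pow {..<m} \<rightarrow> carrier R" using c by blast
      ultimately show "mlin_eval R m c (map (bit_elem R) b) = bit_elem R (A b)"
        using * mlin_eval_bits[of c m b] b by metis
    qed
    then show ?thesis unfolding is_mlin_extension_def by blast
  qed
  show ?thesis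
  proof (rule ex_ex1I)
    obtain c where c: "\<And>S. c S \<in> carrier R"
      "\<And>S. finite S \<Longrightarrow> card S < Suc m \<Longrightarrow> (\<Oplus>T \<in> Pow S. c T) = bit_elem R (A (?str S))"
      using subset_sum_exists[of "\<lambda>S. bit_elem R (A (?str S))" "Suc m"]
      by (metis bit_elem_def one_closed zero_closed)
    have "is_mlin_extension A m R (restrict c (Pow {..<m}))"
      unfolding iff
    proof (intro conjI allI impI)
      fix S assume S: "S \<subseteq> {..<m}"
      have "(\<Oplus>T \<in> Pow S. restrict c (Pow {..<m}) T) = (\<Oplus>T \<in> Pow S. c T)"
        by (rule finsum_cong') (use S c in auto)
      also have "\<dots> = bit_elem R (A (?str S))"
        using S card_mono[OF _ S] by (intro c(2)) (auto intro: finite_subset)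
      finally show "(\<Oplus>T \<in> Pow S. restrict c (Pow {..<m}) T) = bit_elem R (A (?str S))" .
    qed (use c in auto)
    then show "\<exists>c. is_mlin_extension A m R c" by blast
  next
    fix c d assume "is_mlin_extension A m R c" "is_mlin_extension A m R d"
    then have c: "c \<in> Pow {..<m} \<rightarrow>\<^sub>E carrier R" and d: "d \<in> Pow {..<m} \<rightarrow>\<^sub>E carrier R"
      and eq: "\<And>S. S \<subseteq> {..<m} \<Longrightarrow> (\<Oplus>T \<in> Pow S. c T) = (\<Oplus>T \<in> Pow S. d T)"
      by (auto simp: iff)
    have "finite S \<Longrightarrow> S \<subseteq> {..<m} \<Longrightarrow> c S = d S" for S
    proof (induction S rule: finite_psubset_induct)
      case (psubset S)
      have cS: "c \<in> Pow S \<rightarrow> carrier R" and dS: "d \<in> Pow S \<rightarrow> carrier R"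
        using c d psubset.prems by auto
      have "(\<Oplus>T \<in> Pow S - {S}. c T) = (\<Oplus>T \<in> Pow S - {S}. d T)"
        by (rule finsum_cong') (use psubset dS in auto)
      moreover have "c S \<oplus> (\<Oplus>T \<in> Pow S - {S}. c T) = d S \<oplus> (\<Oplus>T \<in> Pow S - {S}. d T)"
        using eq[OF psubset.prems] subset_sum_split[OF psubset.hyps cS]
          subset_sum_split[OF psubset.hyps dS] by simp
      moreover have "(\<Oplus>T \<in> Pow S - {S}. d T) \<in> carrier R"
        using dS by (intro finsum_closed) auto
      moreover have "c S \<in> carrier R" "d S \<in> carrier R" using cS dS by auto
      ultimately show ?case by simp
    qed
    then show "c = d"
      by (intro PiE_ext[OF c d]) (meson PowD finite_lessThan finite_subset)
  qed
qed

end


section \<open>Finite fields and queries as words\<close>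

text \<open>A query names its field by a prime \<open>p\<close> and an irreducible polynomial \<open>f\<close> over
  \<open>\<int>/p\<int>\<close>: the field is \<open>(\<int>/p\<int>)[X]/(f)\<close>, and up to isomorphism every finite field is of this
  form. Following \<^theory>\<open>HOL-Algebra.Polynomials\<close>, polynomials are coefficient lists with the
  leading coefficient first.\<close>

definition prime_poly_ring :: "nat \<Rightarrow> int list ring" where
  "prime_poly_ring p =
     univ_poly (residue_ring (int p)) (carrier (residue_ring (int p)))"

definition field_descr :: "nat \<Rightarrow> int list \<Rightarrow> bool" where
  "field_descr p f \<longleftrightarrow> prime p \<and> f \<in> carrier (prime_poly_ring p) \<and>
     ring_irreducible\<^bsub>prime_poly_ring p\<^esub> f"

definition descr_field :: "nat \<Rightarrow> int list \<Rightarrow> int list set ring" where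
  "descr_field p f = rupture (residue_ring (int p)) (carrier (residue_ring (int p))) f"

text \<open>Field elements are represented by the polynomials of degree smaller than that of \<open>f\<close>.\<close>

definition reduced_polys :: "nat \<Rightarrow> int list \<Rightarrow> int list set" where
  "reduced_polys p f = {g \<in> carrier (prime_poly_ring p). length g < length f}"

definition residue_class :: "nat \<Rightarrow> int list \<Rightarrow> int list \<Rightarrow> int list set" where
  "residue_class p f g = PIdl\<^bsub>prime_poly_ring p\<^esub> f +>\<^bsub>prime_poly_ring p\<^esub> g"

lemma prime_poly_ring_context:
  assumes "prime p"
  shows "field (residue_ring (int p))"
    and "subfield (carrier (residue_ring (int p))) (residue_ring (int p))"
proof -
  show f: "field (residue_ring (int p))"
    using assms by (intro residues_prime.is_field residues_prime.intro) simp_all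
  show "subfield (carrier (residue_ring (int p))) (residue_ring (int p))"
    using field.carrier_is_subfield[OF f] .
qed

lemma descr_field_is_field:
  assumes "field_descr p f"
  shows "field (descr_field p f)"
proof -
  have p: "prime p" using assms by (simp add: field_descr_def)
  interpret field "residue_ring (int p)" by (rule prime_poly_ring_context[OF p])
  show ?thesis
    using assms rupture_is_field_iff_pirreducible[OF prime_poly_ring_context(2)[OF p], of f]
    by (simp add: field_descr_def descr_field_def prime_poly_ring_def)
qed

lemma bij_betw_residue_class:
  assumes "field_descr p f"
  shows "bij_betw (residue_class p f) (reduced_polys p f) (carrier (descr_field p f))"
proof -
  have p: "prime p" using assms by (simp add: field_descr_def)
  let ?R = "residue_ring (int p)"
  interpret field ?R by (rule prime_poly_ring_context[OF p])
  note sub = prime_poly_ring_context(2)[OF p]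
  have f: "f \<in> carrier (univ_poly ?R (carrier ?R))" "ring_irreducible\<^bsub>univ_poly ?R (carrier ?R)\<^esub> f"
    using assms by (auto simp: field_descr_def prime_poly_ring_def)
  have deg: "length f - 1 \<ge> 1" "f \<noteq> []"
    using pirreducible_degree[OF sub f] by auto
  have red: "reduced_polys p f = (\<lambda>q. ring.pmod ?R q f) ` carrier (univ_poly ?R (carrier ?R))"
    unfolding pmod_image_characterization[OF sub f(1) deg(2)] using deg
    by (auto simp: reduced_polys_def prime_poly_ring_def)
  have "inj_on (residue_class p f) (reduced_polys p f)"
    using rupture_surj_inj_on[OF sub f(1)]
    by (simp add: red residue_class_def[abs_def] prime_poly_ring_def)
  moreover have "residue_class p f ` reduced_polys p f = carrier (descr_field p f)"
    using rupture_carrier_as_pmod_image[OF sub f(1)]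
    by (simp add: red residue_class_def[abs_def] prime_poly_ring_def descr_field_def)
  ultimately show ?thesis by (simp add: bij_betw_def)
qed

definition representative :: "nat \<Rightarrow> int list \<Rightarrow> int list set \<Rightarrow> int list" where
  "representative p f y = (THE g. g \<in> reduced_polys p f \<and> residue_class p f g = y)"

text \<open>Words on tapes use the symbols 1 and 2 for the bits 0 and 1, the symbol 3 to end a number
  and the symbol 4 to end a list; the symbol 0 is the blank.\<close>

fun binary :: "nat \<Rightarrow> nat list" where
  "binary n = (if n = 0 then [] else binary (n div 2) @ [n mod 2 + 1])"

declare binary.simps [simp del]

text \<open>Numbers are padded with leading zeros to a given width \<open>l\<close>, and field elements to lists of
  \<open>deg f\<close> coefficients, so that every element takes order \<open>log |F|\<close> symbols.\<close>

definition number_word :: "nat \<Rightarrow> nat \<Rightarrow> nat list" where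
  "number_word l n = replicate (l - length (binary n)) 1 @ binary n"

definition list_word :: "nat \<Rightarrow> int list \<Rightarrow> nat list" where
  "list_word l g = concat (map (\<lambda>a. number_word l (nat a) @ [3]) g) @ [4]"

definition padded :: "int list \<Rightarrow> int list \<Rightarrow> int list" where
  "padded f g = replicate (length f - 1 - length g) 0 @ g"

definition query_word :: "nat \<Rightarrow> int list \<Rightarrow> int list list \<Rightarrow> nat list" where
  "query_word p f xs =
     concat (map (list_word (length (binary p))) ([int p] # f # map (padded f) xs))"

lemma binary_value: "foldl (\<lambda>v d. 2 * v + (d - 1)) 0 (binary n) = n"
proof (induction n rule: less_induct)
  case (less n)
  then show ?case by (subst binary.simps) simp
qed

lemma number_word_inj:
  assumes "number_word l n = number_word l' n'"
  shows "n = n'"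
proof -
  have "foldl (\<lambda>v d. 2 * v + (d - 1)) 0 (replicate k (1::nat)) = 0" for k
    by (induction k) auto
  then have "foldl (\<lambda>v d. 2 * v + (d - 1)) 0 (number_word l n) = n" for l n
    by (simp add: number_word_def binary_value del: One_nat_def)
  then show ?thesis using assms by metis
qed

lemma set_number_word: "set (number_word l n) \<subseteq> {1, 2}"
proof -
  have "set (binary n) \<subseteq> {1, 2}"
  proof (induction n rule: less_induct)
    case (less n)
    then show ?case by (subst binary.simps) auto
  qed
  then show ?thesis by (auto simp: number_word_def)
qed

lemma separator_cancel:
  assumes "s \<notin> set u" "s \<notin> set v" "u @ s # a = v @ s # b"
  shows "u = v \<and> a = b"
proof -
  have "takeWhile (\<lambda>d. d \<noteq> s) (w @ s # c) = w" if "s \<notin> set w" for w c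
    using that by (induction w) auto
  then have "u = v" using assms by metis
  then show ?thesis using assms(3) by simp
qed

lemma list_word_Nil: "list_word l [] @ r = 4 # r"
  by (simp add: list_word_def)

lemma list_word_Cons:
  "list_word l (a # g) @ r = number_word l (nat a) @ 3 # list_word l g @ r"
  by (simp add: list_word_def)

lemma list_word_Nil_neq_Cons: "list_word l [] @ r \<noteq> list_word l' (b # h) @ s"
  using set_number_word[of l' "nat b"] unfolding list_word_Nil list_word_Cons
  by (cases "number_word l' (nat b)") auto

lemma list_word_cancel:
  assumes "\<forall>a \<in> set g. 0 \<le> a" "\<forall>a \<in> set h. 0 \<le> a"
    and "list_word l g @ r = list_word l' h @ s"
  shows "g = h \<and> r = s"
  using assms
proof (induction g arbitrary: h)
  case Nil
  then show ?case
    using list_word_Nil_neq_Cons by (cases h) (auto simp: list_word_Nil)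
next
  case (Cons a g)
  then obtain b h' where h: "h = b # h'"
    using list_word_Nil_neq_Cons by (metis list.exhaust)
  have "3 \<notin> set (number_word k n)" for k n using set_number_word[of k n] by auto
  then have eq: "number_word l (nat a) = number_word l' (nat b)"
    "list_word l g @ r = list_word l' h' @ s"
    using Cons.prems(3) separator_cancel[of 3 "number_word l (nat a)" "number_word l' (nat b)"]
    unfolding h list_word_Cons by auto
  then have "nat a = nat b" by (blast intro: number_word_inj)
  then show ?case
    using Cons.IH[OF _ _ eq(2)] Cons.prems h by (simp add: eq_nat_nat_iff)
qed

lemma list_words_inj:
  assumes "\<forall>g \<in> set gs. \<forall>a \<in> set g. 0 \<le> a" "\<forall>h \<in> set hs. \<forall>a \<in> set h. 0 \<le> a"
    and "concat (map (list_word l) gs) = concat (map (list_word l') hs)"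
  shows "gs = hs"
  using assms
proof (induction gs arbitrary: hs)
  case Nil
  then show ?case by (cases hs) (auto simp: list_word_def)
next
  case (Cons g gs)
  then obtain h hs' where hs: "hs = h # hs'"
    by (cases hs) (auto simp: list_word_def)
  have "g = h \<and> concat (map (list_word l) gs) = concat (map (list_word l') hs')"
    by (rule list_word_cancel) (use Cons.prems hs in auto)
  then show ?case using Cons hs by auto
qed

lemma inj_on_padded: "inj_on (padded f) (reduced_polys p f)"
proof (rule inj_on_inverseI)
  fix g assume "g \<in> reduced_polys p f"
  then have "g = [] \<or> hd g \<noteq> 0"
    by (auto simp: reduced_polys_def prime_poly_ring_def univ_poly_def polynomial_def
        residue_ring_def)
  then have "dropWhile (\<lambda>a. a = 0) g = g" by (cases g) auto
  moreover have "dropWhile (\<lambda>a. a = 0) (replicate k 0 @ g) = dropWhile (\<lambda>a. a = 0) g" for k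
    by (induction k) auto
  ultimately show "dropWhile (\<lambda>a. a = 0) (padded f g) = g" by (simp add: padded_def)
qed

definition is_query :: "nat list \<Rightarrow> nat \<Rightarrow> int list \<Rightarrow> int list list \<Rightarrow> bool" where
  "is_query w p f xs \<longleftrightarrow>
     field_descr p f \<and> set xs \<subseteq> reduced_polys p f \<and> w = query_word p f xs"

lemma is_query_unique:
  assumes "is_query w p f xs" "is_query w p' f' xs'"
  shows "p = p' \<and> f = f' \<and> xs = xs'"
proof -
  have nonneg: "\<forall>a \<in> set g. 0 \<le> a" if "g \<in> carrier (prime_poly_ring q)" for g q
    using that
    by (cases g) (auto simp: prime_poly_ring_def univ_poly_def polynomial_def residue_ring_def)
  have *: "\<forall>g \<in> set ([int q] # k # map (padded k) ys). \<forall>a \<in> set g. 0 \<le> a"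
    if "is_query w q k ys" for q k ys
  proof -
    have "k \<in> carrier (prime_poly_ring q)"
      using that by (simp add: is_query_def field_descr_def)
    moreover have "g \<in> carrier (prime_poly_ring q)" if "g \<in> set ys" for g
      using that \<open>is_query w q k ys\<close> by (auto simp: is_query_def reduced_polys_def)
    ultimately show ?thesis using nonneg by (auto simp: padded_def)
  qed
  have "w = concat (map (list_word (length (binary q))) ([int q] # k # map (padded k) ys))"
    if "is_query w q k ys" for q k ys
    using that unfolding is_query_def query_word_def by (elim conjE)
  from this[OF assms(1)] this[OF assms(2)]
  have "[int p] # f # map (padded f) xs = [int p'] # f' # map (padded f') xs'"
    using *[OF assms(1)] *[OF assms(2)] list_words_inj by (metis (no_types))
  then have eq: "p = p'" "f = f'" "map (padded f) xs = map (padded f) xs'" by auto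
  have "set xs \<union> set xs' \<subseteq> reduced_polys p f"
    using assms by (simp add: is_query_def eq)
  then have "inj_on (padded f) (set xs \<union> set xs')"
    by (rule inj_on_subset[OF inj_on_padded])
  with eq show ?thesis by (simp add: inj_on_map_eq_map)
qed

text \<open>The number of variables of a query is the number of its field elements. Words that are not
  queries are answered by the empty word.\<close>

definition mlin_answer :: "bool_oracle \<Rightarrow> nat \<Rightarrow> int list \<Rightarrow> int list list \<Rightarrow> nat list" where
  "mlin_answer A p f xs =
     (let F = descr_field p f; m = length xs in
      list_word (length (binary p)) (padded f (representative p f
        (mlin_eval F m (mlin_extension A m F) (map (residue_class p f) xs)))))"

definition mlin_oracle :: "bool_oracle \<Rightarrow> nat list \<Rightarrow> nat list" where
  "mlin_oracle A w =
     (if \<exists>p f xs. is_query w p f xs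
      then THE v. \<exists>p f xs. is_query w p f xs \<and> v = mlin_answer A p f xs
      else [])"

lemma mlin_oracle_query:
  assumes "is_query w p f xs"
  shows "mlin_oracle A w = mlin_answer A p f xs"
proof -
  have "(THE v. \<exists>p f xs. is_query w p f xs \<and> v = mlin_answer A p f xs) = mlin_answer A p f xs"
    by (rule the_equality) (use assms is_query_unique[OF _ assms] in blast)+
  then show ?thesis unfolding mlin_oracle_def using assms by auto
qed


section \<open>Randomized oracle Turing machines\<close>

text \<open>A machine has finitely many two-way infinite tapes; the first one initially holds the input,
  the second one is the query tape. In every step the transition function sees, besides the state
  and the scanned symbols, a fresh random bit; it yields the next state and, for each tape, the
  symbol to write and the head movement. Only its values on actual states and symbols matter.\<close>

record ptm =
  num_tapes :: nat
  num_states :: nat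
  num_symbols :: nat
  trans :: "nat \<Rightarrow> bool \<Rightarrow> nat list \<Rightarrow> nat \<times> (nat \<times> int) list"

abbreviation (input) start_state :: nat where "start_state \<equiv> 0"
abbreviation (input) accept_state :: nat where "accept_state \<equiv> 1"
abbreviation (input) reject_state :: nat where "reject_state \<equiv> 2"
abbreviation (input) query_state :: nat where "query_state \<equiv> 3"
abbreviation (input) answer_state :: nat where "answer_state \<equiv> 4"

definition wf_ptm :: "ptm \<Rightarrow> bool" where
  "wf_ptm M \<longleftrightarrow> 2 \<le> num_tapes M \<and> 5 \<le> num_states M \<and> 5 \<le> num_symbols M \<and>
     (\<forall>q < num_states M. \<forall>b ss. length ss = num_tapes M \<and> set ss \<subseteq> {..<num_symbols M} \<longrightarrow>
        (case trans M q b ss of (q', acts) \<Rightarrow>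
           q' < num_states M \<and> length acts = num_tapes M \<and>
           set acts \<subseteq> {..<num_symbols M} \<times> {-1, 0, 1}))"

text \<open>A tape consists of its head position and its contents.\<close>

type_synonym tape = "int \<times> (int \<Rightarrow> nat)"
type_synonym config = "nat \<times> tape list"

definition word_tape :: "nat list \<Rightarrow> tape" where
  "word_tape w = (0, \<lambda>i. if 0 \<le> i \<and> i < int (length w) then w ! nat i else 0)"

text \<open>The word on a tape starts at cell 0 and ends before the first blank.\<close>

definition tape_word :: "tape \<Rightarrow> nat list" where
  "tape_word t = map (\<lambda>i. snd t (int i)) [0..<(LEAST k. snd t (int k) = 0)]"

definition init_config :: "ptm \<Rightarrow> bool list \<Rightarrow> config" where
  "init_config M x = (start_state,
     word_tape (map (\<lambda>b. if b then 2 else 1) x) # replicate (num_tapes M - 1) (word_tape []))"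

definition halted :: "config \<Rightarrow> bool" where
  "halted cf \<longleftrightarrow> fst cf = accept_state \<or> fst cf = reject_state"

definition tape_action :: "nat \<times> int \<Rightarrow> tape \<Rightarrow> tape" where
  "tape_action = (\<lambda>(s, d) (h, u). (h + d, u(h := s)))"

definition step :: "(nat list \<Rightarrow> nat list) \<Rightarrow> ptm \<Rightarrow> bool \<Rightarrow> config \<Rightarrow> config" where
  "step Q M b cf =
     (case cf of (q, ts) \<Rightarrow>
        if halted cf then cf
        else if q = query_state
        then (answer_state, ts[1 := word_tape (Q (tape_word (ts ! 1)))])
        else (case trans M q b (map (\<lambda>(h, u). u h) ts) of (q', acts) \<Rightarrow>
                (q', map2 tape_action acts ts)))"

text \<open>A query is charged (up to the additive 1) the length of the query word, which for
  \<open>m \<ge> 1\<close> variables over a field \<open>F\<close> is of order \<open>m log |F|\<close>.\<close>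

definition step_cost :: "config \<Rightarrow> nat" where
  "step_cost cf =
     (if halted cf then 0
      else if fst cf = query_state then 1 + length (tape_word (snd cf ! 1))
      else 1)"

fun run :: "(nat list \<Rightarrow> nat list) \<Rightarrow> ptm \<Rightarrow> bool list \<Rightarrow> config \<Rightarrow> config" where
  "run Q M [] cf = cf"
| "run Q M (b # r) cf = run Q M r (step Q M b cf)"

fun run_time :: "(nat list \<Rightarrow> nat list) \<Rightarrow> ptm \<Rightarrow> bool list \<Rightarrow> config \<Rightarrow> nat" where
  "run_time Q M [] cf = 0"
| "run_time Q M (b # r) cf = step_cost cf + run_time Q M r (step Q M b cf)"

text \<open>Each step before halting costs at least 1, so \<open>T\<close> random bits suffice for a run of time
  at most \<open>T\<close>.\<close>

definition halts_within ::
  "(nat list \<Rightarrow> nat list) \<Rightarrow> ptm \<Rightarrow> bool list \<Rightarrow> nat \<Rightarrow> bool" where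
  "halts_within Q M x T \<longleftrightarrow>
     (\<forall>r. length r = T \<longrightarrow>
        halted (run Q M r (init_config M x)) \<and> run_time Q M r (init_config M x) \<le> T)"

definition accepts ::
  "(nat list \<Rightarrow> nat list) \<Rightarrow> ptm \<Rightarrow> bool list \<Rightarrow> bool list \<Rightarrow> bool" where
  "accepts Q M x r \<longleftrightarrow> fst (run Q M r (init_config M x)) = accept_state"

definition BPE :: "(nat list \<Rightarrow> nat list) \<Rightarrow> bool list set set" where
  "BPE Q = {L. \<exists>M t. wf_ptm M \<and> (\<lambda>n. real (t n)) \<in> O(\<lambda>n. real n) \<and>
     (\<forall>x. let T = 2 ^ t (length x) in
        halts_within Q M x T \<and>
        measure_pmf.prob (pmf_of_set {r. length r = T}) {r. accepts Q M x r \<longleftrightarrow> x \<in> L} \<ge> 2 / 3)}"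


section \<open>Circuits with oracle gates\<close>

text \<open>A circuit is a sequence of gates together with an output wire; \<open>Gate j\<close> denotes the output
  of the \<open>j\<close>-th gate, counted from 0. Inputs and constants are wires rather than gates, so a
  constant function has a circuit of size 0.\<close>

datatype wire = Input nat | Constant bool | Gate nat

datatype gate = AND wire wire | OR wire wire | NOT wire | ORACLE "wire list"

type_synonym circuit = "gate list \<times> wire"

fun gate_wires :: "gate \<Rightarrow> wire list" where
  "gate_wires (AND u v) = [u, v]"
| "gate_wires (OR u v) = [u, v]"
| "gate_wires (NOT u) = [u]"
| "gate_wires (ORACLE us) = us"

fun wf_wire :: "nat \<Rightarrow> nat \<Rightarrow> wire \<Rightarrow> bool" where
  "wf_wire n k (Input i) \<longleftrightarrow> i < n"
| "wf_wire n k (Constant b) \<longleftrightarrow> True"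
| "wf_wire n k (Gate j) \<longleftrightarrow> j < k"

definition wf_circuit :: "nat \<Rightarrow> circuit \<Rightarrow> bool" where
  "wf_circuit n C \<longleftrightarrow>
     (\<forall>k < length (fst C). \<forall>u \<in> set (gate_wires (fst C ! k)). wf_wire n k u) \<and>
     wf_wire n (length (fst C)) (snd C)"

fun wire_value :: "bool list \<Rightarrow> bool list \<Rightarrow> wire \<Rightarrow> bool" where
  "wire_value x vs (Input i) = x ! i"
| "wire_value x vs (Constant b) = b"
| "wire_value x vs (Gate j) = vs ! j"

fun gate_value :: "bool_oracle \<Rightarrow> bool list \<Rightarrow> bool list \<Rightarrow> gate \<Rightarrow> bool" where
  "gate_value A x vs (AND u v) = (wire_value x vs u \<and> wire_value x vs v)"
| "gate_value A x vs (OR u v) = (wire_value x vs u \<or> wire_value x vs v)"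
| "gate_value A x vs (NOT u) = (\<not> wire_value x vs u)"
| "gate_value A x vs (ORACLE us) = A (map (wire_value x vs) us)"

definition gate_values :: "bool_oracle \<Rightarrow> bool list \<Rightarrow> gate list \<Rightarrow> bool list" where
  "gate_values A x gs = foldl (\<lambda>vs g. vs @ [gate_value A x vs g]) [] gs"

definition circuit_value :: "bool_oracle \<Rightarrow> circuit \<Rightarrow> bool list \<Rightarrow> bool" where
  "circuit_value A C x = wire_value x (gate_values A x (fst C)) (snd C)"

text \<open>The size counts gates and wires into gates: an oracle gate of fan-in \<open>m\<close> contributes
  \<open>1 + m\<close>.\<close>

definition circuit_size :: "circuit \<Rightarrow> nat" where
  "circuit_size C = (\<Sum>g\<leftarrow>fst C. 1 + length (gate_wires g))"

definition SIZE :: "bool_oracle \<Rightarrow> (nat \<Rightarrow> nat) \<Rightarrow> bool list set set" where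
  "SIZE A s = {L. \<forall>n. \<exists>C. wf_circuit n C \<and> circuit_size C \<le> s n \<and>
     (\<forall>x. length x = n \<longrightarrow> (circuit_value A C x \<longleftrightarrow> x \<in> L))}"

end

theory Submission
  imports Defs
begin

text \<open>
  The oracle has two halves, with tables \<open>Xs w\<close> and \<open>Ys w\<close> for every seed \<open>w\<close>, and the circuits
  look up \<open>y\<close> in the symmetric difference of \<open>Xs w\<close> and \<open>Ys w'\<close> for hardwired seeds \<open>w\<close>, \<open>w'\<close>. The
  multilinear extension of the oracle is the sum of the extensions of its halves, so a machine with
  access to it is a communication protocol between the owners of the halves whose cost is at most
  twice the running time. This is the problem XOR-Missing-String of Chen, Hu and Ren.

  A protocol cuts the set of all pairs \<open>(Xs, Ys)\<close> into few rectangles. On a large rectangle with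
  constant answers \<open>s\<close>, the tables at most seeds are close to uniformly distributed, so one can choose
  seeds \<open>w\<close>, \<open>w'\<close> and a table \<open>a\<close> such that the condition \<open>Xs w = a\<close>, \<open>Ys w' = a \<oplus> s\<close> leaves a large
  rectangle. Errors are controlled on average: for random \<open>w\<close>, \<open>w'\<close>, \<open>a\<close> no cheap protocol notices the
  condition, hence the expectation of a high moment of the error probabilities of all machines
  treated so far hardly increases. Machines that violate the promise need no attention, since the
  moment only weighs answers that are wrong with probability about \<open>2 / 3\<close> or more. Compactness turns
  the oracles for finitely many stages into a single one.
\<close>

section \<open>Averages and near-uniform coordinates\<close>

text \<open>A query to a multilinear extension depends on all values of \<open>A\<close> at one
  length, so nothing can be hidden by leaving it unqueried; only the information in the answers is
  bounded. With a single half such a bound would not help: for large \<open>d\<close> there are far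
  fewer seeds than tables, and the owner of all \<open>Xs w\<close> could answer with a table that
  differs from each of them. With two halves neither owner knows the tables
  \<open>xor_set (Xs w) (Ys w')\<close>. Moreover no prescribed value is ever forced on one half:
  for a fixed answer \<open>s\<close> and uniform \<open>a\<close>, both \<open>a\<close> and
  \<open>xor_set a s\<close> are uniform, so it suffices that typical values can be planted. The
  sampled runs serve only to find \<open>s\<close>; planting may change them, and it is the moment
  that is carried on. Earlier moments are tested again at every stage, because early tasks run for
  exponential time and can query seeds of later stages. A power of an error probability is the
  probability that independent runs all err, hence again an average of cheap protocols.\<close>

definition avg :: "'a set \<Rightarrow> ('a \<Rightarrow> real) \<Rightarrow> real" where
  "avg S f = sum f S / real (card S)"

lemma avg_mono: "(\<And>x. x \<in> S \<Longrightarrow> f x \<le> g x) \<Longrightarrow> avg S f \<le> avg S g"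
  unfolding avg_def by (intro divide_right_mono sum_mono) auto

lemma avg_add: "avg S (\<lambda>x. f x + g x) = avg S f + avg S g"
  by (simp add: avg_def sum.distrib add_divide_distrib)

lemma avg_diff: "avg S (\<lambda>x. f x - g x) = avg S f - avg S g"
  by (simp add: avg_def sum_subtractf diff_divide_distrib)

lemma avg_cmult: "avg S (\<lambda>x. c * f x) = c * avg S f"
  by (simp add: avg_def sum_distrib_left)

lemma avg_const: "finite S \<Longrightarrow> S \<noteq> {} \<Longrightarrow> avg S (\<lambda>_. c) = c"
  by (simp add: avg_def)

lemma avg_sum: "avg S (\<lambda>x. \<Sum>k\<in>T. f k x) = (\<Sum>k\<in>T. avg S (f k))"
  unfolding avg_def by (subst sum.swap) (simp add: sum_divide_distrib)

lemma avg_swap: "avg S (\<lambda>x. avg T (f x)) = avg T (\<lambda>y. avg S (\<lambda>x. f x y))"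
  unfolding avg_def
  by (simp add: sum_divide_distrib [symmetric] sum.swap[of _ T S] mult.commute)

lemma exists_le_avg:
  assumes "finite S" "S \<noteq> {}" shows "\<exists>x\<in>S. f x \<le> avg S f"
proof (rule ccontr)
  assume "\<not> ?thesis"
  then have "(\<Sum>x\<in>S. avg S f) < sum f S" using assms by (intro sum_strict_mono) auto
  with assms show False by (simp add: avg_def)
qed

text \<open>For \<open>z = - y\<close> with \<open>y \<ge> 0\<close> the claim is
  \<open>1 \<le> exp y * (1 - y + y\<^sup>2)\<close>; multiplying out with the quadratic Taylor
  bound of \<open>exp y\<close> leaves 1 plus nonnegative terms.\<close>

lemma exp_le_quadratic:
  fixes z :: real assumes "\<bar>z\<bar> \<le> 1" shows "exp z \<le> 1 + z + z\<^sup>2"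
proof (cases "0 \<le> z")
  case True then show ?thesis using exp_bound[of z] assms by simp
next
  case False
  define y where "y = - z"
  have y: "0 \<le> y" using False by (simp add: y_def)
  have "1 + y + y\<^sup>2 / 2 \<le> exp y" using exp_lower_Taylor_quadratic[OF y] by simp
  moreover have "0 < 1 - y + y\<^sup>2"
    using zero_le_power2[of "y - 1/2"] by (simp add: power2_eq_square algebra_simps)
  ultimately have "(1 + y + y\<^sup>2 / 2) * (1 - y + y\<^sup>2) \<le> exp y * (1 - y + y\<^sup>2)"
    by (intro mult_right_mono) auto
  moreover have "(1 + y + y\<^sup>2 / 2) * (1 - y + y\<^sup>2) = 1 + y^2 / 2 + y^3 / 2 + y^4 / 2"
    by (simp add: field_simps power2_eq_square power3_eq_cube power4_eq_xxxx)
  ultimately have "1 \<le> exp y * (1 - y + y\<^sup>2)" using y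
    by (smt (verit) zero_le_power divide_nonneg_nonneg)
  then have "exp (- y) * 1 \<le> exp (- y) * (exp y * (1 - y + y\<^sup>2))"
    by (intro mult_left_mono) auto
  then show ?thesis by (simp add: exp_minus y_def mult.assoc[symmetric])
qed

text \<open>Coordinates of a product set are independent, so the exponential moment factors. In each
  factor the linear term averages to 0, which leaves at most \<open>1 + l\<^sup>2\<close>.\<close>

lemma avg_exp_sum_le:
  fixes u :: "'i \<Rightarrow> 'v \<Rightarrow> real"
  assumes I: "finite I" "J \<subseteq> I" and V: "\<And>i. i \<in> I \<Longrightarrow> finite (V i)" "\<And>i. i \<in> I \<Longrightarrow> V i \<noteq> {}"
    and u: "\<And>i a. i \<in> J \<Longrightarrow> a \<in> V i \<Longrightarrow> \<bar>u i a\<bar> \<le> 1" "\<And>i. i \<in> J \<Longrightarrow> (\<Sum>a\<in>V i. u i a) = 0"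
    and l: "0 \<le> l" "l \<le> 1"
  shows "avg (Pi\<^sub>E I V) (\<lambda>x. exp (l * (\<Sum>i\<in>J. u i (x i)))) \<le> exp (l\<^sup>2 * real (card J))"
proof -
  define g where "g i a = (if i \<in> J then exp (l * u i a) else 1)" for i a
  have fJ: "finite J" using I finite_subset by blast
  have "exp (l * (\<Sum>i\<in>J. u i (x i))) = (\<Prod>i\<in>I. g i (x i))" for x
  proof -
    have "exp (l * (\<Sum>i\<in>J. u i (x i))) = (\<Prod>i\<in>J. exp (l * u i (x i)))"
      by (simp add: sum_distrib_left exp_sum fJ)
    also have "\<dots> = (\<Prod>i\<in>I. g i (x i))"
      unfolding g_def using I by (intro prod.mono_neutral_cong_left) auto
    finally show ?thesis .
  qed
  then have "avg (Pi\<^sub>E I V) (\<lambda>x. exp (l * (\<Sum>i\<in>J. u i (x i))))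
    = (\<Prod>i\<in>I. \<Sum>a\<in>V i. g i a) / (\<Prod>i\<in>I. real (card (V i)))"
    using I V by (simp add: avg_def prod_sum_PiE card_PiE)
  also have "\<dots> = (\<Prod>i\<in>I. avg (V i) (g i))" by (simp add: avg_def prod_dividef)
  also have "\<dots> \<le> (\<Prod>i\<in>I. if i \<in> J then exp (l\<^sup>2) else 1)"
  proof (intro prod_mono conjI)
    fix i assume i: "i \<in> I"
    show "0 \<le> avg (V i) (g i)" by (auto simp: avg_def g_def intro!: divide_nonneg_nonneg sum_nonneg)
    show "avg (V i) (g i) \<le> (if i \<in> J then exp (l\<^sup>2) else 1)"
    proof (cases "i \<in> J")
      case False then show ?thesis using V[OF i] avg_const[of "V i" 1] by (simp add: g_def avg_def)
    next
      case True
      have "avg (V i) (g i) \<le> avg (V i) (\<lambda>a. (1 + l\<^sup>2) + l * u i a)"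
      proof (rule avg_mono)
        fix a assume a: "a \<in> V i"
        have "\<bar>l * u i a\<bar> \<le> 1" using u(1)[OF True a] l by (simp add: abs_mult mult_le_one)
        then have "exp (l * u i a) \<le> 1 + l * u i a + (l * u i a)\<^sup>2" by (rule exp_le_quadratic)
        moreover have "(l * u i a)\<^sup>2 \<le> l\<^sup>2"
        proof -
          have "(u i a)\<^sup>2 \<le> 1" using u(1)[OF True a] by (simp add: abs_square_le_1)
          then have "l\<^sup>2 * (u i a)\<^sup>2 \<le> l\<^sup>2 * 1" by (intro mult_left_mono) auto
          then show ?thesis by (simp add: power_mult_distrib)
        qed
        ultimately show "g i a \<le> 1 + l\<^sup>2 + l * u i a" using True by (simp add: g_def)
      qed
      also have "\<dots> = 1 + l\<^sup>2"
        using V[OF i] u(2)[OF True] unfolding avg_add avg_cmult by (simp add: avg_const) (simp add: avg_def)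
      also have "\<dots> \<le> exp (l\<^sup>2)" by (rule exp_ge_add_one_self)
      finally show ?thesis using True by simp
    qed
  qed
  also have "\<dots> = (\<Prod>i\<in>J. exp (l\<^sup>2))" using I by (intro prod.mono_neutral_cong_right) auto
  also have "\<dots> = exp (l\<^sup>2 * real (card J))" by (simp add: exp_of_nat_mult[symmetric] mult.commute)
  finally show ?thesis .
qed

text \<open>A change of measure in place of entropy: passing to \<open>P\<close> multiplies the
  average of a nonnegative function by at most \<open>exp D\<close>, and the tangent of
  \<open>exp\<close> at \<open>c\<close> replaces Jensen's inequality. The free parameter
  \<open>l\<close> balances \<open>D / l\<close> against \<open>l * card J\<close>.\<close>

lemma sum_avg_le:
  fixes u :: "'i \<Rightarrow> 'v \<Rightarrow> real"
  assumes I: "finite I" "J \<subseteq> I" and V: "\<And>i. i \<in> I \<Longrightarrow> finite (V i)" "\<And>i. i \<in> I \<Longrightarrow> V i \<noteq> {}"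
    and u: "\<And>i a. i \<in> J \<Longrightarrow> a \<in> V i \<Longrightarrow> \<bar>u i a\<bar> \<le> 1" "\<And>i. i \<in> J \<Longrightarrow> (\<Sum>a\<in>V i. u i a) = 0"
    and l: "0 < l" "l \<le> 1"
    and P: "P \<subseteq> Pi\<^sub>E I V" "P \<noteq> {}" "real (card (Pi\<^sub>E I V)) \<le> exp D * real (card P)"
  shows "(\<Sum>i\<in>J. avg P (\<lambda>x. u i (x i))) \<le> D / l + l * real (card J)"
proof -
  define S where "S x = (\<Sum>i\<in>J. u i (x i))" for x
  define c where "c = D + l\<^sup>2 * real (card J)"
  have fin: "finite (Pi\<^sub>E I V)" using I V by (intro finite_PiE) auto
  have fP: "finite P" using P fin finite_subset by blast
  have cP: "0 < real (card P)" using P fP by (simp add: card_gt_0_iff)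
  have ne: "0 < real (card (Pi\<^sub>E I V))" using P fin by (auto simp: card_gt_0_iff)
  have "avg P (\<lambda>x. exp (l * S x)) \<le> exp D * avg (Pi\<^sub>E I V) (\<lambda>x. exp (l * S x))"
  proof -
    let ?T = "\<Sum>x\<in>Pi\<^sub>E I V. exp (l * S x)"
    have "(\<Sum>x\<in>P. exp (l * S x)) \<le> ?T" by (intro sum_mono2) (use fin P in auto)
    then have "avg P (\<lambda>x. exp (l * S x)) \<le> ?T / card P" 
      unfolding avg_def using cP by (intro divide_right_mono) auto
    also have "\<dots> = ?T * (1 / card P)" by simp
    also have "\<dots> \<le> ?T * (exp D / card (Pi\<^sub>E I V))"
      using P(3) cP ne by (intro mult_left_mono sum_nonneg) (auto simp: field_simps)
    finally show ?thesis by (simp add: avg_def mult.commute)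
  qed
  also have "\<dots> \<le> exp D * exp (l\<^sup>2 * real (card J))"
    using avg_exp_sum_le[of I J V u l] assms unfolding S_def by (intro mult_left_mono) auto
  also have "\<dots> = exp c" by (simp add: c_def exp_add)
  finally have E: "avg P (\<lambda>x. exp (l * S x)) \<le> exp c" .
  have "avg P (\<lambda>x. (1 - c) + l * S x) \<le> avg P (\<lambda>x. exp (- c) * exp (l * S x))"
  proof (rule avg_mono)
    fix x show "(1 - c) + l * S x \<le> exp (- c) * exp (l * S x)"
      using exp_ge_add_one_self[of "l * S x - c"] by (simp add: exp_diff exp_minus field_simps)
  qed
  also have "\<dots> \<le> exp (- c) * exp c" unfolding avg_cmult using E by (intro mult_left_mono) auto
  also have "\<dots> = 1" by (simp add: exp_minus)
  finally have "l * avg P S \<le> c"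
    unfolding avg_add avg_cmult using P fP by (simp add: avg_const)
  then have "avg P S \<le> c / l" using l by (simp add: field_simps)
  also have "c / l = D / l + l * real (card J)" using l by (simp add: c_def field_simps power2_eq_square)
  finally show ?thesis unfolding S_def avg_sum .
qed

section \<open>Marginals of a large set and their distance from uniform\<close>

definition fibre :: "('i \<Rightarrow> 'v) set \<Rightarrow> 'i \<Rightarrow> 'v \<Rightarrow> ('i \<Rightarrow> 'v) set" where
  "fibre P i a = {x \<in> P. x i = a}"

definition freq :: "('i \<Rightarrow> 'v) set \<Rightarrow> 'i \<Rightarrow> 'v \<Rightarrow> real" where
  "freq P i a = real (card (fibre P i a)) / real (card P)"

definition deviation :: "'v set \<Rightarrow> ('i \<Rightarrow> 'v) set \<Rightarrow> 'i \<Rightarrow> real" where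
  "deviation V P i = (\<Sum>a\<in>V. \<bar>freq P i a - 1 / real (card V)\<bar>)"

lemma avg_coordinate:
  assumes "finite P" "finite V" "(\<lambda>x. x i) ` P \<subseteq> V"
  shows "avg P (\<lambda>x. g (x i)) = (\<Sum>a\<in>V. freq P i a * g a)"
proof -
  have "(\<Sum>a\<in>V. real (card (fibre P i a)) * g a) = (\<Sum>a\<in>V. \<Sum>x\<in>{x\<in>P. x i = a}. g (x i))"
    by (intro sum.cong) (auto simp: fibre_def)
  also have "\<dots> = (\<Sum>x\<in>P. g (x i))" using assms by (intro sum.group) auto
  finally have "(\<Sum>a\<in>V. real (card (fibre P i a)) * g a) / card P = avg P (\<lambda>x. g (x i))"
    by (simp add: avg_def)
  then show ?thesis unfolding freq_def by (simp add: sum_divide_distrib)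
qed

text \<open>The L1 distance from uniform is attained by testing with signs, and
  \<open>sum_avg_le\<close> allows tests that depend on \<open>P\<close>. Centring the signs on
  \<open>U\<close> and halving them keeps them within [-1, 1]; the halving accounts for the factor
  2. In the application the coordinates outside \<open>J\<close> are those of the other
  stages.\<close>

lemma sum_deviation_le:
  assumes I: "finite I" "J \<subseteq> I" and V: "\<And>i. i \<in> I \<Longrightarrow> finite (V i)" "\<And>i. i \<in> I \<Longrightarrow> V i \<noteq> {}"
    and J: "\<And>i. i \<in> J \<Longrightarrow> V i = U" and l: "0 < l" "l \<le> 1"
    and P: "P \<subseteq> Pi\<^sub>E I V" "P \<noteq> {}" "real (card (Pi\<^sub>E I V)) \<le> exp D * real (card P)"
  shows "(\<Sum>i\<in>J. deviation U P i) \<le> 2 * (D / l + l * real (card J))"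
proof -
  define sg where "sg i a = sgn (freq P i a - 1 / real (card U))" for i a
  define u where "u i a = (sg i a - avg U (sg i)) / 2" for i a
  have fP: "finite P" using P I V finite_PiE[of I V] finite_subset by blast
  have U: "finite U" "U \<noteq> {}" if "i \<in> J" for i using that I V J by blast+
  have "\<bar>sg i a\<bar> \<le> 1" for i a by (simp add: sg_def abs_sgn_eq)
  then have sg: "\<bar>sg i a\<bar> \<le> 1 \<and> \<bar>avg U (sg i)\<bar> \<le> 1" if "i \<in> J" for i a
    using avg_mono[of U "sg i" "\<lambda>_. 1"] avg_mono[of U "\<lambda>_. - 1" "sg i"] avg_const[OF U[OF that]]
    by (metis abs_le_iff minus_le_iff)
  have u1: "\<bar>u i a\<bar> \<le> 1" if "i \<in> J" for i a
    using sg[OF that, of a] unfolding u_def abs_le_iff by auto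
  have u0: "(\<Sum>a\<in>U. u i a) = 0" if "i \<in> J" for i
    using U[OF that] by (simp add: u_def sum_divide_distrib[symmetric] sum_subtractf avg_def)
  have "deviation U P i = 2 * avg P (\<lambda>x. u i (x i))" if i: "i \<in> J" for i
  proof -
    have sub: "(\<lambda>x. x i) ` P \<subseteq> U" using P I J[OF i] i by fastforce
    have "2 * avg P (\<lambda>x. u i (x i)) = avg P (\<lambda>x. sg i (x i) - avg U (sg i))"
      unfolding avg_cmult[symmetric] u_def by (simp only: times_divide_eq_right nonzero_mult_div_cancel_left zero_neq_numeral not_False_eq_True)
    also have "\<dots> = avg P (\<lambda>x. sg i (x i)) - avg U (sg i)"
      unfolding avg_diff using fP P by (simp add: avg_const)
    also have "avg P (\<lambda>x. sg i (x i)) = (\<Sum>a\<in>U. freq P i a * sg i a)"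
      by (rule avg_coordinate[OF fP U(1)[OF i] sub])
    also have "avg U (sg i) = (\<Sum>a\<in>U. 1 / real (card U) * sg i a)"
      by (simp add: avg_def sum_divide_distrib)
    finally have "2 * avg P (\<lambda>x. u i (x i)) = (\<Sum>a\<in>U. (freq P i a - 1 / real (card U)) * sg i a)"
      by (simp add: sum_subtractf left_diff_distrib)
    also have "\<dots> = deviation U P i"
      unfolding deviation_def sg_def by (intro sum.cong refl) (simp add: abs_sgn)
    finally show ?thesis by simp
  qed
  then have "(\<Sum>i\<in>J. deviation U P i) = 2 * (\<Sum>i\<in>J. avg P (\<lambda>x. u i (x i)))"
    by (simp add: sum_distrib_left)
  also have "\<dots> \<le> 2 * (D / l + l * real (card J))"
    using sum_avg_le[of I J V u l P D] I V u1 u0 J l P by simp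
  finally show ?thesis .
qed

section \<open>Rectangular functions\<close>

definition rectangular :: "('x \<Rightarrow> 'y \<Rightarrow> nat) \<Rightarrow> bool" where
  "rectangular lab \<longleftrightarrow> (\<forall>x y x' y'. lab x y = lab x' y' \<longrightarrow> lab x y' = lab x y)"

text \<open>The leaves of a protocol of cost \<open>log N\<close> form a rectangular labelling with \<open>N\<close> labels; \<open>simple\<close>
  keeps only this.\<close>

definition simple :: "nat \<Rightarrow> ('x \<Rightarrow> 'y \<Rightarrow> 'b) \<Rightarrow> bool" where
  "simple N f \<longleftrightarrow>
     (\<exists>lab h. rectangular lab \<and> (\<forall>x y. lab x y < N) \<and> (\<forall>x y. f x y = h (lab x y)))"

lemma simpleI:
  assumes "rectangular lab" "\<And>x y. lab x y < N" "\<And>x y. f x y = h (lab x y)" shows "simple N f"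
  using assms unfolding simple_def by blast

lemma rectangularD: "rectangular lab \<Longrightarrow> lab x y = lab x' y' \<Longrightarrow> lab x y' = lab x y"
  unfolding rectangular_def by blast

lemma simple_const: "0 < N \<Longrightarrow> simple N (\<lambda>x y. c)"
  by (rule simpleI[of "\<lambda>_ _. 0" _ _ "\<lambda>_. c"]) (auto simp: rectangular_def)

lemma simple_mono:
  assumes "simple N f" "N \<le> N'" shows "simple N' f"
proof -
  obtain lab h where "rectangular lab" "\<And>x y. lab x y < N" "\<And>x y. f x y = h (lab x y)"
    using assms(1) unfolding simple_def by blast
  then show ?thesis using less_le_trans[OF _ assms(2)] by (intro simpleI[of lab _ _ h]) simp_all
qed

lemma simple_map:
  assumes "simple N f" shows "simple N (\<lambda>x y. g (f x y))"
proof -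
  obtain lab h where "rectangular lab" "\<And>x y. lab x y < N" "\<And>x y. f x y = h (lab x y)"
    using assms unfolding simple_def by blast
  then show ?thesis by (intro simpleI[of lab _ _ "\<lambda>n. g (h n)"]) simp_all
qed

lemma mixed_radix_inj:
  fixes a b :: nat
  assumes "b < n" "b' < n" "a * n + b = a' * n + b'" shows "a = a' \<and> b = b'"
proof -
  have "(a * n + b) div n = a" "(a' * n + b') div n = a'" using assms(1,2) by auto
  then have "a = a'" using assms(3) by simp
  then show ?thesis using assms(3) by simp
qed

text \<open>One round of a protocol: the owners announce \<open>\<alpha> x\<close> and
  \<open>\<beta> y\<close> and go on with the protocol selected by these values. Labels encode both
  announcements and the later label in mixed radix, so equal labels mean equal transcripts.\<close>

lemma simple_branch:
  assumes "finite (range \<alpha>)" "card (range \<alpha>) \<le> n1" "finite (range \<beta>)" "card (range \<beta>) \<le> n2"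
    and F: "\<And>a b. simple N (F a b)"
  shows "simple (n1 * n2 * N) (\<lambda>x y. F (\<alpha> x) (\<beta> y) x y)"
proof -
  have "\<forall>a b. \<exists>lab h. rectangular lab \<and> (\<forall>x y. lab x y < N) \<and> (\<forall>x y. F a b x y = h (lab x y))"
    using F unfolding simple_def by blast
  then obtain lab h where lab: "\<And>a b x y. lab a b x y < N" "\<And>a b. rectangular (lab a b)"
    "\<And>a b x y. F a b x y = h a b (lab a b x y)" by metis
  obtain \<iota> where \<iota>: "inj_on \<iota> (range \<alpha>)" "\<iota> ` range \<alpha> = {0..<card (range \<alpha>)}"
    using ex_bij_betw_finite_nat[OF assms(1)] unfolding bij_betw_def by blast
  obtain \<kappa> where \<kappa>: "inj_on \<kappa> (range \<beta>)" "\<kappa> ` range \<beta> = {0..<card (range \<beta>)}"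
    using ex_bij_betw_finite_nat[OF assms(3)] unfolding bij_betw_def by blast
  have b1: "\<iota> (\<alpha> x) < n1" for x
  proof -
    have "\<iota> (\<alpha> x) \<in> \<iota> ` range \<alpha>" by blast
    then show ?thesis using \<iota>(2) assms(2) by auto
  qed
  have b2: "\<kappa> (\<beta> y) < n2" for y
  proof -
    have "\<kappa> (\<beta> y) \<in> \<kappa> ` range \<beta>" by blast
    then show ?thesis using \<kappa>(2) assms(4) by auto
  qed
  define L where "L x y = (\<iota> (\<alpha> x) * n2 + \<kappa> (\<beta> y)) * N + lab (\<alpha> x) (\<beta> y) x y" for x y
  have L: "\<alpha> x = \<alpha> x' \<and> \<beta> y = \<beta> y' \<and> lab (\<alpha> x) (\<beta> y) x y = lab (\<alpha> x') (\<beta> y') x' y'"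
    if "L x y = L x' y'" for x y x' y'
  proof -
    have *: "\<iota> (\<alpha> x) * n2 + \<kappa> (\<beta> y) = \<iota> (\<alpha> x') * n2 + \<kappa> (\<beta> y')"
      "lab (\<alpha> x) (\<beta> y) x y = lab (\<alpha> x') (\<beta> y') x' y'"
      using mixed_radix_inj[OF lab(1) lab(1) that[unfolded L_def]] by auto
    then have "\<iota> (\<alpha> x) = \<iota> (\<alpha> x') \<and> \<kappa> (\<beta> y) = \<kappa> (\<beta> y')"
      using mixed_radix_inj[OF b2 b2] by blast
    then show ?thesis using * \<iota>(1) \<kappa>(1) by (auto dest: inj_onD)
  qed
  have "L x y < n1 * n2 * N" for x y
  proof -
    have "\<iota> (\<alpha> x) * n2 + \<kappa> (\<beta> y) + 1 \<le> (\<iota> (\<alpha> x) + 1) * n2" using b2[of y] by simp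
    also have "\<dots> \<le> n1 * n2" using b1[of x] by (intro mult_right_mono) auto
    finally have "(\<iota> (\<alpha> x) * n2 + \<kappa> (\<beta> y) + 1) * N \<le> n1 * n2 * N" by (rule mult_right_mono) simp
    then show ?thesis using lab(1)[of "\<alpha> x" "\<beta> y" x y] by (simp add: L_def)
  qed
  moreover have "rectangular L"
    unfolding rectangular_def
  proof (intro allI impI)
    fix x y x' y' assume that: "L x y = L x' y'"
    note e = L[OF that]
    have "lab (\<alpha> x) (\<beta> y) x y = lab (\<alpha> x) (\<beta> y) x' y'" using e by metis
    then have "lab (\<alpha> x) (\<beta> y) x y' = lab (\<alpha> x) (\<beta> y) x y" by (rule rectangularD[OF lab(2)])
    then show "L x y' = L x y" using e by (simp add: L_def)
  qed
  moreover
  \<comment> \<open>The continuations read their labels in different ways, so a value is chosen for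
    each combined label; equality of transcripts makes the choice immaterial.\<close>
  define g where "g n = (SOME v. \<exists>x y. L x y = n \<and> v = F (\<alpha> x) (\<beta> y) x y)" for n
  have "F (\<alpha> x) (\<beta> y) x y = g (L x y)" for x y
  proof -
    have "\<exists>x' y'. L x' y' = L x y \<and> g (L x y) = F (\<alpha> x') (\<beta> y') x' y'"
      unfolding g_def by (rule someI_ex) blast
    then obtain x' y' where xy: "L x' y' = L x y" "g (L x y) = F (\<alpha> x') (\<beta> y') x' y'" by blast
    show ?thesis using L[OF xy(1)] unfolding xy(2) lab(3) by metis
  qed
  ultimately show ?thesis by (intro simpleI[of L _ _ g])
qed

lemma simple_Pair:
  assumes "simple N f" "simple M g"
  shows "simple (N * M) (\<lambda>x y. (f x y, g x y))"
proof -
  obtain lab h where lab: "rectangular lab" "\<And>x y. lab x y < N" "\<And>x y. f x y = h (lab x y)"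
    using assms(1) unfolding simple_def by blast
  obtain lab' h' where lab': "rectangular lab'" "\<And>x y. lab' x y < M" "\<And>x y. g x y = h' (lab' x y)"
    using assms(2) unfolding simple_def by blast
  define L where "L x y = lab x y * M + lab' x y" for x y
  have L: "lab x y = lab x' y' \<and> lab' x y = lab' x' y'" if "L x y = L x' y'" for x y x' y'
    using mixed_radix_inj[OF lab'(2) lab'(2) that[unfolded L_def]] .
  have "L x y < N * M" for x y
  proof -
    have "(lab x y + 1) * M \<le> N * M" using lab(2)[of x y] by (intro mult_right_mono) simp_all
    then show ?thesis using lab'(2)[of x y] by (simp add: L_def)
  qed
  moreover have "rectangular L"
    unfolding rectangular_def
  proof (intro allI impI)
    fix x y x' y' assume "L x y = L x' y'"
    from L[OF this] have "lab x y' = lab x y" "lab' x y' = lab' x y"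
      by (metis rectangularD[OF lab(1)]) (metis rectangularD[OF lab'(1)] L[OF \<open>L x y = L x' y'\<close>])
    then show "L x y' = L x y" unfolding L_def by (simp only:)
  qed
  moreover have "(f x y, g x y) = (\<lambda>n. (h (n div M), h' (n mod M))) (L x y)" for x y
  proof -
    have "L x y div M = lab x y" "L x y mod M = lab' x y" using lab'(2)[of x y] by (auto simp: L_def)
    then show ?thesis unfolding lab(3) lab'(3) by (simp only:)
  qed
  ultimately show ?thesis by (intro simpleI[of L _ _ "\<lambda>n. (h (n div M), h' (n mod M))"])
qed

lemma simple_family:
  assumes "finite S" "\<And>i. i \<in> S \<Longrightarrow> simple N (f i)"
  shows "simple (N ^ card S) (\<lambda>x y. \<lambda>i\<in>S. f i x y)"
  using assms
proof (induction S rule: finite_induct)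
  case empty
  then show ?case by (auto intro!: simple_const simp: restrict_def)
next
  case (insert i S)
  have "simple (N * N ^ card S) (\<lambda>x y. (f i x y, \<lambda>i\<in>S. f i x y))"
    by (intro simple_Pair insert.prems insert.IH) auto
  from simple_map[OF this, of "\<lambda>(a, g). g(i := a)"]
  have "simple (N * N ^ card S) (\<lambda>x y. (\<lambda>i\<in>S. f i x y)(i := f i x y))" by simp
  moreover have "(\<lambda>i\<in>S. f i x y)(i := f i x y) = (\<lambda>i\<in>insert i S. f i x y)" for x y
    by (auto simp: fun_eq_iff)
  ultimately show ?case using insert.hyps by (simp del: restrict_apply)
qed

section \<open>Leaves as rectangles, and the choice of a large leaf\<close>

definition rows :: "('x \<Rightarrow> 'y \<Rightarrow> nat) \<Rightarrow> 'x set \<Rightarrow> 'y set \<Rightarrow> nat \<Rightarrow> 'x set" where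
  "rows lab Xs Ys n = {x \<in> Xs. \<exists>y\<in>Ys. lab x y = n}"

definition cols :: "('x \<Rightarrow> 'y \<Rightarrow> nat) \<Rightarrow> 'x set \<Rightarrow> 'y set \<Rightarrow> nat \<Rightarrow> 'y set" where
  "cols lab Xs Ys n = {y \<in> Ys. \<exists>x\<in>Xs. lab x y = n}"

lemma mem_rows_cols:
  assumes "rectangular lab" "x \<in> Xs" "y \<in> Ys"
  shows "(x, y) \<in> rows lab Xs Ys n \<times> cols lab Xs Ys n \<longleftrightarrow> lab x y = n"
proof
  assume "(x, y) \<in> rows lab Xs Ys n \<times> cols lab Xs Ys n"
  then obtain x' y' where "lab x y' = n" "lab x' y = n" by (auto simp: rows_def cols_def)
  then show "lab x y = n" using rectangularD[OF assms(1), of x y' x' y] by simp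
next
  assume "lab x y = n"
  then show "(x, y) \<in> rows lab Xs Ys n \<times> cols lab Xs Ys n"
    using assms(2,3) by (auto simp: rows_def cols_def)
qed

lemma avg_rectangle:
  assumes "finite Xs" "finite Ys" "P \<subseteq> Xs" "Q \<subseteq> Ys"
  shows "avg (Xs \<times> Ys) (\<lambda>z. of_bool (z \<in> P \<times> Q))
    = (real (card P) / real (card Xs)) * (real (card Q) / real (card Ys))"
proof -
  have "(\<Sum>z\<in>Xs \<times> Ys. of_bool (z \<in> P \<times> Q) :: real) = (\<Sum>z\<in>P \<times> Q. 1)"
    using assms by (intro sum.mono_neutral_cong_right) auto
  then show ?thesis by (simp add: avg_def card_cartesian_product)
qed

text \<open>The leaves partition \<open>Xs \<times> Ys\<close>, so only the leaf of \<open>z\<close>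
  contributes. This turns averages into sums over leaves.\<close>

lemma sum_leaves:
  assumes "\<And>x y. lab x y < N" "rectangular lab" "z \<in> Xs \<times> Ys"
  shows "(\<Sum>n<N. g n * of_bool (z \<in> rows lab Xs Ys n \<times> cols lab Xs Ys n)) = (g (case_prod lab z) :: real)"
proof -
  obtain x y where z: "z = (x, y)" "x \<in> Xs" "y \<in> Ys" using assms by auto
  have "z \<in> rows lab Xs Ys n \<times> cols lab Xs Ys n \<longleftrightarrow> n = lab x y" for n
    unfolding z(1) using mem_rows_cols[of lab x Xs y Ys n, OF assms(2) z(2,3)] by metis
  then have "(\<Sum>n<N. g n * of_bool (z \<in> rows lab Xs Ys n \<times> cols lab Xs Ys n))
    = (\<Sum>n<N. if n = lab x y then g n else 0)"
    by (intro sum.cong) simp_all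
  also have "\<dots> = g (lab x y)" using assms(1)[of x y] by simp
  finally show ?thesis by (simp add: z(1))
qed

text \<open>A leaf that is thin in one direction has measure at most \<open>\<theta>\<close>. The
  averaging is done with \<open>1 - F\<close>, which is at most 1, whereas \<open>F\<close> has no
  upper bound here; thus the thin leaves carry at most \<open>real N * \<theta>\<close> of its
  mass.\<close>

lemma exists_large_leaf:
  assumes f: "simple N f" and Xs: "finite Xs" "Xs \<noteq> {}" and Ys: "finite Ys" "Ys \<noteq> {}"
    and F: "\<And>z. 0 \<le> F z" and small: "avg (Xs \<times> Ys) F + real N * \<theta> < 1"
    and \<theta>: "0 < \<theta>"
  obtains P Q c where "P \<subseteq> Xs" "Q \<subseteq> Ys" "P \<noteq> {}" "Q \<noteq> {}"
    "\<forall>x\<in>P. \<forall>y\<in>Q. f x y = c"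
    "\<theta> * card Xs \<le> card P" "\<theta> * card Ys \<le> card Q"
    "avg (P \<times> Q) F \<le> avg (Xs \<times> Ys) F + real N * \<theta>"
proof -
  obtain lab h where lab: "rectangular lab" "\<And>x y. lab x y < N" "\<And>x y. f x y = h (lab x y)"
    using f unfolding simple_def by blast
  let ?P = "rows lab Xs Ys" and ?Q = "cols lab Xs Ys"
  define \<mu> where "\<mu> n = avg (Xs \<times> Ys) (\<lambda>z. of_bool (z \<in> ?P n \<times> ?Q n))" for n
  define w where "w n = avg (Xs \<times> Ys) (\<lambda>z. (1 - F z) * of_bool (z \<in> ?P n \<times> ?Q n))" for n
  have sub: "?P n \<subseteq> Xs" "?Q n \<subseteq> Ys" for n by (auto simp: rows_def cols_def)
  have fin: "finite (Xs \<times> Ys)" "Xs \<times> Ys \<noteq> {}" using Xs Ys by auto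
  have \<mu>: "\<mu> n = (real (card (?P n)) / real (card Xs)) * (real (card (?Q n)) / real (card Ys))" for n
    unfolding \<mu>_def using avg_rectangle[OF Xs(1) Ys(1) sub] .
  have cong: "avg (Xs \<times> Ys) g = avg (Xs \<times> Ys) g'" if "\<And>z. z \<in> Xs \<times> Ys \<Longrightarrow> g z = g' z" for g g'
    unfolding avg_def using that by (metis (no_types, lifting) sum.cong)
  have "(\<Sum>n<N. \<mu> n) = avg (Xs \<times> Ys) (\<lambda>z. \<Sum>n<N. 1 * of_bool (z \<in> ?P n \<times> ?Q n))"
    unfolding \<mu>_def avg_sum by simp
  also have "\<dots> = avg (Xs \<times> Ys) (\<lambda>z. 1)"
    by (rule cong) (rule sum_leaves[OF lab(2,1)])
  finally have \<mu>1: "(\<Sum>n<N. \<mu> n) = 1" using fin by (simp add: avg_const)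
  have "(\<Sum>n<N. w n) = avg (Xs \<times> Ys) (\<lambda>z. (1 - F z) * (\<Sum>n<N. 1 * of_bool (z \<in> ?P n \<times> ?Q n)))"
    unfolding w_def avg_sum[symmetric] by (simp only: sum_distrib_left mult_1)
  also have "\<dots> = avg (Xs \<times> Ys) (\<lambda>z. 1 - F z)"
  proof (rule cong)
    fix z assume "z \<in> Xs \<times> Ys"
    then show "(1 - F z) * (\<Sum>n<N. 1 * of_bool (z \<in> ?P n \<times> ?Q n)) = 1 - F z"
      by (subst sum_leaves[OF lab(2,1)]) auto
  qed
  finally have w1: "(\<Sum>n<N. w n) = 1 - avg (Xs \<times> Ys) F"
    using fin unfolding avg_diff by (simp add: avg_const)
  have w\<mu>: "w n \<le> \<mu> n" for n
    unfolding w_def \<mu>_def using F by (intro avg_mono) (auto simp: of_bool_def)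
  define big where "big n \<longleftrightarrow> \<theta> * card Xs \<le> card (?P n) \<and> \<theta> * card Ys \<le> card (?Q n)" for n
  have cX: "real (card Xs) > 0" "real (card Ys) > 0" using Xs Ys by (auto simp: card_gt_0_iff)
  have fr: "real (card (?P n)) / real (card Xs) \<le> 1" "real (card (?Q n)) / real (card Ys) \<le> 1" for n
    using cX card_mono[OF Xs(1) sub(1)] card_mono[OF Ys(1) sub(2)]
    by (simp_all only: pos_divide_le_eq mult_1 of_nat_le_iff)
  have small': "\<mu> n \<le> \<theta>" if "\<not> big n" for n
  proof (cases "real (card (?P n)) / real (card Xs) \<le> \<theta>")
    case True
    then show ?thesis unfolding \<mu>
      using mult_left_le[OF fr(2)[of n], of "real (card (?P n)) / real (card Xs)"] by simp
  next
    case False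
    then have "\<theta> * card Xs \<le> card (?P n)" using cX by (simp add: pos_divide_le_eq)
    then have "card (?Q n) \<le> \<theta> * card Ys" using that unfolding big_def by linarith
    then have "real (card (?Q n)) / real (card Ys) \<le> \<theta>" using cX by (simp add: pos_divide_le_eq)
    then show ?thesis unfolding \<mu>
      using mult_left_le_one_le[OF _ _ fr(1)[of n], of "real (card (?Q n)) / real (card Ys)"] by simp
  qed
  have \<mu>0: "0 \<le> \<mu> n" for n unfolding \<mu> by simp
  \<comment> \<open>\<open>c\<close> is what is sure to remain of the mass of \<open>1 - F\<close>
    without the thin leaves. If every other leaf of positive measure had an average below
    \<open>c\<close>, the total mass would be too small.\<close>
  define c where "c = 1 - avg (Xs \<times> Ys) F - real N * \<theta>"
  have c: "0 < c" using small unfolding c_def by linarith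
  have "\<exists>n<N. big n \<and> c * \<mu> n \<le> w n \<and> 0 < \<mu> n"
  proof (rule ccontr)
    assume "\<not> ?thesis"
    then have *: "\<not> c * \<mu> n \<le> w n \<or> \<not> 0 < \<mu> n" if "n < N" "big n" for n
      using that by blast
    have "w n < c * \<mu> n + \<theta>" if "n < N" for n
    proof (cases "\<mu> n = 0")
      case True
      then show ?thesis using w\<mu>[of n] \<theta> by simp
    next
      case False
      then have \<mu>n: "0 < \<mu> n" using \<mu>0[of n] by linarith
      show ?thesis
      proof (cases "big n")
        case True
        with *[OF that] \<mu>n have "w n < c * \<mu> n" by linarith
        then show ?thesis using \<theta> by linarith
      next
        case False
        from \<mu>n c have "0 < c * \<mu> n" by (rule mult_pos_pos[rotated])
        then show ?thesis using w\<mu>[of n] small'[OF False] by linarith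
      qed
    qed
    moreover have "{..<N} \<noteq> {}" using \<mu>1 by (metis sum.empty zero_neq_one)
    ultimately have "(\<Sum>n<N. w n) < (\<Sum>n<N. c * \<mu> n + \<theta>)" by (intro sum_strict_mono) auto
    also have "\<dots> = c * (\<Sum>n<N. \<mu> n) + real N * \<theta>" by (simp add: sum.distrib sum_distrib_left)
    finally show False unfolding w1 \<mu>1 c_def mult_1_right by linarith
  qed
  then obtain n where n: "big n" "c * \<mu> n \<le> w n" "0 < \<mu> n" by blast
  let ?R = "?P n \<times> ?Q n"
  have ne: "?P n \<noteq> {}" "?Q n \<noteq> {}" using n(3) unfolding \<mu> by auto
  have finR: "finite ?R" "?R \<noteq> {}"
    using ne finite_subset[OF sub(1) Xs(1)] finite_subset[OF sub(2) Ys(1)] by auto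
  have cR: "real (card ?R) > 0" using finR card_gt_0_iff by fastforce
  have cXY: "real (card (Xs \<times> Ys)) > 0" using fin card_gt_0_iff by fastforce
  have "(\<Sum>z\<in>Xs \<times> Ys. (1 - F z) * of_bool (z \<in> ?R)) = (\<Sum>z\<in>?R. 1 - F z)"
    using fin(1) sub[of n] by (intro sum.mono_neutral_cong_right) auto
  then have wn: "w n = (\<Sum>z\<in>?R. 1 - F z) / card (Xs \<times> Ys)" unfolding w_def avg_def by (simp only:)
  have \<mu>n: "\<mu> n = card ?R / card (Xs \<times> Ys)" unfolding \<mu> by (simp add: card_cartesian_product)
  have "c * card ?R \<le> (\<Sum>z\<in>?R. 1 - F z)"
    using n(2) cXY unfolding wn \<mu>n times_divide_eq_right by (simp only: divide_le_cancel)
  then have "c \<le> avg ?R (\<lambda>z. 1 - F z)" using cR unfolding avg_def by (simp only: pos_le_divide_eq)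
  also have "\<dots> = 1 - avg ?R F" unfolding avg_diff avg_const[OF finR] ..
  finally have avg: "avg ?R F \<le> avg (Xs \<times> Ys) F + real N * \<theta>" unfolding c_def by linarith
  have "f x y = h n" if xy: "x \<in> ?P n" "y \<in> ?Q n" for x y
  proof -
    have "x \<in> Xs" "y \<in> Ys" using xy sub by auto
    with mem_rows_cols[OF lab(1) this, of n] xy lab(3) show ?thesis by simp
  qed
  note const = this
  show thesis
  proof (rule that)
    show "?P n \<subseteq> Xs" by (rule sub)
    show "?Q n \<subseteq> Ys" by (rule sub)
    show "?P n \<noteq> {}" by (rule ne)
    show "?Q n \<noteq> {}" by (rule ne)
    show "\<forall>x\<in>?P n. \<forall>y\<in>?Q n. f x y = h n" using const by (intro ballI)
    show "\<theta> * card Xs \<le> card (?P n)" using n(1) unfolding big_def by (rule conjunct1)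
    show "\<theta> * card Ys \<le> card (?Q n)" using n(1) unfolding big_def by (rule conjunct2)
    show "avg ?R F \<le> avg (Xs \<times> Ys) F + real N * \<theta>" by (rule avg)
  qed
qed

section \<open>Planting a pair of tables\<close>

text \<open>Half of the size that uniformity predicts for a fibre: passing to a valid fibre costs a
  factor of at most \<open>2 * card U\<close>.\<close>

definition valid :: "'v set \<Rightarrow> ('i \<Rightarrow> 'v) set \<Rightarrow> 'i \<Rightarrow> 'v \<Rightarrow> bool" where
  "valid U S i a \<longleftrightarrow> 1 / 2 \<le> real (card U) * freq S i a"

definition cond_freq :: "'v set \<Rightarrow> ('i \<Rightarrow> 'v) set \<Rightarrow> ('i \<Rightarrow> 'v) set \<Rightarrow> 'i \<Rightarrow> 'v \<Rightarrow> real" where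
  "cond_freq U S P i a =
     (if valid U S i a then real (card (fibre P i a)) / real (card (fibre S i a)) else 0)"

lemma valid_fibre:
  assumes "valid U S i a" "finite S"
  shows "0 < card (fibre S i a)" "real (card S) \<le> 2 * real (card U) * real (card (fibre S i a))"
    "0 < card S"
proof -
  have "freq S i a \<noteq> 0" using assms by (auto simp: valid_def)
  then show 1: "0 < card (fibre S i a)" "0 < card S" by (auto simp: freq_def)
  then show "real (card S) \<le> 2 * real (card U) * real (card (fibre S i a))"
    using assms(1) by (simp add: valid_def freq_def field_simps)
qed

text \<open>By Bayes' rule the conditional frequency at a valid value is \<open>p * (B / A)\<close>,
  where \<open>A\<close> and \<open>B\<close> are the frequencies in \<open>S\<close> and
  \<open>P\<close> relative to uniform. Only the shortfall below \<open>p\<close> is measured, since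
  lower bounds suffice for planting. The factor 2 pays for invalid values: there
  \<open>A < 1 / 2\<close>, so that \<open>2 * \<bar>A - 1\<bar>\<close> exceeds 1.\<close>

lemma cond_freq_lower:
  assumes S: "finite S" "P \<subseteq> S" "P \<noteq> {}" and U: "finite U" "U \<noteq> {}"
  defines "p \<equiv> real (card P) / real (card S)"
  shows "avg U (\<lambda>a. max 0 (p - cond_freq U S P i a)) \<le> p * (2 * deviation U S i + deviation U P i)"
proof -
  let ?v = "real (card U)"
  have v: "?v > 0" using U by (simp add: card_gt_0_iff)
  have fP: "finite P" using S finite_subset by blast
  have c: "real (card P) > 0" "real (card S) > 0" using S fP by (auto simp: card_gt_0_iff)
  have p: "0 < p" unfolding p_def using c by simp
  have aux: "x \<le> 2 * \<alpha> + \<beta>" if "x \<le> \<alpha> + \<beta>" "0 \<le> \<alpha>" for x \<alpha> \<beta> :: real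
    using that by linarith
  have pt: "max 0 (p - cond_freq U S P i a)
    \<le> ?v * p * (2 * \<bar>freq S i a - 1 / ?v\<bar> + \<bar>freq P i a - 1 / ?v\<bar>)" for a
  proof -
    define A where "A = ?v * freq S i a"
    define B where "B = ?v * freq P i a"
    have AB0: "0 \<le> A" "0 \<le> B" by (simp_all add: A_def B_def freq_def)
    have eA: "?v * \<bar>freq S i a - 1 / ?v\<bar> = \<bar>A - 1\<bar>"
    proof -
      have "?v * (freq S i a - 1 / ?v) = A - 1" using v by (simp add: A_def right_diff_distrib)
      then show ?thesis using abs_mult[of ?v "freq S i a - 1 / ?v"] by simp
    qed
    have eB: "?v * \<bar>freq P i a - 1 / ?v\<bar> = \<bar>B - 1\<bar>"
    proof -
      have "?v * (freq P i a - 1 / ?v) = B - 1" using v by (simp add: B_def right_diff_distrib)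
      then show ?thesis using abs_mult[of ?v "freq P i a - 1 / ?v"] by simp
    qed
    have key: "max 0 (p - cond_freq U S P i a) \<le> p * (2 * \<bar>A - 1\<bar> + \<bar>B - 1\<bar>)"
    proof (cases "valid U S i a")
      case False
      then have "A < 1 / 2" by (simp add: valid_def A_def)
      then have "p * 1 \<le> p * (2 * \<bar>A - 1\<bar> + \<bar>B - 1\<bar>)" using p by (intro mult_left_mono) auto
      then show ?thesis using False p by (simp add: cond_freq_def)
    next
      case True
      then have A: "1 / 2 \<le> A" by (simp add: valid_def A_def)
      have "cond_freq U S P i a = p * (B / A)"
        using True v c valid_fibre(1)[OF True S(1)] by (simp add: cond_freq_def p_def A_def B_def freq_def)
      moreover have "1 - B / A \<le> 2 * \<bar>A - 1\<bar> + \<bar>B - 1\<bar>"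
      proof -
        consider "A \<le> B" | "B < A" "1 \<le> A" | "B < A" "A < 1" by linarith
        then show ?thesis
        proof cases
          case 1
          then have "1 - B / A \<le> 0" using A by (simp add: pos_le_divide_eq)
          also have "0 \<le> 2 * \<bar>A - 1\<bar> + \<bar>B - 1\<bar>" by simp
          finally show ?thesis .
        next
          case 2
          have "1 - B / A = (A - B) / A" using A by (simp add: diff_divide_distrib)
          also have "\<dots> \<le> (A - B) / 1" using 2 by (intro divide_left_mono) auto
          also have "\<dots> \<le> 2 * \<bar>A - 1\<bar> + \<bar>B - 1\<bar>"
            unfolding div_by_1 by (rule aux) auto
          finally show ?thesis .
        next
          case 3
          then have "B * A \<le> B * 1" using AB0 by (intro mult_left_mono) auto
          then have "1 - B / A \<le> 1 - B" using A by (simp add: pos_le_divide_eq)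
          also have "1 - B \<le> 2 * \<bar>A - 1\<bar> + \<bar>B - 1\<bar>" by (rule aux) auto
          finally show ?thesis .
        qed
      qed
      then have "p * (1 - B / A) \<le> p * (2 * \<bar>A - 1\<bar> + \<bar>B - 1\<bar>)"
        using p by (intro mult_left_mono) auto
      moreover have "0 \<le> p * (2 * \<bar>A - 1\<bar> + \<bar>B - 1\<bar>)"
        using p by (intro mult_nonneg_nonneg) auto
      ultimately show ?thesis by (simp add: algebra_simps)
    qed
    have "p * (2 * \<bar>A - 1\<bar> + \<bar>B - 1\<bar>) = ?v * p * (2 * \<bar>freq S i a - 1 / ?v\<bar> + \<bar>freq P i a - 1 / ?v\<bar>)"
      unfolding eA[symmetric] eB[symmetric] by (simp add: algebra_simps)
    with key show ?thesis by simp
  qed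
  have "avg U (\<lambda>a. max 0 (p - cond_freq U S P i a))
    \<le> avg U (\<lambda>a. ?v * p * (2 * \<bar>freq S i a - 1 / ?v\<bar> + \<bar>freq P i a - 1 / ?v\<bar>))"
    by (intro avg_mono pt)
  also have "\<dots> = p * (2 * deviation U S i + deviation U P i)"
    using v by (simp add: avg_def deviation_def sum.distrib sum_distrib_left[symmetric])
  finally show ?thesis .
qed

text \<open>The constant 6 is chosen for \<open>planted_rectangle\<close>: each owner is charged two
  deviations of the whole set and one of the part, and there are two owners. In the application
  \<open>\<sigma>\<close> is the shift by the answer; being a bijection, it makes the value planted
  in \<open>Ys\<close> as uniform as \<open>a\<close>.\<close>

locale planting =
  fixes Xs Ys :: "('i \<Rightarrow> 'v) set" and J :: "'i set" and U :: "'v set" and \<sigma> :: "'v \<Rightarrow> 'v"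
    and \<epsilon> h :: real
  assumes Xs: "finite Xs" "Xs \<noteq> {}" and Ys: "finite Ys" "Ys \<noteq> {}"
    and J: "finite J" "J \<noteq> {}" and U: "finite U" "U \<noteq> {}" and \<sigma>: "bij_betw \<sigma> U U"
    and eps: "0 \<le> \<epsilon>" "\<epsilon> \<le> 1" and h: "0 \<le> h"
    and devX: "\<And>P. P \<subseteq> Xs \<Longrightarrow> P \<noteq> {} \<Longrightarrow> exp (- h) * card Xs \<le> card P \<Longrightarrow> avg J (deviation U P) \<le> \<epsilon> / 6"
    and devY: "\<And>P. P \<subseteq> Ys \<Longrightarrow> P \<noteq> {} \<Longrightarrow> exp (- h) * card Ys \<le> card P \<Longrightarrow> avg J (deviation U P) \<le> \<epsilon> / 6"
begin

text \<open>The tuples with \<open>\<not> valid\<close> count as 0, so \<open>planted 1\<close> may be less than 1; this is why tests are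
  stated for \<open>M - f\<close>.\<close>

definition planted_at :: "(('i \<Rightarrow> 'v) \<times> ('i \<Rightarrow> 'v) \<Rightarrow> real) \<Rightarrow> 'i \<Rightarrow> 'i \<Rightarrow> 'v \<Rightarrow> real" where
  "planted_at f i j a = (if valid U Xs i a \<and> valid U Ys j (\<sigma> a)
     then avg (fibre Xs i a \<times> fibre Ys j (\<sigma> a)) f else 0)"

definition planted :: "(('i \<Rightarrow> 'v) \<times> ('i \<Rightarrow> 'v) \<Rightarrow> real) \<Rightarrow> real" where
  "planted f = avg J (\<lambda>i. avg J (\<lambda>j. avg U (\<lambda>a. planted_at f i j a)))"

lemma planted_add: "planted (\<lambda>z. f z + g z) = planted f + planted g"
proof -
  have "planted_at (\<lambda>z. f z + g z) i j a = planted_at f i j a + planted_at g i j a" for i j a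
    by (simp add: planted_at_def avg_add)
  then show ?thesis by (simp add: planted_def avg_add)
qed

lemma planted_cmult: "planted (\<lambda>z. c * f z) = c * planted f"
proof -
  have "planted_at (\<lambda>z. c * f z) i j a = c * planted_at f i j a" for i j a
    by (simp add: planted_at_def avg_cmult)
  then show ?thesis by (simp add: planted_def avg_cmult)
qed

lemma planted_zero: "planted (\<lambda>z. 0) = 0"
  using planted_cmult[of 0 "\<lambda>_. 0"] by simp

lemma planted_cong:
  assumes "\<And>z. z \<in> Xs \<times> Ys \<Longrightarrow> f z = g z" shows "planted f = planted g"
proof -
  have "avg (fibre Xs i a \<times> fibre Ys j b) f = avg (fibre Xs i a \<times> fibre Ys j b) g" for i j a b
    unfolding avg_def using assms by (intro arg_cong2[where f = "(/)"] sum.cong refl) (auto simp: fibre_def)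
  then have "planted_at f = planted_at g" unfolding planted_at_def by (intro ext) (simp only:)
  then show ?thesis by (simp only: planted_def)
qed

text \<open>The factors \<open>g i a\<close> and \<open>k j (\<sigma> a)\<close> share
  \<open>a\<close>, so the average of their product does not factor. The pointwise bound
  \<open>pt\<close> separates them by charging each shortfall on its own, and these averages use
  only that \<open>a\<close> and \<open>\<sigma> a\<close> are both uniform.\<close>

lemma planted_rectangle:
  assumes P: "P \<subseteq> Xs" "P \<noteq> {}" "exp (- h) * card Xs \<le> card P"
    and Q: "Q \<subseteq> Ys" "Q \<noteq> {}" "exp (- h) * card Ys \<le> card Q"
  shows "(1 - \<epsilon>) * (real (card P) / card Xs * (real (card Q) / card Ys))
    \<le> planted (\<lambda>z. of_bool (z \<in> P \<times> Q))"
proof -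
  define p where "p = real (card P) / card Xs"
  define q where "q = real (card Q) / card Ys"
  have pq: "0 \<le> p" "0 \<le> q" by (simp_all add: p_def q_def)
  define g where "g i a = cond_freq U Xs P i a" for i a
  define k where "k j b = cond_freq U Ys Q j b" for j b
  define \<delta> where "\<delta> i = avg U (\<lambda>a. max 0 (p - g i a))" for i
  define \<gamma> where "\<gamma> j = avg U (\<lambda>a. max 0 (q - k j a))" for j
  have fin: "finite (fibre Xs i a)" "finite (fibre Ys j b)" for i j a b
    using Xs Ys by (simp_all add: fibre_def)
  have at: "planted_at (\<lambda>z. of_bool (z \<in> P \<times> Q)) i j a = g i a * k j (\<sigma> a)" for i j a
  proof -
    have "avg (fibre Xs i a \<times> fibre Ys j (\<sigma> a)) (\<lambda>z. of_bool (z \<in> P \<times> Q))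
      = avg (fibre Xs i a \<times> fibre Ys j (\<sigma> a)) (\<lambda>z. of_bool (z \<in> fibre P i a \<times> fibre Q j (\<sigma> a)))"
      unfolding avg_def by (intro arg_cong2[where f = "(/)"] sum.cong refl) (auto simp: fibre_def)
    also have "\<dots> = (real (card (fibre P i a)) / card (fibre Xs i a)) *
        (real (card (fibre Q j (\<sigma> a))) / card (fibre Ys j (\<sigma> a)))"
      using fin P Q by (intro avg_rectangle) (auto simp: fibre_def)
    finally show ?thesis by (simp add: planted_at_def g_def k_def cond_freq_def)
  qed
  have pt: "p * q - q * max 0 (p - g i a) - p * max 0 (q - k j b) \<le> g i a * k j b" for i j a b
  proof -
    have gk: "0 \<le> g i a" "0 \<le> k j b" by (simp_all add: g_def k_def cond_freq_def)
    consider "p \<le> g i a" "q \<le> k j b" | "p \<le> g i a" "k j b < q" | "g i a < p" "q \<le> k j b"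
      | "g i a < p" "k j b < q" by linarith
    then show ?thesis
    proof cases
      case 1
      then have "p * q \<le> g i a * k j b" using pq by (intro mult_mono) auto
      then show ?thesis using 1 by simp
    next
      case 2
      then have "p * k j b \<le> g i a * k j b" using gk by (intro mult_right_mono) auto
      then show ?thesis using 2 by (simp add: algebra_simps)
    next
      case 3
      then have "g i a * q \<le> g i a * k j b" using gk by (intro mult_left_mono) auto
      then show ?thesis using 3 by (simp add: algebra_simps)
    next
      case 4
      then have "0 \<le> (p - g i a) * (q - k j b)" by (intro mult_nonneg_nonneg) auto
      then show ?thesis using 4 by (simp add: algebra_simps)
    qed
  qed
  have inner: "p * q - q * \<delta> i - p * \<gamma> j \<le> avg U (\<lambda>a. planted_at (\<lambda>z. of_bool (z \<in> P \<times> Q)) i j a)" for i j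
  proof -
    have "(\<Sum>a\<in>U. max 0 (q - k j (\<sigma> a))) = (\<Sum>b\<in>U. max 0 (q - k j b))"
      by (rule sum.reindex_bij_betw[OF \<sigma>, of "\<lambda>b. max 0 (q - k j b)"])
    then have "\<gamma> j = avg U (\<lambda>a. max 0 (q - k j (\<sigma> a)))" by (simp add: \<gamma>_def avg_def)
    then have "p * q - q * \<delta> i - p * \<gamma> j
      = avg U (\<lambda>a. p * q - q * max 0 (p - g i a) - p * max 0 (q - k j (\<sigma> a)))"
      unfolding avg_diff avg_cmult avg_const[OF U] \<delta>_def by simp
    also have "\<dots> \<le> avg U (\<lambda>a. planted_at (\<lambda>z. of_bool (z \<in> P \<times> Q)) i j a)"
      unfolding at by (intro avg_mono pt)
    finally show ?thesis .
  qed
  have "exp (- h) * real (card Xs) \<le> card Xs" "exp (- h) * real (card Ys) \<le> card Ys"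
    using h by (auto intro!: mult_left_le_one_le)
  then have dX: "avg J (deviation U Xs) \<le> \<epsilon> / 6" and dY: "avg J (deviation U Ys) \<le> \<epsilon> / 6"
    using devX[of Xs] devY[of Ys] Xs Ys by auto
  have "avg J \<delta> \<le> avg J (\<lambda>i. p * (2 * deviation U Xs i + deviation U P i))"
    unfolding \<delta>_def g_def p_def using cond_freq_lower[OF Xs(1) P(1,2) U] by (intro avg_mono)
  also have "\<dots> = p * (2 * avg J (deviation U Xs) + avg J (deviation U P))"
    unfolding avg_cmult avg_add ..
  also have "\<dots> \<le> p * (\<epsilon> / 2)" using dX devX[OF P] pq by (intro mult_left_mono) auto
  finally have \<delta>: "q * avg J \<delta> \<le> q * (p * (\<epsilon> / 2))" using pq by (intro mult_left_mono)
  have "avg J \<gamma> \<le> avg J (\<lambda>i. q * (2 * deviation U Ys i + deviation U Q i))"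
    unfolding \<gamma>_def k_def q_def using cond_freq_lower[OF Ys(1) Q(1,2) U] by (intro avg_mono)
  also have "\<dots> = q * (2 * avg J (deviation U Ys) + avg J (deviation U Q))"
    unfolding avg_cmult avg_add ..
  also have "\<dots> \<le> q * (\<epsilon> / 2)" using dY devY[OF Q] pq by (intro mult_left_mono) auto
  finally have \<gamma>: "p * avg J \<gamma> \<le> p * (q * (\<epsilon> / 2))" using pq by (intro mult_left_mono)
  have "(1 - \<epsilon>) * (p * q) \<le> p * q - q * avg J \<delta> - p * avg J \<gamma>"
    using \<delta> \<gamma> by (simp add: algebra_simps)
  also have "\<dots> = avg J (\<lambda>i. avg J (\<lambda>j. p * q - q * \<delta> i - p * \<gamma> j))"
    unfolding avg_diff avg_cmult avg_const[OF J] ..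
  also have "\<dots> \<le> planted (\<lambda>z. of_bool (z \<in> P \<times> Q))"
    unfolding planted_def by (intro avg_mono inner)
  finally show ?thesis unfolding p_def q_def .
qed

text \<open>Leaves of density at least \<open>exp (- h)\<close> on both sides lose a fraction
  \<open>\<epsilon>\<close> of their mass at most, by \<open>planted_rectangle\<close>. Any other
  leaf has mass at most \<open>exp (- h)\<close> and may be lost altogether.\<close>

lemma planted_simple:
  assumes "simple N f"
  shows "avg (Xs \<times> Ys) (\<lambda>(x, y). of_bool (f x y)) - (\<epsilon> + real N * exp (- h))
    \<le> planted (\<lambda>(x, y). of_bool (f x y))"
proof -
  obtain lab g where lab: "rectangular lab" "\<And>x y. lab x y < N" "\<And>x y. f x y = g (lab x y)"
    using assms unfolding simple_def by blast
  define P where "P n = rows lab Xs Ys n" for n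
  define Q where "Q n = cols lab Xs Ys n" for n
  define \<mu> where "\<mu> n = avg (Xs \<times> Ys) (\<lambda>z. of_bool (z \<in> P n \<times> Q n))" for n
  define \<nu> where "\<nu> n = planted (\<lambda>z. of_bool (z \<in> P n \<times> Q n))" for n
  have sub: "P n \<subseteq> Xs" "Q n \<subseteq> Ys" for n by (auto simp: P_def Q_def rows_def cols_def)
  have \<mu>: "\<mu> n = real (card (P n)) / card Xs * (real (card (Q n)) / card Ys)" for n
    unfolding \<mu>_def using avg_rectangle[OF Xs(1) Ys(1) sub] .
  have f: "(\<lambda>(x, y). of_bool (f x y) :: real) z = (\<Sum>n<N. of_bool (g n) * of_bool (z \<in> P n \<times> Q n))"
    if "z \<in> Xs \<times> Ys" for z
    unfolding P_def Q_def sum_leaves[OF lab(2,1) that] by (simp add: lab(3) split: prod.split)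
  have lin: "planted (\<lambda>z. \<Sum>n<m. c n * k n z) = (\<Sum>n<m. c n * planted (k n))" for c :: "nat \<Rightarrow> real" and k m
    by (induction m) (simp_all add: planted_add planted_cmult planted_zero)
  have "planted (\<lambda>(x, y). of_bool (f x y))
    = planted (\<lambda>z. \<Sum>n<N. of_bool (g n) * of_bool (z \<in> P n \<times> Q n))"
    by (rule planted_cong) (rule f)
  also have "\<dots> = (\<Sum>n<N. of_bool (g n) * \<nu> n)" unfolding lin \<nu>_def ..
  finally have \<nu>f: "planted (\<lambda>(x, y). of_bool (f x y)) = (\<Sum>n<N. of_bool (g n) * \<nu> n)" .
  have "avg (Xs \<times> Ys) (\<lambda>(x, y). of_bool (f x y))
    = avg (Xs \<times> Ys) (\<lambda>z. \<Sum>n<N. of_bool (g n) * of_bool (z \<in> P n \<times> Q n))"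
    unfolding avg_def by (intro arg_cong2[where f = "(/)"] sum.cong refl f)
  also have "\<dots> = (\<Sum>n<N. of_bool (g n) * \<mu> n)" unfolding avg_sum avg_cmult \<mu>_def ..
  finally have \<mu>f: "avg (Xs \<times> Ys) (\<lambda>(x, y). of_bool (f x y)) = (\<Sum>n<N. of_bool (g n) * \<mu> n)" .
  have c: "real (card Xs) > 0" "real (card Ys) > 0" using Xs Ys by (auto simp: card_gt_0_iff)
  have fr: "real (card (P n)) / card Xs \<le> 1" "real (card (Q n)) / card Ys \<le> 1" for n
    using c card_mono[OF Xs(1) sub(1)] card_mono[OF Ys(1) sub(2)]
    by (simp_all only: pos_divide_le_eq mult_1 of_nat_le_iff)
  have \<nu>0: "0 \<le> \<nu> n" for n
    unfolding \<nu>_def planted_def planted_at_def avg_def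
    by (intro divide_nonneg_nonneg sum_nonneg) (auto intro!: divide_nonneg_nonneg sum_nonneg)
  have leaf: "of_bool (g n) * \<mu> n - (\<epsilon> * \<mu> n + exp (- h)) \<le> of_bool (g n) * \<nu> n" for n
  proof -
    have \<mu>0: "0 \<le> \<mu> n" by (simp add: \<mu>)
    then have e: "0 \<le> \<epsilon> * \<mu> n" using eps by simp
    have "\<mu> n - \<epsilon> * \<mu> n - exp (- h) \<le> \<nu> n"
    proof (cases "exp (- h) * card Xs \<le> card (P n) \<and> exp (- h) * card Ys \<le> card (Q n)")
      case True
      then have "P n \<noteq> {}" "Q n \<noteq> {}" using c by (auto simp: mult_le_0_iff)
      then have "(1 - \<epsilon>) * \<mu> n \<le> \<nu> n"
        unfolding \<mu> \<nu>_def using True sub by (intro planted_rectangle) auto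
      then have "\<mu> n - \<epsilon> * \<mu> n \<le> \<nu> n" by (simp add: left_diff_distrib)
      then show ?thesis using exp_ge_zero[of "- h"] by linarith
    next
      case False
      then have "real (card (P n)) / card Xs \<le> exp (- h) \<or> real (card (Q n)) / card Ys \<le> exp (- h)"
        using c by (auto simp: pos_divide_le_eq)
      then have "\<mu> n \<le> exp (- h)"
        unfolding \<mu> using mult_left_le[OF fr(2), of "real (card (P n)) / card Xs" n]
          mult_left_le_one_le[OF _ _ fr(1), of "real (card (Q n)) / card Ys" n] by auto
      then show ?thesis using \<nu>0[of n] e by linarith
    qed
    moreover have "- (\<epsilon> * \<mu> n) \<le> exp (- h)" using e exp_ge_zero[of "- h"] by linarith
    ultimately show ?thesis by (cases "g n") auto
  qed
  have "(\<Sum>n<N. \<mu> n) = avg (Xs \<times> Ys) (\<lambda>z. \<Sum>n<N. 1 * of_bool (z \<in> P n \<times> Q n))"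
    unfolding \<mu>_def avg_sum by simp
  also have "\<dots> = avg (Xs \<times> Ys) (\<lambda>z. 1)"
    unfolding avg_def P_def Q_def
    by (intro arg_cong2[where f = "(/)"] sum.cong refl sum_leaves[OF lab(2,1)])
  also have "\<dots> = 1" using Xs Ys by (intro avg_const) auto
  finally have \<mu>1: "(\<Sum>n<N. \<mu> n) = 1" .
  have "(\<Sum>n<N. of_bool (g n) * \<mu> n - (\<epsilon> * \<mu> n + exp (- h))) \<le> (\<Sum>n<N. of_bool (g n) * \<nu> n)"
    by (intro sum_mono leaf)
  also have "(\<Sum>n<N. of_bool (g n) * \<mu> n - (\<epsilon> * \<mu> n + exp (- h)))
    = (\<Sum>n<N. of_bool (g n) * \<mu> n) - (\<epsilon> * (\<Sum>n<N. \<mu> n) + real N * exp (- h))"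
    by (simp add: sum_subtractf sum.distrib sum_distrib_left)
  finally show ?thesis unfolding \<nu>f \<mu>f \<mu>1 by simp
qed

text \<open>Meant for \<open>f\<close> with values between 0 and \<open>M\<close>. The condition is
  homogeneous in \<open>M\<close> and \<open>f\<close> jointly, so nonnegative combinations of
  Boolean tests stay testable with the same \<open>\<delta>\<close>, while their bounds
  \<open>M\<close> combine in the same way.\<close>

definition testable :: "real \<Rightarrow> real \<Rightarrow> (('i \<Rightarrow> 'v) \<times> ('i \<Rightarrow> 'v) \<Rightarrow> real) \<Rightarrow> bool" where
  "testable \<delta> M f \<longleftrightarrow> avg (Xs \<times> Ys) (\<lambda>z. M - f z) - M * \<delta> \<le> planted (\<lambda>z. M - f z)"

lemma testable_simple:
  assumes "simple N f" "\<epsilon> + real N * exp (- h) \<le> \<delta>"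
  shows "testable \<delta> 1 (\<lambda>(x, y). of_bool (f x y))"
proof -
  have "(\<lambda>z. 1 - (\<lambda>(x, y). of_bool (f x y)) z) = (\<lambda>(x, y). of_bool (\<not> f x y) :: real)"
    by (auto simp: fun_eq_iff)
  then show ?thesis
    using planted_simple[OF simple_map[OF assms(1), of Not]] assms(2) by (simp add: testable_def)
qed

lemma testable_add:
  assumes "testable \<delta> M f" "testable \<delta> K g" shows "testable \<delta> (M + K) (\<lambda>z. f z + g z)"
proof -
  have e: "(\<lambda>z. M + K - (f z + g z)) = (\<lambda>z. (M - f z) + (K - g z))" by (simp add: fun_eq_iff)
  show ?thesis using assms unfolding testable_def e planted_add avg_add by (simp add: algebra_simps)
qed

lemma testable_cmult:
  assumes "testable \<delta> M f" "0 \<le> c" shows "testable \<delta> (c * M) (\<lambda>z. c * f z)"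
proof -
  have e: "(\<lambda>z. c * M - c * f z) = (\<lambda>z. c * (M - f z))" by (simp add: fun_eq_iff right_diff_distrib)
  show ?thesis using mult_left_mono[OF assms(1)[unfolded testable_def] assms(2)]
    unfolding testable_def e planted_cmult avg_cmult by (simp add: right_diff_distrib mult.assoc)
qed

lemma testable_sum:
  assumes "finite T" "\<And>k. k \<in> T \<Longrightarrow> testable \<delta> (M k) (f k)"
  shows "testable \<delta> (\<Sum>k\<in>T. M k) (\<lambda>z. \<Sum>k\<in>T. f k z)"
  using assms
proof (induction T rule: finite_induct)
  case empty
  then show ?case by (simp add: testable_def planted_zero avg_def)
next
  case (insert k T)
  then show ?case by (simp add: testable_add)
qed

text \<open>Invalid tuples have \<open>planted_at\<close> equal to 0, whereas the average for
  \<open>M - f\<close> is at least the positive \<open>c\<close>; a tuple that reaches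
  \<open>c\<close> is therefore valid.\<close>

lemma exists_planting:
  assumes "testable \<delta> M f" "avg (Xs \<times> Ys) f + M * \<delta> < M"
  obtains i j a where "i \<in> J" "j \<in> J" "a \<in> U" "valid U Xs i a" "valid U Ys j (\<sigma> a)"
    "avg (fibre Xs i a \<times> fibre Ys j (\<sigma> a)) f \<le> avg (Xs \<times> Ys) f + M * \<delta>"
proof -
  define c where "c = M - avg (Xs \<times> Ys) f - M * \<delta>"
  have c: "0 < c" using assms(2) by (simp add: c_def)
  have XY: "finite (Xs \<times> Ys)" "Xs \<times> Ys \<noteq> {}" using Xs Ys by auto
  have pl: "c \<le> planted (\<lambda>z. M - f z)"
    using assms(1) unfolding testable_def avg_diff avg_const[OF XY] by (simp add: c_def)
  \<comment> \<open>The factor \<open>- 1\<close> turns \<open>exists_le_avg\<close> into the choice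
    of an element that is at least average.\<close>
  from exists_le_avg[OF J, of "\<lambda>i. - 1 * avg J (\<lambda>j. avg U (\<lambda>a. planted_at (\<lambda>z. M - f z) i j a))"]
  obtain i where i: "i \<in> J" "c \<le> avg J (\<lambda>j. avg U (\<lambda>a. planted_at (\<lambda>z. M - f z) i j a))"
    using pl unfolding planted_def avg_cmult by force
  from exists_le_avg[OF J, of "\<lambda>j. - 1 * avg U (\<lambda>a. planted_at (\<lambda>z. M - f z) i j a)"]
  obtain j where j: "j \<in> J" "c \<le> avg U (\<lambda>a. planted_at (\<lambda>z. M - f z) i j a)"
    using i unfolding avg_cmult by force
  from exists_le_avg[OF U, of "\<lambda>a. - 1 * planted_at (\<lambda>z. M - f z) i j a"]
  obtain a where a: "a \<in> U" "c \<le> planted_at (\<lambda>z. M - f z) i j a"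
    using j unfolding avg_cmult by force
  have v: "valid U Xs i a" "valid U Ys j (\<sigma> a)" using a(2) c by (auto simp: planted_at_def split: if_splits)
  have R: "finite (fibre Xs i a \<times> fibre Ys j (\<sigma> a))" "fibre Xs i a \<times> fibre Ys j (\<sigma> a) \<noteq> {}"
    using valid_fibre(1)[OF v(1) Xs(1)] valid_fibre(1)[OF v(2) Ys(1)] by (auto simp: card_gt_0_iff)
  have "planted_at (\<lambda>z. M - f z) i j a = M - avg (fibre Xs i a \<times> fibre Ys j (\<sigma> a)) f"
    using v by (simp add: planted_at_def avg_diff avg_const[OF R])
  then have "avg (fibre Xs i a \<times> fibre Ys j (\<sigma> a)) f \<le> avg (Xs \<times> Ys) f + M * \<delta>"
    using a(2) unfolding c_def by linarith
  with i(1) j(1) a(1) v show thesis by (rule that)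
qed

end

section \<open>Majority votes\<close>

lemma avg_PiE_prod:
  assumes "finite I" "finite R"
  shows "avg (Pi\<^sub>E I (\<lambda>_. R)) (\<lambda>\<rho>. \<Prod>i\<in>I. f (\<rho> i)) = avg R f ^ card I"
proof -
  have "(\<Sum>\<rho>\<in>Pi\<^sub>E I (\<lambda>_. R). \<Prod>i\<in>I. f (\<rho> i)) = (\<Prod>i\<in>I. \<Sum>r\<in>R. f r)"
    using assms by (intro prod_sum_PiE[symmetric])
  then show ?thesis using assms by (simp add: avg_def card_PiE power_divide)
qed

definition disagreement :: "'r set \<Rightarrow> ('r \<Rightarrow> bool) \<Rightarrow> bool \<Rightarrow> real" where
  "disagreement R A b = avg R (\<lambda>r. of_bool (A r \<noteq> b))"

lemma disagreement_bounds:
  assumes "finite R" "R \<noteq> {}"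
  shows "0 \<le> disagreement R A b" "disagreement R A b \<le> 1"
    "disagreement R A (\<not> b) = 1 - disagreement R A b"
proof -
  show "0 \<le> disagreement R A b"
    unfolding disagreement_def avg_def by (intro divide_nonneg_nonneg sum_nonneg) auto
  have "disagreement R A b \<le> avg R (\<lambda>_. 1)" unfolding disagreement_def by (intro avg_mono) auto
  then show "disagreement R A b \<le> 1" unfolding avg_const[OF assms] .
  have "disagreement R A (\<not> b) = avg R (\<lambda>r. 1 - of_bool (A r \<noteq> b))"
    unfolding disagreement_def avg_def by (intro arg_cong2[where f = "(/)"] sum.cong) auto
  then show "disagreement R A (\<not> b) = 1 - disagreement R A b"
    unfolding avg_diff avg_const[OF assms] disagreement_def .
qed

definition majority :: "nat \<Rightarrow> (nat \<Rightarrow> bool) \<Rightarrow> bool" where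
  "majority K v \<longleftrightarrow> card {i\<in>{..<K}. \<not> v i} \<le> card {i\<in>{..<K}. v i}"

lemma majority_neq:
  assumes "majority K v \<noteq> b"
  shows "card {i\<in>{..<K}. v i = b} \<le> card {i\<in>{..<K}. v i \<noteq> b}"
  using assms by (cases b) (auto simp: majority_def)

text \<open>A Chernoff bound with weights \<open>5 / 6\<close> and \<open>6 / 5\<close>: over a
  sample with at least as many wrong votes as right ones their product is at least 1, while one vote
  has average weight at most \<open>5 / 6 + 11 / 30 * (2 / 5) = 49 / 50\<close>.\<close>

lemma majority_error:
  assumes R: "finite R" "R \<noteq> {}" and d: "disagreement R A b \<le> 2 / 5"
  shows "avg (Pi\<^sub>E {..<K} (\<lambda>_. R)) (\<lambda>\<rho>. of_bool (majority K (\<lambda>i. A (\<rho> i)) \<noteq> b)) \<le> (49 / 50) ^ K"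
proof -
  define \<psi> :: "'a \<Rightarrow> real" where "\<psi> r = (if A r = b then 5 / 6 else 6 / 5)" for r
  have "of_bool (majority K (\<lambda>i. A (\<rho> i)) \<noteq> b) \<le> (\<Prod>i<K. \<psi> (\<rho> i))" for \<rho>
  proof (cases "majority K (\<lambda>i. A (\<rho> i)) = b")
    case True
    then show ?thesis by (auto simp: \<psi>_def intro!: prod_nonneg)
  next
    case False
    let ?E = "{i\<in>{..<K}. A (\<rho> i) = b}" and ?N = "{i\<in>{..<K}. A (\<rho> i) \<noteq> b}"
    have le: "card ?E \<le> card ?N" using majority_neq[OF False] .
    have "(\<Prod>i\<in>?E \<union> ?N. \<psi> (\<rho> i)) = (\<Prod>i\<in>?E. \<psi> (\<rho> i)) * (\<Prod>i\<in>?N. \<psi> (\<rho> i))"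
      by (rule prod.union_disjoint) auto
    moreover have "?E \<union> ?N = {..<K}" by auto
    ultimately have "(\<Prod>i<K. \<psi> (\<rho> i)) = (\<Prod>i\<in>?E. \<psi> (\<rho> i)) * (\<Prod>i\<in>?N. \<psi> (\<rho> i))" by simp
    also have "\<dots> = (\<Prod>i\<in>?E. 5 / 6) * (\<Prod>i\<in>?N. 6 / 5)"
      by (intro arg_cong2[where f = "(*)"] prod.cong) (auto simp: \<psi>_def)
    also have "\<dots> = (5 / 6) ^ card ?E * (6 / 5) ^ card ?N" by simp
    finally have e: "(\<Prod>i<K. \<psi> (\<rho> i)) = (5 / 6) ^ card ?E * (6 / 5) ^ card ?N" .
    have "1 = (5 / 6 * (6 / 5) :: real) ^ card ?E" by simp
    also have "\<dots> = (5 / 6) ^ card ?E * (6 / 5 :: real) ^ card ?E" by (rule power_mult_distrib)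
    also have "\<dots> \<le> (5 / 6) ^ card ?E * (6 / 5 :: real) ^ card ?N"
      using le by (intro mult_left_mono power_increasing) auto
    finally show ?thesis using False unfolding e by simp
  qed
  then have "avg (Pi\<^sub>E {..<K} (\<lambda>_. R)) (\<lambda>\<rho>. of_bool (majority K (\<lambda>i. A (\<rho> i)) \<noteq> b))
    \<le> avg (Pi\<^sub>E {..<K} (\<lambda>_. R)) (\<lambda>\<rho>. \<Prod>i<K. \<psi> (\<rho> i))" by (intro avg_mono)
  also have "\<dots> = avg R \<psi> ^ K" using avg_PiE_prod[of "{..<K}" R \<psi>] R by simp
  also have "avg R \<psi> = avg R (\<lambda>r. 5 / 6 + 11 / 30 * of_bool (A r \<noteq> b))"
    unfolding avg_def by (intro arg_cong2[where f = "(/)"] sum.cong) (auto simp: \<psi>_def)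
  also have "\<dots> = 5 / 6 + 11 / 30 * disagreement R A b"
    unfolding avg_add avg_cmult avg_const[OF R] disagreement_def ..
  also have "(5 / 6 + 11 / 30 * disagreement R A b) ^ K \<le> (49 / 50) ^ K"
    using d disagreement_bounds(1)[OF R] by (intro power_mono) auto
  finally show ?thesis .
qed

text \<open>The majority vote of a sample disagrees with three fifths of the votes at most, unless the
  sample is exceptional. Nothing is assumed on the fraction of votes for either answer.\<close>

lemma majority_moment:
  assumes R: "finite R" "R \<noteq> {}"
  shows "avg (Pi\<^sub>E {..<26 * k} (\<lambda>_. R))
      (\<lambda>\<rho>. (3 / 2 * disagreement R A (majority (26 * k) (\<lambda>i. A (\<rho> i)))) ^ k) \<le> 2 * (9 / 10) ^ k"
    (is "avg ?P ?f \<le> _")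
proof -
  have P: "finite ?P" "?P \<noteq> {}" using R by (auto intro!: finite_PiE simp: PiE_eq_empty_iff)
  note bd = disagreement_bounds[OF R, of A]
  show ?thesis
  proof (cases "disagreement R A True \<le> 3 / 5 \<and> disagreement R A False \<le> 3 / 5")
    \<comment> \<open>A close vote: either answer is tolerable, as
      \<open>3 / 2 * (3 / 5) = 9 / 10\<close>. Otherwise one answer has disagreement at most
      \<open>2 / 5\<close>, and the sample finds it.\<close>
    case True
    then have "disagreement R A b \<le> 3 / 5" for b by (cases b) simp_all
    then have "3 / 2 * disagreement R A b \<le> 9 / 10" for b by (rule order_trans[OF mult_left_mono]) auto
    then have "?f \<rho> \<le> (9 / 10) ^ k" for \<rho> using bd(1) by (intro power_mono) simp_all
    then have "avg ?P ?f \<le> avg ?P (\<lambda>_. (9 / 10) ^ k)" by (intro avg_mono)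
    also have "\<dots> = (9 / 10) ^ k" using avg_const[OF P] .
    also have "\<dots> \<le> 2 * (9 / 10) ^ k" by simp
    finally show ?thesis .
  next
    case False
    obtain b where b: "disagreement R A b \<le> 2 / 5"
    proof (cases "disagreement R A True \<le> 3 / 5")
      case True
      then have "3 / 5 < disagreement R A False" using False by simp
      then show thesis using bd(3)[of False] that[of True] by simp
    next
      case False
      then show thesis using bd(3)[of True] that[of False] by simp
    qed
    have "?f \<rho> \<le> (9 / 10) ^ k + (3 / 2) ^ k * of_bool (majority (26 * k) (\<lambda>i. A (\<rho> i)) \<noteq> b)" for \<rho>
    proof (cases "majority (26 * k) (\<lambda>i. A (\<rho> i)) = b")
      case True
      have "(3 / 2 * disagreement R A b) ^ k \<le> (9 / 10) ^ k"
          using b bd(1)[of b] by (intro power_mono) simp_all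
      then show ?thesis using True by simp
    next
      case False
      have "?f \<rho> \<le> (3 / 2) ^ k"
        using bd(1,2) by (intro power_mono) auto
      then show ?thesis using False by (simp add: add_increasing)
    qed
    then have "avg ?P ?f
      \<le> avg ?P (\<lambda>\<rho>. (9 / 10) ^ k + (3 / 2) ^ k * of_bool (majority (26 * k) (\<lambda>i. A (\<rho> i)) \<noteq> b))"
      by (intro avg_mono)
    also have "\<dots> \<le> (9 / 10) ^ k + (3 / 2) ^ k * (49 / 50) ^ (26 * k)"
      unfolding avg_add avg_cmult avg_const[OF P]
      using majority_error[OF R b, of "26 * k"] by (intro add_left_mono mult_left_mono) auto
    also have "(3 / 2) ^ k * (49 / 50) ^ (26 * k) = (3 / 2 * (49 / 50) ^ 26 :: real) ^ k"
      unfolding power_mult power_mult_distrib ..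
    \<comment> \<open>26 is the least exponent for which \<open>3 / 2 * (49 / 50) ^ 26\<close> is at
      most \<open>9 / 10\<close>.\<close>
    also have "(3 / 2 * (49 / 50) ^ 26 :: real) ^ k \<le> (9 / 10) ^ k"
      by (intro power_mono) (simp_all add: power_divide)
    finally show ?thesis by simp
  qed
qed

section \<open>Stages\<close>

definition words :: "nat \<Rightarrow> bool list set" where "words d = {y. length y = d}"

lemma finite_words: "finite (words d)" and card_words: "card (words d) = 2 ^ d"
  using finite_lists_length_eq[of "UNIV :: bool set" d] card_lists_length_eq[of "UNIV :: bool set" d]
  by (simp_all add: words_def)

lemma words_nonempty: "words d \<noteq> {}"
  using card_words[of d] by auto

definition seeds :: "nat \<Rightarrow> bool list set" where "seeds d = words (100 * (d + 1))"

text \<open>The number \<open>length w div 100 - 1\<close> is the stage of a seed \<open>w\<close>,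
  so one dependent product can hold the tables of all stages.\<close>

definition tables :: "bool list \<Rightarrow> bool list set set" where
  "tables w = Pow (words (length w div 100 - 1))"

lemma tables_seeds: "w \<in> seeds d \<Longrightarrow> tables w = Pow (words d)"
  by (simp add: tables_def seeds_def words_def)

definition profiles :: "nat \<Rightarrow> (bool list \<Rightarrow> bool list set) set" where
  "profiles H = Pi\<^sub>E (\<Union>d<H. seeds d) tables"

lemma finite_seeds: "finite (seeds d)" and seeds_nonempty: "seeds d \<noteq> {}"
  by (simp_all add: seeds_def finite_words words_nonempty)

lemma card_seeds: "card (seeds d) = 2 ^ (100 * (d + 1))"
  by (simp add: seeds_def card_words)

lemma tables_finite: "finite (tables w)" and tables_nonempty: "tables w \<noteq> {}"
  by (auto simp: tables_def finite_words)

lemma finite_profiles: "finite (profiles H)"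
  unfolding profiles_def by (intro finite_PiE) (simp_all add: finite_seeds tables_finite)

lemma profiles_nonempty: "profiles H \<noteq> {}"
  unfolding profiles_def by (simp add: PiE_eq_empty_iff tables_nonempty)

definition xor_set :: "'a set \<Rightarrow> 'a set \<Rightarrow> 'a set" where
  "xor_set a b = {y. (y \<in> a) \<noteq> (y \<in> b)}"

lemma xor_set_cancel: "xor_set a (xor_set a b) = b"
  by (auto simp: xor_set_def)

lemma bij_betw_xor_set:
  assumes "c \<subseteq> W" shows "bij_betw (\<lambda>a. xor_set a c) (Pow W) (Pow W)"
  using assms by (intro bij_betwI[where g = "\<lambda>a. xor_set a c"]) (auto simp: xor_set_def)

text \<open>The number of labels allows \<open>2 ^ length y\<close> bits from each of the two
  owners; \<open>y\<close> will stand for a computation of at most that time.\<close>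

locale randomized_protocols =
  fixes acc :: "bool list \<Rightarrow> 'r \<Rightarrow> (bool list \<Rightarrow> bool list set) \<Rightarrow> (bool list \<Rightarrow> bool list set) \<Rightarrow> bool"
    and Rn :: "bool list \<Rightarrow> 'r set"
  assumes finite_Rn: "finite (Rn y)" and Rn_nonempty: "Rn y \<noteq> {}"
    and acc_simple: "r \<in> Rn y \<Longrightarrow> simple (4 ^ 2 ^ length y) (acc y r)"
begin

definition err :: "bool list \<Rightarrow> bool \<Rightarrow> (bool list \<Rightarrow> bool list set) \<times> (bool list \<Rightarrow> bool list set) \<Rightarrow> real" where
  "err y b z = disagreement (Rn y) (\<lambda>r. acc y r (fst z) (snd z)) b"

lemma err_bounds: "0 \<le> err y b z" "err y b z \<le> 1"
  unfolding err_def using disagreement_bounds[OF finite_Rn Rn_nonempty] by auto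

text \<open>\<open>14 * d + 28 = 7 * (2 * d + 4)\<close> and
  \<open>(9 / 10) ^ 7 \<le> 1 / 2\<close>; this yields the bound \<open>(1 / 2) ^ (d + 3)\<close> in
  \<open>sampling_bound\<close>.\<close>

definition rounds :: "nat \<Rightarrow> nat" where "rounds d = 14 * d + 28"

text \<open>The factor \<open>3 / 2\<close> lifts every error probability of at least
  \<open>2 / 3\<close> to at least 1, so a sum below 1 excludes them for all words at once. The
  exponent grows with \<open>d\<close> in order to outweigh the \<open>2 ^ d\<close>
  summands.\<close>

definition pot :: "nat \<Rightarrow> bool list set \<Rightarrow> (bool list \<Rightarrow> bool list set) \<times> (bool list \<Rightarrow> bool list set) \<Rightarrow> real" where
  "pot d s z = (\<Sum>y\<in>words d. (3 / 2 * err y (y \<in> s) z) ^ rounds d)"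

lemma pot_nonneg: "0 \<le> pot d s z"
  unfolding pot_def using err_bounds by (intro sum_nonneg zero_le_power) auto

lemma err_if_pot:
  assumes "pot d s z < 1" "y \<in> words d" shows "err y (y \<in> s) z < 2 / 3"
proof (rule ccontr)
  assume "\<not> ?thesis"
  then have "1 \<le> (3 / 2 * err y (y \<in> s) z) ^ rounds d" by (intro one_le_power) auto
  also have "\<dots> \<le> pot d s z"
    unfolding pot_def using err_bounds assms(2) finite_words
    by (intro member_le_sum zero_le_power) auto
  finally show False using assms(1) by simp
qed

text \<open>The power is the probability that \<open>k\<close> independent runs all contradict
  \<open>b\<close>, up to the factor \<open>(3 / 2) ^ k\<close>. As a nonnegative combination of
  Boolean simple functions it has the form that \<open>testable_sum\<close> and
  \<open>testable_cmult\<close> handle.\<close>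

lemma err_power:
  "(3 / 2 * err y b z) ^ k = (\<Sum>\<rho>\<in>Pi\<^sub>E {..<k} (\<lambda>_. Rn y).
     (3 / 2) ^ k / real (card (Rn y)) ^ k * (\<lambda>(Xs, Ys). of_bool (\<forall>i<k. acc y (\<rho> i) Xs Ys \<noteq> b)) z)"
proof -
  have prod: "(\<Prod>i<k. of_bool (acc y (\<rho> i) (fst z) (snd z) \<noteq> b)) =
    (\<lambda>(Xs, Ys). of_bool (\<forall>i<k. acc y (\<rho> i) Xs Ys \<noteq> b) :: real) z" for \<rho>
    by (induction k) (auto simp: less_Suc_eq split: prod.split)
  have "err y b z ^ k = avg (Pi\<^sub>E {..<k} (\<lambda>_. Rn y)) (\<lambda>\<rho>. \<Prod>i<k. of_bool (acc y (\<rho> i) (fst z) (snd z) \<noteq> b))"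
    unfolding err_def disagreement_def
    using avg_PiE_prod[OF finite_lessThan finite_Rn, of k y "\<lambda>r. of_bool (acc y r (fst z) (snd z) \<noteq> b)"]
    unfolding card_lessThan by (rule sym)
  also have "\<dots> = (\<Sum>\<rho>\<in>Pi\<^sub>E {..<k} (\<lambda>_. Rn y).
      1 / real (card (Rn y)) ^ k * (\<lambda>(Xs, Ys). of_bool (\<forall>i<k. acc y (\<rho> i) Xs Ys \<noteq> b)) z)"
    unfolding prod by (simp add: avg_def card_PiE sum_divide_distrib)
  finally have e: "err y b z ^ k = \<dots>" .
  show ?thesis unfolding power_mult_distrib e sum_distrib_left mult.assoc[symmetric] by simp
qed

lemma simple_rejections:
  assumes "\<rho> \<in> Pi\<^sub>E {..<k} (\<lambda>_. Rn y)"
  shows "simple ((4 ^ 2 ^ length y) ^ k) (\<lambda>Xs Ys. \<forall>i<k. acc y (\<rho> i) Xs Ys \<noteq> b)"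
proof -
  have "simple ((4 ^ 2 ^ length y) ^ card {..<k}) (\<lambda>Xs Ys. \<lambda>i\<in>{..<k}. acc y (\<rho> i) Xs Ys)"
    using assms by (intro simple_family acc_simple) auto
  from simple_map[OF this, of "\<lambda>v. \<forall>i<k. v i \<noteq> b"] show ?thesis by simp
qed

lemma testable_pot:
  assumes "planting Xs Ys J U \<sigma> \<epsilon> h" and \<delta>: "\<epsilon> + (4 ^ 2 ^ d) ^ rounds d * exp (- h) \<le> \<delta>"
  shows "planting.testable Xs Ys J U \<sigma> \<delta> (2 ^ d * (3 / 2) ^ rounds d) (pot d s)"
proof -
  interpret planting Xs Ys J U \<sigma> \<epsilon> h by fact
  let ?P = "\<lambda>y. Pi\<^sub>E {..<rounds d} (\<lambda>_. Rn y)"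
  let ?c = "\<lambda>y. (3 / 2) ^ rounds d / real (card (Rn y)) ^ rounds d"
  have "testable \<delta> ((3 / 2) ^ rounds d) (\<lambda>z. (3 / 2 * err y (y \<in> s) z) ^ rounds d)" if y: "y \<in> words d" for y
  proof -
    have fin: "finite (?P y)" using finite_Rn by (intro finite_PiE) auto
    have "testable \<delta> (\<Sum>\<rho>\<in>?P y. ?c y * 1)
      (\<lambda>z. \<Sum>\<rho>\<in>?P y. ?c y * (\<lambda>(Xs, Ys). of_bool (\<forall>i<rounds d. acc y (\<rho> i) Xs Ys \<noteq> (y \<in> s))) z)"
    proof (intro testable_sum testable_cmult fin)
      fix \<rho> assume "\<rho> \<in> ?P y"
      from simple_rejections[OF this] y
      have "simple ((4 ^ 2 ^ d) ^ rounds d) (\<lambda>Xs Ys. \<forall>i<rounds d. acc y (\<rho> i) Xs Ys \<noteq> (y \<in> s))"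
        by (simp add: words_def)
      then show "testable \<delta> 1 (\<lambda>(Xs, Ys). of_bool (\<forall>i<rounds d. acc y (\<rho> i) Xs Ys \<noteq> (y \<in> s)))"
        by (rule testable_simple) (use \<delta> in simp)
    qed auto
    moreover have "(\<Sum>\<rho>\<in>?P y. ?c y * 1) = (3 / 2) ^ rounds d"
      using finite_Rn[of y] Rn_nonempty[of y] by (simp add: card_PiE)
    ultimately show ?thesis unfolding err_power by (simp only:)
  qed
  then have "testable \<delta> (\<Sum>y\<in>words d. (3 / 2) ^ rounds d) (\<lambda>z. \<Sum>y\<in>words d. (3 / 2 * err y (y \<in> s) z) ^ rounds d)"
    by (intro testable_sum finite_words)
  then show ?thesis unfolding pot_def by (simp add: card_words)
qed

text \<open>\<open>majority_moment\<close> holds at every point for a random sample; exchanging the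
  averages fixes one sample per word that is good on average over \<open>Xs \<times> Ys\<close>.
  With fixed samples the answer is computed by a deterministic protocol made of
  \<open>2 ^ d * (26 * rounds d)\<close> runs.\<close>

lemma sampling_step:
  assumes Xs: "finite Xs" "Xs \<noteq> {}" and Ys: "finite Ys" "Ys \<noteq> {}"
  obtains s where "simple ((4 ^ 2 ^ d) ^ (2 ^ d * (26 * rounds d))) s" "\<forall>x y. s x y \<subseteq> words d"
    "avg (Xs \<times> Ys) (\<lambda>z. pot d (s (fst z) (snd z)) z) \<le> 2 ^ d * (2 * (9 / 10) ^ rounds d)"
proof -
  let ?k = "rounds d"
  let ?m = "\<lambda>y \<rho> z. majority (26 * ?k) (\<lambda>i. acc y (\<rho> i) (fst z) (snd z))"
  have XY: "finite (Xs \<times> Ys)" "Xs \<times> Ys \<noteq> {}" using Xs Ys by auto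
  have "\<exists>\<rho>\<in>Pi\<^sub>E {..<26 * ?k} (\<lambda>_. Rn y).
      avg (Xs \<times> Ys) (\<lambda>z. (3 / 2 * err y (?m y \<rho> z) z) ^ ?k) \<le> 2 * (9 / 10) ^ ?k" for y
  proof -
    let ?P = "Pi\<^sub>E {..<26 * ?k} (\<lambda>_. Rn y)"
    have P: "finite ?P" "?P \<noteq> {}"
      using finite_Rn Rn_nonempty by (auto intro!: finite_PiE simp: PiE_eq_empty_iff)
    have "avg ?P (\<lambda>\<rho>. avg (Xs \<times> Ys) (\<lambda>z. (3 / 2 * err y (?m y \<rho> z) z) ^ ?k))
      = avg (Xs \<times> Ys) (\<lambda>z. avg ?P (\<lambda>\<rho>. (3 / 2 * err y (?m y \<rho> z) z) ^ ?k))" by (rule avg_swap)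
    also have "\<dots> \<le> avg (Xs \<times> Ys) (\<lambda>z. 2 * (9 / 10) ^ ?k)"
      unfolding err_def by (intro avg_mono majority_moment finite_Rn Rn_nonempty)
    also have "\<dots> = 2 * (9 / 10) ^ ?k" by (rule avg_const[OF XY])
    finally have le: "avg ?P (\<lambda>\<rho>. avg (Xs \<times> Ys) (\<lambda>z. (3 / 2 * err y (?m y \<rho> z) z) ^ ?k)) \<le> 2 * (9 / 10) ^ ?k" .
    from exists_le_avg[OF P] obtain \<rho> where "\<rho> \<in> ?P"
      "avg (Xs \<times> Ys) (\<lambda>z. (3 / 2 * err y (?m y \<rho> z) z) ^ ?k)
        \<le> avg ?P (\<lambda>\<rho>. avg (Xs \<times> Ys) (\<lambda>z. (3 / 2 * err y (?m y \<rho> z) z) ^ ?k))" by (rule bexE)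
    with le show ?thesis by (intro bexI[of _ \<rho>]) (rule order_trans)
  qed
  then have "\<forall>y. \<exists>\<rho>. \<rho> \<in> Pi\<^sub>E {..<26 * ?k} (\<lambda>_. Rn y) \<and>
      avg (Xs \<times> Ys) (\<lambda>z. (3 / 2 * err y (?m y \<rho> z) z) ^ ?k) \<le> 2 * (9 / 10) ^ ?k" by (simp only: Bex_def simp_thms)
  from choice[OF this] obtain \<rho> where "\<forall>y. \<rho> y \<in> Pi\<^sub>E {..<26 * ?k} (\<lambda>_. Rn y) \<and>
      avg (Xs \<times> Ys) (\<lambda>z. (3 / 2 * err y (?m y (\<rho> y) z) z) ^ ?k) \<le> 2 * (9 / 10) ^ ?k" ..
  then have \<rho>: "\<rho> y \<in> Pi\<^sub>E {..<26 * ?k} (\<lambda>_. Rn y)"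
    "avg (Xs \<times> Ys) (\<lambda>z. (3 / 2 * err y (?m y (\<rho> y) z) z) ^ ?k) \<le> 2 * (9 / 10) ^ ?k" for y by simp_all
  define s where "s x x' = {y \<in> words d. ?m y (\<rho> y) (x, x')}" for x x'
  show thesis
  proof (rule that)
    let ?S = "words d \<times> {..<26 * ?k}"
    have "simple ((4 ^ 2 ^ d) ^ card ?S) (\<lambda>x x'. \<lambda>p\<in>?S. acc (fst p) (\<rho> (fst p) (snd p)) x x')"
    proof (rule simple_family)
      show "finite ?S" using finite_words by simp
      fix p assume p: "p \<in> ?S"
      then have "length (fst p) = d" "snd p \<in> {..<26 * ?k}" unfolding words_def by auto
      then show "simple (4 ^ 2 ^ d) (acc (fst p) (\<rho> (fst p) (snd p)))"
        using acc_simple[OF PiE_mem[OF \<rho>(1)]] by metis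
    qed
    from simple_map[OF this, of "\<lambda>v. {y \<in> words d. majority (26 * ?k) (\<lambda>i. v (y, i))}"]
    have "simple ((4 ^ 2 ^ d) ^ (2 ^ d * (26 * ?k))) (\<lambda>x x'. {y \<in> words d. majority (26 * ?k)
        (\<lambda>i. (\<lambda>p\<in>?S. acc (fst p) (\<rho> (fst p) (snd p)) x x') (y, i))})"
      by (simp only: card_cartesian_product card_words card_lessThan)
    moreover have "(\<lambda>x x'. {y \<in> words d. majority (26 * ?k)
        (\<lambda>i. (\<lambda>p\<in>?S. acc (fst p) (\<rho> (fst p) (snd p)) x x') (y, i))}) = s"
    proof (intro ext)
      fix x x'
      have "majority (26 * ?k) (\<lambda>i. (\<lambda>p\<in>?S. acc (fst p) (\<rho> (fst p) (snd p)) x x') (y, i))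
        = ?m y (\<rho> y) (x, x')" if "y \<in> words d" for y
        unfolding majority_def using that
        by (intro arg_cong2[where f = "(\<le>)"] arg_cong[where f = card] Collect_cong) auto
      then show "{y \<in> words d. majority (26 * ?k)
        (\<lambda>i. (\<lambda>p\<in>?S. acc (fst p) (\<rho> (fst p) (snd p)) x x') (y, i))} = s x x'"
        unfolding s_def by (intro Collect_cong conj_cong refl)
    qed
    ultimately show "simple ((4 ^ 2 ^ d) ^ (2 ^ d * (26 * ?k))) s" by (simp only:)
    show "\<forall>x x'. s x x' \<subseteq> words d" by (auto simp: s_def)
    have "pot d (s (fst z) (snd z)) z = (\<Sum>y\<in>words d. (3 / 2 * err y (?m y (\<rho> y) z) z) ^ ?k)" for z
      unfolding pot_def by (intro sum.cong refl) (simp add: s_def)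
    then have "avg (Xs \<times> Ys) (\<lambda>z. pot d (s (fst z) (snd z)) z)
      = (\<Sum>y\<in>words d. avg (Xs \<times> Ys) (\<lambda>z. (3 / 2 * err y (?m y (\<rho> y) z) z) ^ ?k))"
      unfolding avg_sum[symmetric] by (simp only:)
    also have "\<dots> \<le> (\<Sum>y\<in>words d. 2 * (9 / 10) ^ ?k)" by (intro sum_mono \<rho>(2))
    finally show "avg (Xs \<times> Ys) (\<lambda>z. pot d (s (fst z) (snd z)) z) \<le> 2 ^ d * (2 * (9 / 10) ^ ?k)"
      by (simp add: card_words)
  qed
qed

end

section \<open>Numerical estimates for one stage\<close>

lemma power_exp_le: "(2 :: real) ^ n * exp (- (real n + real m)) \<le> (1 / 2) ^ m"
proof -
  have "exp (- (real n + real m)) = exp (- 1) ^ (n + m)"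
    unfolding exp_of_nat_mult[symmetric] by simp
  also have "exp (- 1 :: real) ^ (n + m) \<le> (1 / 2) ^ (n + m)"
  proof (rule power_mono)
    have "(2 :: real) \<le> exp 1" using exp_ge_add_one_self[of 1] by linarith
    then show "exp (- 1 :: real) \<le> 1 / 2" unfolding exp_minus by (simp add: inverse_le_iff_le field_simps)
  qed simp
  finally have "2 ^ n * exp (- (real n + real m)) \<le> 2 ^ n * (1 / 2) ^ (n + m)" by simp
  also have "\<dots> = (1 / 2) ^ m" by (simp add: power_add power_divide)
  finally show ?thesis .
qed

lemma less_two_power_real: "real d + 1 \<le> 2 ^ d"
  by (induction d) auto

text \<open>The binary logarithm of the number of labels in \<open>sampling_step\<close>;
  \<open>test_bits\<close> is the same for \<open>rounds d\<close> runs, that is, for one test of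
  the moment.\<close>

definition sample_bits :: "nat \<Rightarrow> nat" where
  "sample_bits d = 2 * 2 ^ d * (2 ^ d * (26 * (14 * d + 28)))"

definition test_bits :: "nat \<Rightarrow> nat" where
  "test_bits d = 2 * 2 ^ d * (14 * d + 28)"

text \<open>A stage shrinks the rectangle by \<open>exp g\<close> for a leaf and by
  \<open>exp (1 + 2 ^ d)\<close> for a fibre. Together the exponents are at most
  \<open>1461 * 8 ^ d\<close>, which the growth from \<open>8 ^ d\<close> to
  \<open>8 ^ Suc d\<close> covers. In the second inequality the left side is at most
  \<open>2 ^ (37 * d + 86)\<close>, so seeds of length \<open>100 * (d + 1)\<close> leave ample
  room; the factor 576 comes from \<open>avg_deviation_le\<close>.\<close>

lemma budget_bounds:
  defines "g \<equiv> \<lambda>d. real (sample_bits d) + real (d + 3)"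
    and "h \<equiv> \<lambda>d. real (test_bits d) + real (17 * d + 32)"
  shows "1464 * 8 ^ d + g d + 1 + 2 ^ d \<le> 1464 * 8 ^ Suc d"
    and "576 * (1464 * 8 ^ d + g d + h d) * (2 ^ (17 * d + 32))\<^sup>2 \<le> 2 ^ (100 * (d + 1))"
proof -
  define x where "x = (2 :: real) ^ d"
  have x: "1 \<le> x" "real d + 1 \<le> x" using less_two_power_real[of d] by (simp_all add: x_def)
  have "(8 :: real) ^ d = (2 ^ 3) ^ d" by simp
  then have x8: "(8 :: real) ^ d = x ^ 3" unfolding x_def power_mult[symmetric] by (simp only: mult.commute)
  have x3: "x \<le> x ^ 3" "1 \<le> x ^ 3" "x * x \<le> x ^ 3" using x(1) self_le_power[of x 3] one_le_power[of x 3] power_increasing[of 2 3 x]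
    by (simp_all add: power2_eq_square)
  have d2: "real d + 2 \<le> 2 * x" using x by linarith
  have s: "real (sample_bits d) \<le> 1456 * x ^ 3"
  proof -
    have "real (sample_bits d) = 728 * (x * x) * (real d + 2)"
      by (simp add: sample_bits_def x_def algebra_simps)
    also have "\<dots> \<le> 728 * (x * x) * (2 * x)" using d2 x by (intro mult_left_mono) auto
    finally show ?thesis by (simp add: power3_eq_cube mult.assoc)
  qed
  have t: "real (test_bits d) \<le> 56 * x ^ 3"
  proof -
    have "real (test_bits d) = 28 * x * (real d + 2)"
      by (simp add: test_bits_def x_def algebra_simps)
    also have "\<dots> \<le> 28 * x * (2 * x)" using d2 x by (intro mult_left_mono) auto
    finally show ?thesis using x3(3) by (simp add: mult.assoc)
  qed
  show "1464 * 8 ^ d + g d + 1 + 2 ^ d \<le> 1464 * 8 ^ Suc d"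
    using s x3 x(2) by (simp add: g_def x8 x_def[symmetric])
  have "1464 * 8 ^ d + g d + h d \<le> 1464 * x ^ 3 + (1456 * x ^ 3 + x ^ 3 + 2) + (56 * x ^ 3 + 17 * x ^ 3 + 32)"
    using s t x3 x(2) by (simp add: g_def h_def x8 x_def[symmetric])
  also have "\<dots> \<le> 2 ^ 12 * x ^ 3" using x3 by simp
  finally have "576 * (1464 * 8 ^ d + g d + h d) * (2 ^ (17 * d + 32))\<^sup>2
    \<le> 2 ^ 10 * (2 ^ 12 * x ^ 3) * (2 ^ (17 * d + 32))\<^sup>2"
    using x by (intro mult_right_mono mult_mono) (auto simp: g_def h_def)
  also have "x ^ 3 = 2 ^ (3 * d)" by (simp add: x_def mult.commute flip: power_mult)
  also have "2 ^ 10 * (2 ^ 12 * 2 ^ (3 * d)) * (2 ^ (17 * d + 32))\<^sup>2 = (2 :: real) ^ (37 * d + 86)"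
    by (simp only: power_add[symmetric] power_mult[symmetric]) (rule arg_cong[where f = "(^) 2"], simp)
  also have "\<dots> \<le> 2 ^ (100 * (d + 1))" by (intro power_increasing) auto
  finally show "576 * (1464 * 8 ^ d + g d + h d) * (2 ^ (17 * d + 32))\<^sup>2 \<le> 2 ^ (100 * (d + 1))" .
qed

lemma sampling_bound: "2 ^ d * (2 * (9 / 10 :: real) ^ (14 * d + 28)) \<le> (1 / 2) ^ (d + 3)"
proof -
  have "(9 / 10 :: real) ^ (14 * d + 28) = ((9 / 10) ^ 7) ^ (2 * d + 4)"
    by (simp flip: power_mult)
  also have "\<dots> \<le> (1 / 2) ^ (2 * d + 4)" by (intro power_mono) (simp_all add: power_divide)
  finally have "2 ^ d * (2 * (9 / 10 :: real) ^ (14 * d + 28)) \<le> 2 ^ d * (2 * (1 / 2) ^ (2 * d + 4))" by simp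
  also have "\<dots> = (1 / 2) ^ (d + 3)"
  proof -
    have "2 * d + 4 = d + (d + 4)" by simp
    then have "(1 / 2 :: real) ^ (2 * d + 4) = (1 / 2) ^ d * (1 / 2) ^ (d + 4)" by (simp only: power_add)
    moreover have "2 ^ d * (1 / 2 :: real) ^ d = 1" unfolding power_mult_distrib[symmetric] by simp
    moreover have "2 * (1 / 2 :: real) ^ (d + 4) = (1 / 2) ^ (d + 3)" by (simp add: numeral_eq_Suc)
    ultimately show ?thesis by (metis mult.assoc mult.left_commute mult_1_right)
  qed
  finally show ?thesis .
qed

text \<open>All tests together weigh at most \<open>2 ^ (16 * d + 28)\<close>, using
  \<open>real d + 1 \<le> 2 ^ d\<close>. The exponent \<open>17 * d + 31\<close> adds to this the
  \<open>d + 3\<close> of the admissible loss.\<close>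

lemma weight_bound:
  "(\<Sum>d'<Suc d. 2 ^ d' * (3 / 2 :: real) ^ (14 * d' + 28)) * (1 / 2) ^ (17 * d + 31) \<le> (1 / 2) ^ (d + 3)"
proof -
  have "(\<Sum>d'<Suc d. 2 ^ d' * (3 / 2 :: real) ^ (14 * d' + 28)) \<le> (\<Sum>d'<Suc d. 2 ^ d * 2 ^ (14 * d + 28))"
  proof (intro sum_mono mult_mono)
    fix d' assume d: "d' \<in> {..<Suc d}"
    then show "(2 :: real) ^ d' \<le> 2 ^ d" by (intro power_increasing) auto
    have "(3 / 2 :: real) ^ (14 * d' + 28) \<le> 2 ^ (14 * d' + 28)" by (intro power_mono) auto
    also have "\<dots> \<le> 2 ^ (14 * d + 28)" using d by (intro power_increasing) auto
    finally show "(3 / 2 :: real) ^ (14 * d' + 28) \<le> 2 ^ (14 * d + 28)" .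
  qed auto
  also have "\<dots> = (real d + 1) * (2 ^ d * 2 ^ (14 * d + 28))" by simp
  also have "\<dots> \<le> 2 ^ d * (2 ^ d * 2 ^ (14 * d + 28))"
    using less_two_power_real[of d] by (intro mult_right_mono) auto
  also have "\<dots> = 2 ^ (16 * d + 28)" by (simp flip: power_add)
  finally have "(\<Sum>d'<Suc d. 2 ^ d' * (3 / 2 :: real) ^ (14 * d' + 28)) * (1 / 2) ^ (17 * d + 31)
    \<le> 2 ^ (16 * d + 28) * (1 / 2) ^ (17 * d + 31)" by (intro mult_right_mono) auto
  moreover have e: "17 * d + 31 = (16 * d + 28) + (d + 3)" by simp
  have "2 ^ (16 * d + 28) * (1 / 2 :: real) ^ (17 * d + 31) = (1 / 2) ^ (d + 3)"
    unfolding e power_add[of "1/2 :: real" "16 * d + 28"] mult.assoc[symmetric] power_mult_distrib[symmetric]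
    by simp
  ultimately show ?thesis by (simp only:)
qed

lemma two_power_le_exp: "(2 :: real) ^ n \<le> exp (real n)"
  using power_exp_le[of n 0] by (simp add: exp_minus inverse_eq_divide pos_divide_le_eq)

lemma power_four: "((4 :: real) ^ m) ^ n = 2 ^ (2 * m * n)"
proof -
  have "(4 :: real) = 2 ^ 2" by simp
  then show ?thesis by (simp only: power_mult[symmetric] mult.assoc)
qed

lemma avg_deviation_le:
  assumes "R \<subseteq> profiles H" "R \<noteq> {}" "d < H"
    and D: "real (card (profiles H)) \<le> exp D * real (card R)" "576 * D * E\<^sup>2 \<le> 2 ^ (100 * (d + 1))"
    and E: "1 \<le> E"
  shows "avg (seeds d) (deviation (Pow (words d)) R) \<le> 1 / E / 6"
proof -
  \<comment> \<open>With this \<open>l\<close> the term \<open>2 * l * card (seeds d)\<close> is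
    half of the target \<open>card (seeds d) / (6 * E)\<close>. The hypothesis on \<open>D\<close>
    bounds the other term by the same amount, with \<open>576 = 48 * 12\<close>.\<close>
  define l where "l = 1 / (24 * E)"
  have l: "0 < l" "l \<le> 1" using E by (auto simp: l_def)
  have "(\<Sum>w\<in>seeds d. deviation (Pow (words d)) R w) \<le> 2 * (D / l + l * real (card (seeds d)))"
    using assms l unfolding profiles_def
    by (intro sum_deviation_le) (auto simp: finite_seeds tables_finite tables_nonempty tables_seeds)
  also have "\<dots> = 48 * D * E + card (seeds d) / (12 * E)"
    by (simp add: l_def)
  also have "\<dots> \<le> card (seeds d) / (12 * E) + card (seeds d) / (12 * E)"
  proof (intro add_right_mono)
    have "48 * D * E * (12 * E) \<le> card (seeds d)"
      using D(2) by (simp add: card_seeds power2_eq_square mult.assoc)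
    then show "48 * D * E \<le> card (seeds d) / (12 * E)" using E by (subst pos_le_divide_eq) auto
  qed
  also have "\<dots> = 1 / E / 6 * card (seeds d)" by simp
  finally show ?thesis
    unfolding avg_def using finite_seeds seeds_nonempty by (simp add: pos_divide_le_eq card_gt_0_iff)
qed

section \<open>Induction over the stages\<close>

context randomized_protocols
begin

text \<open>The exponent \<open>1464 * 8 ^ d\<close> bounds the logarithm of the factor by which the rectangle has shrunk
  in the first \<open>d\<close> stages; it is negligible compared to the number \<open>2 ^ (100 * (d + 1))\<close> of seeds.\<close>

definition stage :: "nat \<Rightarrow> nat \<Rightarrow> (bool list \<Rightarrow> bool list set) set \<Rightarrow> (bool list \<Rightarrow> bool list set) set \<Rightarrow>
    (nat \<Rightarrow> bool list set) \<Rightarrow> bool" where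
  "stage H d P Q S \<longleftrightarrow> P \<subseteq> profiles H \<and> Q \<subseteq> profiles H \<and> P \<noteq> {} \<and> Q \<noteq> {} \<and>
     real (card (profiles H)) \<le> exp (1464 * 8 ^ d) * real (card P) \<and>
     real (card (profiles H)) \<le> exp (1464 * 8 ^ d) * real (card Q) \<and>
     (\<forall>d'<d. \<exists>w\<in>seeds d'. \<exists>w'\<in>seeds d'. \<forall>Xs\<in>P. \<forall>Ys\<in>Q. xor_set (Xs w) (Ys w') = S d') \<and>
     avg (P \<times> Q) (\<lambda>z. \<Sum>d'<d. pot d' (S d') z) \<le> 1 - (1 / 2) ^ d"

lemma stage_0: "stage H 0 (profiles H) (profiles H) S"
proof -
  have "1 * real (card (profiles H)) \<le> exp 1464 * real (card (profiles H))"
    by (intro mult_right_mono) auto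
  then show ?thesis by (simp add: stage_def profiles_nonempty avg_def)
qed

text \<open>With \<open>\<eta> = (1 / 2) ^ (d + 3)\<close>, the reserve \<open>8 * \<eta>\<close> of
  stage \<open>d\<close> pays \<open>\<eta>\<close> each for the sampled answer, the choice of a
  leaf and the planting. The remaining \<open>5 * \<eta>\<close> exceed the reserve
  \<open>4 * \<eta>\<close> demanded at stage \<open>Suc d\<close>.\<close>

lemma stage_Suc:
  assumes st: "stage H d P Q S" and d: "d < H"
  shows "\<exists>P' Q' S'. stage H (Suc d) P' Q' S'"
proof -
  define g where "g = real (sample_bits d) + real (d + 3)"
  define h where "h = real (test_bits d) + real (17 * d + 32)"
  define E where "E = (2 :: real) ^ (17 * d + 32)"
  \<comment> \<open>\<open>\<delta>\<close> consists of \<open>1 / E\<close> for the deviation from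
    uniform and an equal amount for the small leaves of a test.\<close>
  define \<delta> where "\<delta> = (1 / 2 :: real) ^ (17 * d + 31)"
  define \<eta> where "\<eta> = (1 / 2 :: real) ^ (d + 3)"
  have \<eta>8: "(1 / 2 :: real) ^ d = 8 * \<eta>" by (simp add: \<eta>_def power_add power_divide)
  have \<eta>: "0 < \<eta>" by (simp add: \<eta>_def)
  have gh: "0 \<le> g" "0 \<le> h" by (simp_all add: g_def h_def)
  have P: "P \<subseteq> profiles H" "P \<noteq> {}" "real (card (profiles H)) \<le> exp (1464 * 8 ^ d) * real (card P)"
    and Q: "Q \<subseteq> profiles H" "Q \<noteq> {}" "real (card (profiles H)) \<le> exp (1464 * 8 ^ d) * real (card Q)"
    and old: "\<And>d'. d' < d \<Longrightarrow> \<exists>w\<in>seeds d'. \<exists>w'\<in>seeds d'. \<forall>Xs\<in>P. \<forall>Ys\<in>Q. xor_set (Xs w) (Ys w') = S d'"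
    and avgF: "avg (P \<times> Q) (\<lambda>z. \<Sum>d'<d. pot d' (S d') z) \<le> 1 - 8 * \<eta>"
    using st unfolding stage_def \<eta>8 by auto
  have fin: "finite R" if "R \<subseteq> profiles H" for R using that finite_profiles finite_subset by blast
  obtain s where s: "simple ((4 ^ 2 ^ d) ^ (2 ^ d * (26 * rounds d))) s" "\<forall>x y. s x y \<subseteq> words d"
    "avg (P \<times> Q) (\<lambda>z. pot d (s (fst z) (snd z)) z) \<le> 2 ^ d * (2 * (9 / 10) ^ rounds d)"
    using sampling_step[OF fin[OF P(1)] P(2) fin[OF Q(1)] Q(2), where d = d] .
  define G where "G z = (\<Sum>d'<d. pot d' (S d') z) + pot d (s (fst z) (snd z)) z" for z
  have G0: "0 \<le> G z" for z unfolding G_def by (intro add_nonneg_nonneg sum_nonneg pot_nonneg)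
  have "avg (P \<times> Q) (\<lambda>z. pot d (s (fst z) (snd z)) z) \<le> \<eta>"
    using s(3) sampling_bound[of d] unfolding rounds_def \<eta>_def by (rule order_trans)
  then have avgG: "avg (P \<times> Q) G \<le> 1 - 7 * \<eta>"
    unfolding G_def avg_add using avgF by linarith
  have "real ((4 ^ 2 ^ d) ^ (2 ^ d * (26 * rounds d))) = 2 ^ sample_bits d"
    unfolding of_nat_power of_nat_numeral power_four sample_bits_def rounds_def ..
  then have N: "real ((4 ^ 2 ^ d) ^ (2 ^ d * (26 * rounds d))) * exp (- g) \<le> \<eta>"
    using power_exp_le[of "sample_bits d" "d + 3"] unfolding g_def \<eta>_def by (simp only:)
  have "avg (P \<times> Q) G + real ((4 ^ 2 ^ d) ^ (2 ^ d * (26 * rounds d))) * exp (- g) < 1"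
    using avgG N \<eta> by linarith
  from exists_large_leaf[OF s(1) fin[OF P(1)] P(2) fin[OF Q(1)] Q(2) G0 this exp_gt_zero]
  obtain P' Q' c where leaf: "P' \<subseteq> P" "Q' \<subseteq> Q" "P' \<noteq> {}" "Q' \<noteq> {}"
    "\<forall>x\<in>P'. \<forall>y\<in>Q'. s x y = c"
    "exp (- g) * card P \<le> card P'" "exp (- g) * card Q \<le> card Q'"
    "avg (P' \<times> Q') G \<le> avg (P \<times> Q) G + real ((4 ^ 2 ^ d) ^ (2 ^ d * (26 * rounds d))) * exp (- g)" .
  obtain x0 y0 where "x0 \<in> P'" "y0 \<in> Q'" using leaf(3,4) by blast
  then have "s x0 y0 = c" using leaf(5) by simp
  then have c: "c \<subseteq> words d" using s(2) by blast
  define S' where "S' = S(d := c)"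
  define F where "F z = (\<Sum>d'<Suc d. pot d' (S' d') z)" for z
  \<comment> \<open>On the leaf the sampled answer is the constant \<open>c\<close>, so the
    potential with the varying answer becomes one with a fixed answer.\<close>
  have "F z = G z" if "z \<in> P' \<times> Q'" for z
  proof -
    have "s (fst z) (snd z) = c" using leaf(5) that by auto
    moreover have "(\<Sum>d'<d. pot d' (S' d') z) = (\<Sum>d'<d. pot d' (S d') z)"
      by (intro sum.cong refl) (simp add: S'_def)
    ultimately show ?thesis by (simp add: F_def G_def S'_def)
  qed
  then have "avg (P' \<times> Q') F = avg (P' \<times> Q') G" unfolding avg_def by (simp cong: sum.cong)
  then have avgF': "avg (P' \<times> Q') F \<le> 1 - 6 * \<eta>" using leaf(8) avgG N by linarith
  have sub: "P' \<subseteq> profiles H" "Q' \<subseteq> profiles H" using P(1) Q(1) leaf by auto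
  have up: "real (card A) \<le> exp b * real (card B)" if "exp (- b) * real (card A) \<le> real (card B)" for b and A B :: "(bool list \<Rightarrow> bool list set) set"
  proof -
    have "exp b * (exp (- b) * real (card A)) \<le> exp b * real (card B)"
      using that by (intro mult_left_mono) auto
    then show ?thesis unfolding mult.assoc[symmetric] exp_minus_inverse by simp
  qed
  have chain: "a \<le> exp (u + v) * q" if "a \<le> exp u * p" "p \<le> exp v * q" for a u p v q :: real
  proof -
    have "exp u * p \<le> exp u * (exp v * q)" using that(2) by (intro mult_left_mono) auto
    from order_trans[OF that(1) this] show ?thesis unfolding exp_add mult.assoc .
  qed
  have dP': "real (card (profiles H)) \<le> exp (1464 * 8 ^ d + g) * real (card P')"
    using chain[OF P(3) up[OF leaf(6)]] .
  have dQ': "real (card (profiles H)) \<le> exp (1464 * 8 ^ d + g) * real (card Q')"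
    using chain[OF Q(3) up[OF leaf(7)]] .
  have E1: "1 \<le> E" by (simp add: E_def)
  note bb = budget_bounds[of d, folded g_def h_def, folded E_def]
  have dev: "avg (seeds d) (deviation (Pow (words d)) R) \<le> 1 / E / 6"
    if "R \<subseteq> B" "R \<noteq> {}" "exp (- h) * card B \<le> card R" "B \<subseteq> profiles H"
      "real (card (profiles H)) \<le> exp (1464 * 8 ^ d + g) * real (card B)" for R B
    using chain[OF that(5) up[OF that(3)]] that(1,2,4)
    by (intro avg_deviation_le[OF _ _ d _ bb(2) E1]) auto
  interpret planting P' Q' "seeds d" "Pow (words d)" "\<lambda>a. xor_set a c" "1 / E" h
  proof
    show "finite P'" "finite Q'" using sub by (auto intro: fin)
    show "finite (Pow (words d))" using finite_words by simp
    show "1 / E \<le> 1" "0 \<le> 1 / E" using E1 by simp_all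
    show "avg (seeds d) (deviation (Pow (words d)) R) \<le> 1 / E / 6"
      if "R \<subseteq> P'" "R \<noteq> {}" "exp (- h) * card P' \<le> card R" for R
      using dev[OF that sub(1) dP'] .
    show "avg (seeds d) (deviation (Pow (words d)) R) \<le> 1 / E / 6"
      if "R \<subseteq> Q'" "R \<noteq> {}" "exp (- h) * card Q' \<le> card R" for R
      using dev[OF that sub(2) dQ'] .
  qed (use leaf finite_seeds seeds_nonempty bij_betw_xor_set[OF c] gh in auto)
  define M where "M = (\<Sum>d'<Suc d. 2 ^ d' * (3 / 2 :: real) ^ rounds d')"
  have test: "testable \<delta> M F"
    unfolding M_def F_def
  proof (intro testable_sum testable_pot[OF planting_axioms])
    fix d' assume "d' \<in> {..<Suc d}"
    then have dd: "d' \<le> d" by simp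
    have "((4 :: real) ^ 2 ^ d') ^ rounds d' \<le> 2 ^ test_bits d"
      unfolding power_four test_bits_def rounds_def using dd
      by (intro power_increasing mult_le_mono) auto
    then have "((4 :: real) ^ 2 ^ d') ^ rounds d' * exp (- h) \<le> 2 ^ test_bits d * exp (- h)"
      by (intro mult_right_mono) auto
    also have "\<dots> \<le> (1 / 2) ^ (17 * d + 32)"
      unfolding h_def by (rule power_exp_le)
    also have "1 / E + (1 / 2) ^ (17 * d + 32) = \<delta>" by (simp add: E_def \<delta>_def power_divide numeral_eq_Suc)
    finally show "1 / E + (4 ^ 2 ^ d') ^ rounds d' * exp (- h) \<le> \<delta>" by simp
  qed simp
  have M\<delta>: "M * \<delta> \<le> \<eta>"
    using weight_bound[of d] unfolding M_def \<delta>_def \<eta>_def rounds_def .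
  \<comment> \<open>The summand of stage 0 gives \<open>1 \<le> M\<close>, whence the strict
    inequality that \<open>exists_planting\<close> asks for.\<close>
  have "1 \<le> 2 ^ 0 * (3 / 2 :: real) ^ rounds 0" by (simp add: one_le_power)
  also have "\<dots> \<le> M" unfolding M_def by (intro member_le_sum) auto
  finally have "avg (P' \<times> Q') F + M * \<delta> < M" using M\<delta> avgF' \<eta> by linarith
  from exists_planting[OF test this]
  obtain i j a where pl: "i \<in> seeds d" "j \<in> seeds d" "valid (Pow (words d)) P' i a"
    "valid (Pow (words d)) Q' j (xor_set a c)"
    "avg (fibre P' i a \<times> fibre Q' j (xor_set a c)) F \<le> avg (P' \<times> Q') F + M * \<delta>" .
  let ?P = "fibre P' i a" and ?Q = "fibre Q' j (xor_set a c)"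
  have fPQ: "finite P'" "finite Q'" using sub by (auto intro: fin)
  have subf: "?P \<subseteq> P'" "?Q \<subseteq> Q'" by (auto simp: fibre_def)
  have "real (card (Pow (words d))) = 2 ^ 2 ^ d"
    using finite_words by (simp add: card_Pow card_words)
  also have "\<dots> \<le> exp (2 ^ d)" using two_power_le_exp[of "2 ^ d"] by simp
  finally have "2 * real (card (Pow (words d))) \<le> exp 1 * exp (2 ^ d)"
    using two_power_le_exp[of 1] by (intro mult_mono) auto
  then have v: "2 * real (card (Pow (words d))) \<le> exp (1 + 2 ^ d)" by (simp only: exp_add)
  have small: "real (card A) \<le> exp (1 + 2 ^ d) * real (card (fibre A k b))"
    if "valid (Pow (words d)) A k b" "finite A" for A k b
    using valid_fibre(2)[OF that] mult_right_mono[OF v, of "real (card (fibre A k b))"]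
    by (rule order_trans) simp
  have final: "real (card (profiles H)) \<le> exp (1464 * 8 ^ Suc d) * real (card (fibre A k b))"
    if "valid (Pow (words d)) A k b" "finite A"
      "real (card (profiles H)) \<le> exp (1464 * 8 ^ d + g) * real (card A)" for A k b
  proof -
    have "real (card (profiles H)) \<le> exp (1464 * 8 ^ d + g + (1 + 2 ^ d)) * real (card (fibre A k b))"
      using chain[OF that(3) small[OF that(1,2)]] .
    also have "\<dots> \<le> exp (1464 * 8 ^ Suc d) * real (card (fibre A k b))"
    proof (rule mult_right_mono)
      show "exp (1464 * 8 ^ d + g + (1 + 2 ^ d)) \<le> exp (1464 * 8 ^ Suc d)"
        using bb(1) by (simp only: exp_le_cancel_iff add.assoc)
    qed simp
    finally show ?thesis .
  qed
  have "stage H (Suc d) ?P ?Q S'"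
    unfolding stage_def
  proof (intro conjI allI impI)
    show "?P \<subseteq> profiles H" "?Q \<subseteq> profiles H" using subf sub by auto
    show "?P \<noteq> {}" using valid_fibre(1)[OF pl(3) fPQ(1)] by auto
    show "?Q \<noteq> {}" using valid_fibre(1)[OF pl(4) fPQ(2)] by auto
    show "real (card (profiles H)) \<le> exp (1464 * 8 ^ Suc d) * real (card ?P)"
      by (rule final[OF pl(3) fPQ(1) dP'])
    show "real (card (profiles H)) \<le> exp (1464 * 8 ^ Suc d) * real (card ?Q)"
      by (rule final[OF pl(4) fPQ(2) dQ'])
    have "(1 / 2 :: real) ^ Suc d = 4 * \<eta>" using \<eta>8 by simp
    then show "avg (?P \<times> ?Q) (\<lambda>z. \<Sum>d'<Suc d. pot d' (S' d') z) \<le> 1 - (1 / 2) ^ Suc d"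
      using pl(5) avgF' M\<delta> \<eta> unfolding F_def by linarith
    fix d' assume "d' < Suc d"
    show "\<exists>w\<in>seeds d'. \<exists>w'\<in>seeds d'. \<forall>Xs\<in>?P. \<forall>Ys\<in>?Q. xor_set (Xs w) (Ys w') = S' d'"
    proof (cases "d' = d")
      case True
      have "\<forall>Xs\<in>?P. \<forall>Ys\<in>?Q. xor_set (Xs i) (Ys j) = S' d'"
        by (auto simp: True S'_def fibre_def xor_set_cancel)
      then show ?thesis using pl(1,2) unfolding True by blast
    next
      case False
      then have "d' < d" using \<open>d' < Suc d\<close> by simp
      from old[OF this] obtain w w' where "w \<in> seeds d'" "w' \<in> seeds d'"
        "\<forall>Xs\<in>P. \<forall>Ys\<in>Q. xor_set (Xs w) (Ys w') = S d'" by blast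
      moreover have "\<forall>Xs\<in>?P. \<forall>Ys\<in>?Q. xor_set (Xs w) (Ys w') = S' d'"
      proof (intro ballI)
        fix Xs Ys assume "Xs \<in> ?P" "Ys \<in> ?Q"
        then have "Xs \<in> P" "Ys \<in> Q" using subf leaf(1,2) by auto
        then have "xor_set (Xs w) (Ys w') = S d'" using \<open>\<forall>Xs\<in>P. \<forall>Ys\<in>Q. xor_set (Xs w) (Ys w') = S d'\<close> by simp
        then show "xor_set (Xs w) (Ys w') = S' d'" using False by (simp add: S'_def)
      qed
      ultimately show ?thesis by (intro bexI[of _ w] bexI[of _ w'])
    qed
  qed
  then show ?thesis by blast
qed

theorem exists_profiles:
  "\<exists>Xs Ys. \<forall>d<H. \<exists>w\<in>seeds d. \<exists>w'\<in>seeds d. \<forall>y\<in>words d.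
     err y ((y \<in> Xs w) \<noteq> (y \<in> Ys w')) (Xs, Ys) < 2 / 3"
proof -
  have "\<exists>P Q S. stage H d P Q S" if "d \<le> H" for d
    using that
  proof (induction d)
    case 0
    show ?case using stage_0 by blast
  next
    case (Suc d)
    then show ?case using stage_Suc by (metis Suc_le_lessD Suc_leD)
  qed
  then obtain P Q S where st: "stage H H P Q S" by blast
  have PQ: "finite (P \<times> Q)" "P \<times> Q \<noteq> {}"
    using st finite_subset[OF _ finite_profiles] unfolding stage_def by auto
  have "avg (P \<times> Q) (\<lambda>z. \<Sum>d'<H. pot d' (S d') z) < 1"
    using st zero_less_power[of "1 / 2 :: real" H] unfolding stage_def by linarith
  then obtain z where z: "z \<in> P \<times> Q" "(\<Sum>d'<H. pot d' (S d') z) < 1"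
    using exists_le_avg[OF PQ, of "\<lambda>z. \<Sum>d'<H. pot d' (S d') z"] by force
  obtain Xs Ys where XY: "z = (Xs, Ys)" "Xs \<in> P" "Ys \<in> Q" using z(1) by auto
  have "\<exists>w\<in>seeds d. \<exists>w'\<in>seeds d. \<forall>y\<in>words d. err y ((y \<in> Xs w) \<noteq> (y \<in> Ys w')) (Xs, Ys) < 2 / 3"
    if d: "d < H" for d
  proof -
    have "pot d (S d) z \<le> (\<Sum>d'<H. pot d' (S d') z)"
      using d pot_nonneg by (intro member_le_sum) auto
    then have pot: "pot d (S d) (Xs, Ys) < 1" using z(2) unfolding XY(1) by linarith
    obtain w w' where w: "w \<in> seeds d" "w' \<in> seeds d" "xor_set (Xs w) (Ys w') = S d"
      using st d XY unfolding stage_def by blast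
    have "((y \<in> Xs w) \<noteq> (y \<in> Ys w')) = (y \<in> S d)" for y
      using w(3) by (auto simp: xor_set_def)
    then have "\<forall>y\<in>words d. err y ((y \<in> Xs w) \<noteq> (y \<in> Ys w')) (Xs, Ys) < 2 / 3"
      using err_if_pot[OF pot] by simp
    then show ?thesis using w by blast
  qed
  then show ?thesis by blast
qed

end

section \<open>Multilinear queries as protocols\<close>

lemma (in cring) mlin_eval_closed:
  assumes c: "c \<in> Pow {..<m} \<rightarrow> carrier R" and x: "length x = m" "set x \<subseteq> carrier R"
  shows "mlin_eval R m c x \<in> carrier R"
proof -
  have "(\<Otimes>i\<in>S. x ! i) \<in> carrier R" if "S \<in> Pow {..<m}" for S
    using that x by (intro finprod_closed) (auto simp: subset_iff Pi_iff)
  then show ?thesis unfolding mlin_eval_def using c by (intro finsum_closed) (auto simp: Pi_iff)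
qed

lemma (in cring) mlin_eval_add:
  assumes c: "c \<in> Pow {..<m} \<rightarrow> carrier R" and d: "d \<in> Pow {..<m} \<rightarrow> carrier R"
    and x: "length x = m" "set x \<subseteq> carrier R"
  shows "mlin_eval R m (\<lambda>S\<in>Pow {..<m}. c S \<oplus> d S) x = mlin_eval R m c x \<oplus> mlin_eval R m d x"
proof -
  have prod: "(\<Otimes>i\<in>S. x ! i) \<in> carrier R" if "S \<in> Pow {..<m}" for S
    using that x by (intro finprod_closed) (auto simp: subset_iff Pi_iff)
  have "mlin_eval R m (\<lambda>S\<in>Pow {..<m}. c S \<oplus> d S) x
    = (\<Oplus>S\<in>Pow {..<m}. c S \<otimes> (\<Otimes>i\<in>S. x ! i) \<oplus> d S \<otimes> (\<Otimes>i\<in>S. x ! i))"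
    unfolding mlin_eval_def using c d prod
    by (intro finsum_cong') (auto simp: Pi_iff l_distr simp del: Pow_iff)
  also have "\<dots> = mlin_eval R m c x \<oplus> mlin_eval R m d x"
    unfolding mlin_eval_def using c d prod by (intro finsum_addf) (auto simp: Pi_iff simp del: Pow_iff)
  finally show ?thesis .
qed

lemma (in cring) mlin_extension_is_extension: "is_mlin_extension A m R (mlin_extension A m R)"
  unfolding mlin_extension_def by (rule theI'[OF mlin_extension_unique_exists])

lemma (in cring) mlin_extension_closed: "mlin_extension A m R \<in> Pow {..<m} \<rightarrow> carrier R"
  using mlin_extension_is_extension[of A m] unfolding is_mlin_extension_def by blast

text \<open>Both coefficient families extend \<open>A\<close>, and extensions are unique. Because
  the supports are disjoint, the two bits add up to a bit in every characteristic.\<close>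

lemma (in cring) mlin_extension_add:
  assumes "\<And>b. A b \<longleftrightarrow> A' b \<or> A'' b" "\<And>b. \<not> (A' b \<and> A'' b)"
  shows "mlin_extension A m R = (\<lambda>S\<in>Pow {..<m}. mlin_extension A' m R S \<oplus> mlin_extension A'' m R S)"
    (is "_ = ?c")
proof -
  have "is_mlin_extension A m R ?c"
    unfolding is_mlin_extension_def
  proof (intro conjI allI impI)
    show "?c \<in> Pow {..<m} \<rightarrow>\<^sub>E carrier R"
      using mlin_extension_closed[of A' m] mlin_extension_closed[of A'' m] by (auto simp: Pi_iff)
    fix b :: "bool list" assume b: "length b = m"
    have "mlin_eval R m ?c (map (bit_elem R) b)
      = mlin_eval R m (mlin_extension A' m R) (map (bit_elem R) b)
        \<oplus> mlin_eval R m (mlin_extension A'' m R) (map (bit_elem R) b)"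
      by (rule mlin_eval_add) (use mlin_extension_closed b in \<open>auto simp: bit_elem_def\<close>)
    also have "\<dots> = bit_elem R (A' b) \<oplus> bit_elem R (A'' b)"
      using mlin_extension_is_extension[of A' m] mlin_extension_is_extension[of A'' m] b
      unfolding is_mlin_extension_def by simp
    also have "\<dots> = bit_elem R (A b)" using assms[of b] by (auto simp: bit_elem_def)
    finally show "mlin_eval R m ?c (map (bit_elem R) b) = bit_elem R (A b)" .
  qed
  then show ?thesis
    unfolding mlin_extension_def by (rule the1_equality[OF mlin_extension_unique_exists])
qed

section \<open>A query value as a sum of two field elements, one for each half\<close>

definition query_value :: "bool_oracle \<Rightarrow> nat \<Rightarrow> int list \<Rightarrow> int list list \<Rightarrow> int list set" where
  "query_value A p f xs = mlin_eval (descr_field p f) (length xs)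
     (mlin_extension A (length xs) (descr_field p f)) (map (residue_class p f) xs)"

lemma query_points:
  assumes "is_query w p f xs" shows "set (map (residue_class p f) xs) \<subseteq> carrier (descr_field p f)"
  using assms bij_betw_residue_class[of p f] by (auto simp: is_query_def bij_betw_def)

lemma query_field: "is_query w p f xs \<Longrightarrow> field (descr_field p f)"
  by (simp add: is_query_def descr_field_is_field)

lemma query_value_closed:
  assumes "is_query w p f xs" shows "query_value A p f xs \<in> carrier (descr_field p f)"
proof -
  interpret field "descr_field p f" using assms by (rule query_field)
  show ?thesis unfolding query_value_def
    by (rule mlin_eval_closed) (use mlin_extension_closed query_points[OF assms] in auto)
qed

lemma query_value_add:
  assumes q: "is_query w p f xs"
    and A: "\<And>b. A b \<longleftrightarrow> A' b \<or> A'' b" "\<And>b. \<not> (A' b \<and> A'' b)"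
  shows "query_value A p f xs = query_value A' p f xs \<oplus>\<^bsub>descr_field p f\<^esub> query_value A'' p f xs"
proof -
  interpret field "descr_field p f" using q by (rule query_field)
  show ?thesis unfolding query_value_def mlin_extension_add[OF A]
    by (rule mlin_eval_add) (use mlin_extension_closed query_points[OF q] in auto)
qed

lemma number_le_two_power_length: "n < 2 ^ length (binary n)"
proof (induction n rule: less_induct)
  case (less n)
  show ?case
  proof (cases "n = 0")
    case False
    then have "n div 2 < 2 ^ length (binary (n div 2))" using less by simp
    moreover have "length (binary n) = Suc (length (binary (n div 2)))"
      using False by (subst binary.simps) simp
    ultimately show ?thesis by simp
  qed simp
qed

lemma length_list_word: "length g * l \<le> length (list_word l g)" "1 \<le> length (list_word l g)"
  by (induction g) (auto simp: list_word_def number_word_def)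

lemma length_query_word:
  "length f * length (binary p) \<le> length (query_word p f xs)" "length xs \<le> length (query_word p f xs)"
proof -
  let ?l = "length (binary p)"
  have "length (concat (map (list_word ?l) ys)) \<ge> length ys" for ys
  proof (induction ys)
    case (Cons y ys)
    then show ?case using length_list_word(2)[of ?l y] by simp
  qed simp
  from this[of "map (padded f) xs"] show "length xs \<le> length (query_word p f xs)"
    by (simp add: query_word_def)
  show "length f * ?l \<le> length (query_word p f xs)"
    using length_list_word(1)[of f ?l] by (simp add: query_word_def)
qed

lemma prime_poly_ring_coeffs:
  "g \<in> carrier (prime_poly_ring p) \<Longrightarrow> set g \<subseteq> {0..int p - 1}"
  by (cases g) (auto simp: prime_poly_ring_def univ_poly_def polynomial_def residue_ring_def)

text \<open>A query word spells out all coefficients of \<open>f\<close>, each with at least as many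
  digits as \<open>p\<close> has, so its length is at least the binary logarithm of the field size.
  Thus the charge for a query also covers the announcement of a field element by either
  owner.\<close>

lemma card_descr_field:
  assumes "is_query w p f xs"
  shows "finite (carrier (descr_field p f))" "card (carrier (descr_field p f)) \<le> 2 ^ length w"
proof -
  have d: "field_descr p f" and w: "w = query_word p f xs" using assms by (auto simp: is_query_def)
  have p: "0 < p" using d prime_gt_0_nat by (auto simp: field_descr_def)
  let ?T = "{g. set g \<subseteq> {0..int p - 1} \<and> length g = length f - 1}"
  have "padded f ` reduced_polys p f \<subseteq> ?T"
  proof
    fix v assume "v \<in> padded f ` reduced_polys p f"
    then obtain g where g: "v = padded f g" "g \<in> carrier (prime_poly_ring p)" "length g < length f"
      by (auto simp: reduced_polys_def)
    then show "v \<in> ?T" using prime_poly_ring_coeffs[OF g(2)] p by (auto simp: padded_def)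
  qed
  moreover have T: "finite ?T" "card ?T = p ^ (length f - 1)"
    using finite_lists_length_eq[of "{0..int p - 1}" "length f - 1"]
      card_lists_length_eq[of "{0..int p - 1}" "length f - 1"] by auto
  ultimately have fin: "finite (padded f ` reduced_polys p f)"
    and "card (padded f ` reduced_polys p f) \<le> p ^ (length f - 1)"
    using finite_subset card_mono[of ?T] by auto
  then have c: "finite (reduced_polys p f)" "card (reduced_polys p f) \<le> p ^ (length f - 1)"
    using finite_imageD[OF fin inj_on_padded] card_image[OF inj_on_padded] by auto
  note b = bij_betw_residue_class[OF d]
  show "finite (carrier (descr_field p f))" using c(1) bij_betw_finite[OF b] by simp
  have "card (carrier (descr_field p f)) \<le> p ^ (length f - 1)" using c(2) bij_betw_same_card[OF b] by simp
  also have "\<dots> \<le> (2 ^ length (binary p)) ^ (length f - 1)"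
    using number_le_two_power_length[of p] by (intro power_mono) auto
  also have "\<dots> = 2 ^ (length (binary p) * (length f - 1))" by (simp add: power_mult)
  also have "\<dots> \<le> 2 ^ length w"
  proof (rule power_increasing)
    have "length (binary p) * (length f - 1) \<le> length f * length (binary p)"
      by (simp add: mult.commute)
    then show "length (binary p) * (length f - 1) \<le> length w"
      unfolding w using length_query_word(1)[of f p xs] by linarith
  qed simp
  finally show "card (carrier (descr_field p f)) \<le> 2 ^ length w" .
qed

text \<open>The query \<open>b # y @ w\<close> with \<open>length w = 100 * (length y + 1)\<close> asks whether \<open>y\<close> belongs to
  the table of half \<open>b\<close> at seed \<open>w\<close>; the length of the query determines where \<open>y\<close> ends.\<close>

definition oracle_of :: "(bool list \<Rightarrow> bool list set) \<Rightarrow> (bool list \<Rightarrow> bool list set) \<Rightarrow> bool_oracle" where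
  "oracle_of Xs Ys z = (case z of [] \<Rightarrow> False | b # u \<Rightarrow>
     take (length u div 101) u \<in> (if b then Ys else Xs) (drop (length u div 101) u))"

lemma oracle_of_append:
  assumes "length y = d" "length w = 100 * (d + 1)"
  shows "oracle_of Xs Ys (b # y @ w) \<longleftrightarrow> y \<in> (if b then Ys else Xs) w"
proof -
  \<comment> \<open>The length is \<open>101 * d + 100\<close>, just below the next multiple of
    101.\<close>
  have "length (y @ w) div 101 = d" using assms by simp
  then show ?thesis using assms by (simp add: oracle_of_def)
qed

text \<open>Emptying the tables of one half isolates the contribution of the other. The first bit of
  an oracle word separates the supports, so \<open>query_value_add\<close> applies.\<close>

lemma mlin_oracle_split:
  obtains \<alpha> \<beta> :: "(bool list \<Rightarrow> bool list set) \<Rightarrow> int list set"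
    and h :: "int list set \<Rightarrow> int list set \<Rightarrow> nat list"
  where "finite (range \<alpha>)" "card (range \<alpha>) \<le> 2 ^ length w"
    "finite (range \<beta>)" "card (range \<beta>) \<le> 2 ^ length w"
    "\<forall>Xs Ys. mlin_oracle (oracle_of Xs Ys) w = h (\<alpha> Xs) (\<beta> Ys)"
proof (cases "\<exists>p f xs. is_query w p f xs")
  case False
  then have "mlin_oracle A w = []" for A by (simp add: mlin_oracle_def)
  then show thesis by (intro that[of "\<lambda>_. {}" "\<lambda>_. {}" "\<lambda>_ _. []"]) simp_all
next
  case True
  then obtain p f xs where q: "is_query w p f xs" by blast
  let ?F = "descr_field p f"
  let ?\<alpha> = "\<lambda>Xs. query_value (oracle_of Xs (\<lambda>_. {})) p f xs"
  let ?\<beta> = "\<lambda>Ys. query_value (oracle_of (\<lambda>_. {}) Ys) p f xs"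
  let ?h = "\<lambda>a b. list_word (length (binary p)) (padded f (representative p f (a \<oplus>\<^bsub>?F\<^esub> b)))"
  have sub: "range ?\<alpha> \<subseteq> carrier ?F" "range ?\<beta> \<subseteq> carrier ?F"
    using query_value_closed[OF q] by auto
  have "mlin_oracle (oracle_of Xs Ys) w = ?h (?\<alpha> Xs) (?\<beta> Ys)" for Xs Ys
  proof -
    have "query_value (oracle_of Xs Ys) p f xs = ?\<alpha> Xs \<oplus>\<^bsub>?F\<^esub> ?\<beta> Ys"
      by (rule query_value_add[OF q]) (auto simp: oracle_of_def split: list.splits)
    then show ?thesis
      unfolding mlin_oracle_query[OF q] mlin_answer_def query_value_def Let_def by simp
  qed
  then have eq: "\<forall>Xs Ys. mlin_oracle (oracle_of Xs Ys) w = ?h (?\<alpha> Xs) (?\<beta> Ys)" by blast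
  note fin = card_descr_field(1)[OF q] and card = card_descr_field(2)[OF q]
  show thesis
  proof (rule that)
    show "finite (range ?\<alpha>)" by (rule finite_subset[OF sub(1) fin])
    show "finite (range ?\<beta>)" by (rule finite_subset[OF sub(2) fin])
    show "card (range ?\<alpha>) \<le> 2 ^ length w" by (rule order_trans[OF card_mono[OF fin sub(1)] card])
    show "card (range ?\<beta>) \<le> 2 ^ length w" by (rule order_trans[OF card_mono[OF fin sub(2)] card])
    show "\<forall>Xs Ys. mlin_oracle (oracle_of Xs Ys) w = ?h (?\<alpha> Xs) (?\<beta> Ys)" by (rule eq)
  qed
qed

lemma set_mlin_oracle: "set (mlin_oracle A w) \<subseteq> {1..4}"
proof (cases "\<exists>p f xs. is_query w p f xs")
  case False
  then show ?thesis by (simp add: mlin_oracle_def)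
next
  case True
  then obtain p f xs where q: "is_query w p f xs" by blast
  have "set (number_word l n) \<subseteq> {1..4}" for l n
    using subset_trans[OF set_number_word[of l n], of "{1..4}"] by simp
  then have "set (list_word l g) \<subseteq> {1..4}" for l g
    by (induction g) (simp_all add: list_word_def)
  then show ?thesis unfolding mlin_oracle_query[OF q] mlin_answer_def Let_def .
qed

text \<open>A query in \<open>m\<close> variables depends on \<open>A\<close> only at words of
  length \<open>m\<close>, and its own word is at least that long. Compactness rests on this
  locality.\<close>

lemma mlin_oracle_cong:
  assumes "\<And>z. length z \<le> length w \<Longrightarrow> A z = A' z"
  shows "mlin_oracle A w = mlin_oracle A' w"
proof (cases "\<exists>p f xs. is_query w p f xs")
  case False
  then show ?thesis by (simp add: mlin_oracle_def)
next
  case True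
  then obtain p f xs where q: "is_query w p f xs" by blast
  then have "length xs \<le> length w" using length_query_word(2) by (auto simp: is_query_def)
  then have "is_mlin_extension A (length xs) R = is_mlin_extension A' (length xs) R"
    for R :: "int list set ring" using assms by (auto simp: is_mlin_extension_def fun_eq_iff)
  then show ?thesis
    unfolding mlin_oracle_query[OF q] mlin_answer_def Let_def mlin_extension_def by simp
qed

section \<open>Clocked runs of normalized machines\<close>

text \<open>Overrunning the budget \<open>B\<close> counts as rejection. The clock gives every
  machine, halting or not, the bounds of \<open>simple_sim\<close> and \<open>sim_cong\<close>; by
  \<open>sim_eq_run\<close> it is invisible for runs within the budget.\<close>

fun sim :: "(nat list \<Rightarrow> nat list) \<Rightarrow> ptm \<Rightarrow> nat \<Rightarrow> bool list \<Rightarrow> config \<Rightarrow> bool" where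
  "sim Q M B [] cf \<longleftrightarrow> fst cf = accept_state"
| "sim Q M B (b # r) cf \<longleftrightarrow> step_cost cf \<le> B \<and> sim Q M (B - step_cost cf) r (step Q M b cf)"

lemma sim_eq_run:
  "run_time Q M r cf \<le> B \<Longrightarrow> sim Q M B r cf \<longleftrightarrow> fst (run Q M r cf) = accept_state"
  by (induction r arbitrary: B cf) auto

lemma step_no_query:
  assumes "halted cf \<or> fst cf \<noteq> query_state" shows "step Q M b cf = step Q' M b cf"
  using assms by (auto simp: step_def split: prod.splits)

lemma step_query:
  assumes "\<not> halted cf" "fst cf = query_state"
  shows "step Q M b cf = (answer_state, (snd cf)[1 := word_tape (Q (tape_word (snd cf ! 1)))])"
    "step_cost cf = 1 + length (tape_word (snd cf ! 1))"
  using assms by (auto simp: step_def step_cost_def split: prod.splits)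

text \<open>Only queries depend on the halves. A query word of length \<open>l\<close> lowers the
  budget by \<open>1 + l\<close> and branches into at most \<open>2 ^ l * 2 ^ l = 4 ^ l\<close>
  pairs of announcements, which determine the next configuration.\<close>

lemma simple_sim:
  "simple (4 ^ B) (\<lambda>Xs Ys. sim (mlin_oracle (oracle_of Xs Ys)) M B r cf)"
proof (induction r arbitrary: B cf)
  case Nil
  show ?case unfolding sim.simps by (rule simple_const) simp
next
  case (Cons b r)
  let ?Q = "\<lambda>Xs Ys. mlin_oracle (oracle_of Xs Ys)"
  show ?case
  proof (cases "step_cost cf \<le> B")
    case False
    then have "simple (4 ^ B) (\<lambda>Xs Ys. False)" by (intro simple_const) simp
    then show ?thesis using False by simp
  next
    case cost: True
    show ?thesis
    proof (cases "halted cf \<or> fst cf \<noteq> query_state")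
      case True
      define cf' where "cf' = step (\<lambda>_. []) M b cf"
      have "step Q M b cf = cf'" for Q unfolding cf'_def by (rule step_no_query[OF True])
      then have "(\<lambda>Xs Ys. sim (?Q Xs Ys) M B (b # r) cf)
        = (\<lambda>Xs Ys. sim (?Q Xs Ys) M (B - step_cost cf) r cf')" using cost by simp
      moreover have "simple (4 ^ B) (\<lambda>Xs Ys. sim (?Q Xs Ys) M (B - step_cost cf) r cf')"
        by (rule simple_mono[OF Cons.IH]) (rule power_increasing, auto)
      ultimately show ?thesis by (simp only:)
    next
      case False
      then have q: "\<not> halted cf" "fst cf = query_state" by auto
      define w where "w = tape_word (snd cf ! 1)"
      obtain \<alpha> \<beta> :: "(bool list \<Rightarrow> bool list set) \<Rightarrow> int list set"
        and h :: "int list set \<Rightarrow> int list set \<Rightarrow> nat list" where ab: "finite (range \<alpha>)" "card (range \<alpha>) \<le> 2 ^ length w"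
        "finite (range \<beta>)" "card (range \<beta>) \<le> 2 ^ length w"
        "\<forall>Xs Ys. mlin_oracle (oracle_of Xs Ys) w = h (\<alpha> Xs) (\<beta> Ys)"
        using mlin_oracle_split[of w] .
      define F where "F a b = (\<lambda>Xs Ys. sim (?Q Xs Ys) M (B - step_cost cf) r
        (answer_state, (snd cf)[1 := word_tape (h a b)]))" for a b
      have "simple (2 ^ length w * 2 ^ length w * 4 ^ (B - step_cost cf))
        (\<lambda>Xs Ys. F (\<alpha> Xs) (\<beta> Ys) Xs Ys)"
        by (rule simple_branch[OF ab(1-4)]) (unfold F_def, rule Cons.IH)
      moreover have "2 ^ length w * 2 ^ length w * 4 ^ (B - step_cost cf) \<le> (4 :: nat) ^ B"
      proof -
        have "(2 :: nat) ^ length w * 2 ^ length w = 4 ^ length w"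
          by (simp flip: power_mult_distrib)
        then have "2 ^ length w * 2 ^ length w * 4 ^ (B - step_cost cf)
          = (4 :: nat) ^ (length w + (B - step_cost cf))" by (simp add: power_add)
        also have "\<dots> \<le> 4 ^ B"
          using cost step_query(2)[OF q] by (intro power_increasing) (auto simp: w_def)
        finally show ?thesis .
      qed
      ultimately have "simple (4 ^ B) (\<lambda>Xs Ys. F (\<alpha> Xs) (\<beta> Ys) Xs Ys)" by (rule simple_mono)
      moreover have "(\<lambda>Xs Ys. F (\<alpha> Xs) (\<beta> Ys) Xs Ys) = (\<lambda>Xs Ys. sim (?Q Xs Ys) M B (b # r) cf)"
      proof (intro ext)
        fix Xs Ys
        have "step (?Q Xs Ys) M b cf = (answer_state, (snd cf)[1 := word_tape (h (\<alpha> Xs) (\<beta> Ys))])"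
          unfolding step_query(1)[OF q] w_def[symmetric] ab(5)[rule_format] ..
        then show "F (\<alpha> Xs) (\<beta> Ys) Xs Ys = sim (?Q Xs Ys) M B (b # r) cf"
          using cost by (simp only: F_def sim.simps simp_thms)
      qed
      ultimately show ?thesis by (simp only:)
    qed
  qed
qed

lemma sim_cong:
  assumes "\<And>w. length w < B \<Longrightarrow> Q w = Q' w" shows "sim Q M B r cf = sim Q' M B r cf"
  using assms
proof (induction r arbitrary: B cf)
  case (Cons b r)
  show ?case
  proof (cases "step_cost cf \<le> B")
    case True
    have "step Q M b cf = step Q' M b cf"
    proof (cases "halted cf \<or> fst cf \<noteq> query_state")
      case False
      then have q: "\<not> halted cf" "fst cf = query_state" by auto
      have "Q (tape_word (snd cf ! 1)) = Q' (tape_word (snd cf ! 1))"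
        using True step_query(2)[OF q] by (intro Cons.prems) simp
      then show ?thesis unfolding step_query(1)[OF q] by simp
    qed (rule step_no_query)
    moreover have "sim Q M (B - step_cost cf) r cf' = sim Q' M (B - step_cost cf) r cf'" for cf'
      by (rule Cons.IH) (rule Cons.prems, simp)
    ultimately show ?thesis by simp
  qed simp
qed simp

section \<open>Reduction to countably many machines\<close>

definition legal_args :: "nat \<Rightarrow> nat \<Rightarrow> nat \<Rightarrow> (nat \<times> bool \<times> nat list) set" where
  "legal_args k s m = {..<s} \<times> UNIV \<times> {ss. set ss \<subseteq> {..<m} \<and> length ss = k}"

text \<open>As \<open>trans\<close> is arbitrary on illegal arguments, the type \<open>ptm\<close>
  is uncountable. Cutting \<open>trans\<close> off there leaves countably many machines and keeps
  the runs of well-formed ones.\<close>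

definition normal_machine :: "ptm \<Rightarrow> ptm" where
  "normal_machine M = M\<lparr>trans := \<lambda>q b ss.
     restrict (\<lambda>(q, b, ss). trans M q b ss) (legal_args (num_tapes M) (num_states M) (num_symbols M)) (q, b, ss)\<rparr>"

lemma countable_normal_machines: "countable (range normal_machine)"
proof -
  let ?G = "\<lambda>(k, s, m). Pi\<^sub>E (legal_args k s m) (\<lambda>_. UNIV :: (nat \<times> (nat \<times> int) list) set)"
  let ?mk = "\<lambda>(k, s, m) g. \<lparr>num_tapes = k, num_states = s, num_symbols = m, trans = \<lambda>q b ss. g (q, b, ss)\<rparr>"
  have "finite (legal_args k s m)" for k s m
    unfolding legal_args_def by (intro finite_cartesian_product finite_lists_length_eq) auto
  then have "countable (\<Union>c. ?mk c ` ?G c)"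
    by (intro countable_UN countable_image) (auto intro!: countable_PiE)
  moreover have "range normal_machine \<subseteq> (\<Union>c. ?mk c ` ?G c)"
  proof clarify
    fix M :: ptm
    let ?c = "(num_tapes M, num_states M, num_symbols M)"
    let ?g = "restrict (\<lambda>(q, b, ss). trans M q b ss) (legal_args (num_tapes M) (num_states M) (num_symbols M))"
    have "normal_machine M = ?mk ?c ?g" by (simp add: normal_machine_def)
    moreover have "?g \<in> ?G ?c" by auto
    ultimately have "normal_machine M \<in> ?mk ?c ` ?G ?c" by (rule image_eqI)
    then show "normal_machine M \<in> (\<Union>c. ?mk c ` ?G c)" by blast
  qed
  ultimately show ?thesis by (rule countable_subset[rotated])
qed

definition legal_config :: "ptm \<Rightarrow> config \<Rightarrow> bool" where
  "legal_config M cf \<longleftrightarrow> fst cf < num_states M \<and> length (snd cf) = num_tapes M \<and>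
     (\<forall>t\<in>set (snd cf). \<forall>i. snd t i < num_symbols M)"

lemma legal_word_tape:
  assumes "\<forall>a\<in>set w. a < n" "0 < n" shows "snd (word_tape w) i < n"
  using assms by (auto simp: word_tape_def)

lemma legal_init:
  assumes "wf_ptm M" shows "legal_config M (init_config M x)"
proof -
  have m: "5 \<le> num_symbols M" "5 \<le> num_states M" "2 \<le> num_tapes M"
    using assms by (auto simp: wf_ptm_def)
  have "snd (word_tape (map (\<lambda>b. if b then 2 else 1) x)) i < num_symbols M" for i
    using m by (intro legal_word_tape) auto
  moreover have "snd (word_tape []) i < num_symbols M" for i using m by (intro legal_word_tape) auto
  ultimately show ?thesis using m by (auto simp: legal_config_def init_config_def)
qed

text \<open>Oracle answers use the symbols 1 to 4 and a well-formed machine has at least five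
  symbols, so queries preserve legality too. On legal configurations the cut-off in
  \<open>normal_machine\<close> is invisible.\<close>

lemma legal_step:
  assumes M: "wf_ptm M" and Q: "\<And>w. set (Q w) \<subseteq> {1..4}" and cf: "legal_config M cf"
  shows "legal_config M (step Q M b cf)" "step Q (normal_machine M) b cf = step Q M b cf"
proof -
  obtain q ts where cf_eq: "cf = (q, ts)" by (cases cf)
  have m: "5 \<le> num_symbols M" "5 \<le> num_states M" "2 \<le> num_tapes M" using M by (auto simp: wf_ptm_def)
  have q: "q < num_states M" and len: "length ts = num_tapes M"
    and sym: "\<And>t i. t \<in> set ts \<Longrightarrow> snd t i < num_symbols M"
    using cf by (auto simp: legal_config_def cf_eq)
  let ?ss = "map (\<lambda>(h, u). u h) ts"
  have ss: "length ?ss = num_tapes M" "set ?ss \<subseteq> {..<num_symbols M}"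
    using len sym by force+
  then have "(q, b, ?ss) \<in> legal_args (num_tapes M) (num_states M) (num_symbols M)"
    using q by (simp add: legal_args_def)
  then have "trans (normal_machine M) q b ?ss = trans M q b ?ss" by (simp add: normal_machine_def)
  then show "step Q (normal_machine M) b cf = step Q M b cf" by (simp add: step_def cf_eq)
  obtain q' acts where tr: "trans M q b ?ss = (q', acts)" by (cases "trans M q b ?ss")
  have "\<forall>q < num_states M. \<forall>b ss. length ss = num_tapes M \<and> set ss \<subseteq> {..<num_symbols M} \<longrightarrow>
        (case trans M q b ss of (q', acts) \<Rightarrow> q' < num_states M \<and> length acts = num_tapes M \<and>
           set acts \<subseteq> {..<num_symbols M} \<times> {-1, 0, 1})"
    using M unfolding wf_ptm_def by (elim conjE)
  from this[rule_format, OF q conjI[OF ss], of b] have wf: "q' < num_states M" "length acts = num_tapes M" "set acts \<subseteq> {..<num_symbols M} \<times> {-1, 0, 1}"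
    unfolding tr by auto
  consider "halted cf" | "\<not> halted cf" "q = query_state" | "\<not> halted cf" "q \<noteq> query_state" by blast
  then show "legal_config M (step Q M b cf)"
  proof cases
    case 1
    then show ?thesis using cf by (simp add: step_def cf_eq)
  next
    case 2
    let ?v = "word_tape (Q (tape_word (ts ! 1)))"
    have st: "step Q M b cf = (answer_state, ts[1 := ?v])" using 2 by (simp add: step_def cf_eq)
    have "\<forall>a\<in>set (Q (tape_word (ts ! 1))). a < num_symbols M" using Q[of "tape_word (ts ! 1)"] m(1) by fastforce
    then have v: "snd ?v i < num_symbols M" for i using m(1) by (intro legal_word_tape) auto
    have "snd t i < num_symbols M" if t: "t \<in> set (ts[1 := ?v])" for t i
    proof -
      from t have "t = ?v \<or> t \<in> set ts" using set_update_subset_insert by fastforce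
      then show ?thesis using v sym by (elim disjE) simp_all
    qed
    then show ?thesis unfolding st legal_config_def fst_conv snd_conv using m len by simp
  next
    case 3
    then have st: "step Q M b cf = (q', map2 tape_action acts ts)"
      by (simp add: step_def cf_eq tr)
    have "snd t i < num_symbols M" if t: "t \<in> set (map2 tape_action acts ts)" for t i
    proof -
      from t obtain a t' where at: "(a, t') \<in> set (zip acts ts)" "t = tape_action a t'" by auto
      then have "a \<in> set acts" "t' \<in> set ts" by (auto dest: set_zip_leftD set_zip_rightD)
      then have "fst a < num_symbols M" "snd t' i < num_symbols M" using wf(3) sym by auto
      then show ?thesis unfolding at(2) by (cases a; cases t') (simp add: tape_action_def)
    qed
    then show ?thesis unfolding st legal_config_def using wf len by simp
  qed
qed

lemma sim_normal_machine:
  assumes "wf_ptm M" "\<And>w. set (Q w) \<subseteq> {1..4}" "legal_config M cf"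
  shows "sim Q (normal_machine M) B r cf = sim Q M B r cf"
  using assms(3)
proof (induction r arbitrary: B cf)
  case (Cons b r)
  then show ?case using legal_step[OF assms(1,2) Cons.prems, where b = b] by simp
qed simp

definition machine :: "nat \<Rightarrow> ptm" where
  "machine = from_nat_into (range normal_machine)"

lemma exists_machine:
  assumes "wf_ptm M"
  obtains e where "\<And>A B r x. sim (mlin_oracle A) (machine e) B r (init_config (machine e) x)
    = sim (mlin_oracle A) M B r (init_config M x)"
proof -
  obtain e where e: "machine e = normal_machine M"
    unfolding machine_def using from_nat_into_surj[OF countable_normal_machines, of "normal_machine M"] by blast
  have i: "init_config (normal_machine M) x = init_config M x" for x
    by (simp add: init_config_def normal_machine_def)
  show thesis
    by (rule that[of e]) (unfold e i, rule sim_normal_machine[OF assms set_mlin_oracle legal_init[OF assms]])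
qed

section \<open>Compactness and circuits\<close>

text \<open>If each of the finitely many \<open>S\<close> failed at some bound, all of them would
  fail at the sum of these bounds, since \<open>P\<close> is antitone in \<open>H\<close>.\<close>

lemma finite_limit_choice:
  fixes P :: "nat \<Rightarrow> 'a \<Rightarrow> bool"
  assumes fin: "finite T" and P: "\<And>H. \<exists>A. P H A \<and> g A \<in> T" and mono: "\<And>H H' A. H \<le> H' \<Longrightarrow> P H' A \<Longrightarrow> P H A"
  shows "\<exists>S\<in>T. \<forall>H. \<exists>A. P H A \<and> g A = S"
proof (rule ccontr)
  assume "\<not> ?thesis"
  then have "\<forall>S\<in>T. \<exists>H. \<forall>A. P H A \<longrightarrow> g A \<noteq> S" by blast
  from bchoice[OF this] obtain h where h: "\<forall>S\<in>T. \<forall>A. P (h S) A \<longrightarrow> g A \<noteq> S" ..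
  obtain A where A: "P (\<Sum>S\<in>T. h S) A" "g A \<in> T" using P by blast
  have "h (g A) \<le> (\<Sum>S\<in>T. h S)" using fin A(2) by (intro member_le_sum) auto
  then have "P (h (g A)) A" using A(1) mono by blast
  then show False using h A(2) by blast
qed

lemma finite_short_words: "finite {z :: bool list. length z \<le> n}"
  using finite_lists_length_le[of "UNIV :: bool set" n] by simp

text \<open>Koenig's lemma for the tree of finite oracle parts: \<open>ok n S\<close> says that
  \<open>S\<close>, a part on words of length up to \<open>n\<close>, extends to oracles that are
  good for any finite number of stages. A branch defines \<open>A\<close>, and each stage inspects
  one finite part of it only.\<close>

lemma oracle_compactness:
  fixes good :: "nat \<Rightarrow> bool_oracle \<Rightarrow> bool"
  assumes ex: "\<And>H. \<exists>A. \<forall>d<H. good d A"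
    and local: "\<And>d A A'. (\<And>z. length z \<le> N d \<Longrightarrow> A z = A' z) \<Longrightarrow> good d A \<Longrightarrow> good d A'"
  shows "\<exists>A. \<forall>d. good d A"
proof -
  define part where "part n A = {z. length z \<le> n \<and> A z}" for n and A :: bool_oracle
  define ok where "ok n S \<longleftrightarrow> (\<forall>H. \<exists>A. (\<forall>d<H. good d A) \<and> part n A = S)" for n S
  have fin: "finite (Pow {z :: bool list. length z \<le> n})" for n using finite_short_words by simp
  have part: "part n A \<in> Pow {z. length z \<le> n}" for n A by (auto simp: part_def)
  have "\<exists>S\<in>Pow {z. length z \<le> 0}. \<forall>H. \<exists>A. (\<forall>d<H. good d A) \<and> part 0 A = S"
  proof (rule finite_limit_choice[OF fin])
    show "\<exists>A. (\<forall>d<H. good d A) \<and> part 0 A \<in> Pow {z. length z \<le> 0}" for H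
      using ex[of H] part by blast
  qed auto
  then have start: "\<exists>S. ok 0 S" unfolding ok_def by blast
  have step: "\<exists>S'. ok (Suc n) S' \<and> S = S' \<inter> {z. length z \<le> n}" if S: "ok n S" for n S
  proof -
    have "\<exists>S'\<in>Pow {z. length z \<le> Suc n}. \<forall>H. \<exists>A. ((\<forall>d<H. good d A) \<and> part n A = S) \<and> part (Suc n) A = S'"
    proof (rule finite_limit_choice[OF fin])
      show "\<exists>A. ((\<forall>d<H. good d A) \<and> part n A = S) \<and> part (Suc n) A \<in> Pow {z. length z \<le> Suc n}" for H
        using S part unfolding ok_def by blast
    qed auto
    then obtain S' where S': "\<forall>H. \<exists>A. ((\<forall>d<H. good d A) \<and> part n A = S) \<and> part (Suc n) A = S'" by blast
    then obtain A where "part n A = S" "part (Suc n) A = S'" by blast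
    then have "S = S' \<inter> {z. length z \<le> n}" by (auto simp: part_def)
    moreover have "ok (Suc n) S'" using S' unfolding ok_def by blast
    ultimately show ?thesis by blast
  qed
  obtain f where f: "\<And>n. ok n (f n)" "\<And>n. f n = f (Suc n) \<inter> {z. length z \<le> n}"
    using dependent_nat_choice[of ok "\<lambda>n S S'. S = S' \<inter> {z. length z \<le> n}", OF start step] by blast
  have f_mono: "z \<in> f (length z + k) \<longleftrightarrow> z \<in> f (length z)" for z k
  proof (induction k)
    case (Suc k)
    have "z \<in> f (length z + k) \<longleftrightarrow> z \<in> f (Suc (length z + k)) \<inter> {z'. length z' \<le> length z + k}"
      using f(2)[of "length z + k"] by simp
    then show ?case using Suc.IH by simp
  qed simp
  define A where "A z \<longleftrightarrow> z \<in> f (length z)" for z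
  have "good d A" for d
  proof -
    obtain A' where A': "\<forall>d'<Suc d. good d' A'" "part (N d) A' = f (N d)"
      using f(1)[of "N d"] unfolding ok_def by blast
    have "A' z = A z" if "length z \<le> N d" for z
    proof -
      have "A' z \<longleftrightarrow> z \<in> f (N d)" unfolding A'(2)[symmetric] using that by (simp add: part_def)
      also have "\<dots> \<longleftrightarrow> A z" using f_mono[of z "N d - length z"] that by (simp add: A_def)
      finally show ?thesis .
    qed
    then show ?thesis using local[of d A' A] A'(1) by simp
  qed
  then show ?thesis by blast
qed

section \<open>Tasks: a machine, a clock and an input in one word\<close>

text \<open>Unary codes are affordable: \<open>e\<close> is constant and \<open>t\<close> is linear
  in the input length. They also make the clock at most the length of the task, as
  \<open>task_time_le\<close> records.\<close>

definition task :: "nat \<Rightarrow> nat \<Rightarrow> bool list \<Rightarrow> bool list" where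
  "task e t x = replicate e True @ False # replicate t True @ False # x"

text \<open>Decoding is total: a word that is not of the form \<open>task e t x\<close> stands for some task as well,
  whose answer is stored but not used.\<close>

definition task_machine :: "bool list \<Rightarrow> nat" where
  "task_machine y = length (takeWhile id y)"

definition task_time :: "bool list \<Rightarrow> nat" where
  "task_time y = length (takeWhile id (drop (Suc (task_machine y)) y))"

definition task_input :: "bool list \<Rightarrow> bool list" where
  "task_input y = drop (Suc (task_time y)) (drop (Suc (task_machine y)) y)"

lemma task_simps:
  "task_machine (task e t x) = e" "task_time (task e t x) = t" "task_input (task e t x) = x"
  "length (task e t x) = e + t + 2 + length x"
proof -
  have tw: "takeWhile id (replicate k True @ False # z) = replicate k True" for k z
    by (induction k) auto
  show e: "task_machine (task e t x) = e" by (simp add: task_machine_def task_def tw)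
  have d: "drop (Suc e) (task e t x) = replicate t True @ False # x" by (simp add: task_def)
  show t: "task_time (task e t x) = t" unfolding task_time_def e d tw by simp
  show "task_input (task e t x) = x" unfolding task_input_def e d t by simp
  show "length (task e t x) = e + t + 2 + length x" by (simp add: task_def)
qed

lemma task_time_le: "task_time y \<le> length y"
  unfolding task_time_def by (rule order_trans[OF length_takeWhile_le]) simp

definition task_seeds :: "bool list \<Rightarrow> bool list set" where
  "task_seeds y = {r. length r = 2 ^ task_time y}"

definition task_accepts :: "bool_oracle \<Rightarrow> bool list \<Rightarrow> bool list \<Rightarrow> bool" where
  "task_accepts A y r = sim (mlin_oracle A) (machine (task_machine y)) (2 ^ task_time y) r
     (init_config (machine (task_machine y)) (task_input y))"

interpretation tasks: randomized_protocols "\<lambda>y r Xs Ys. task_accepts (oracle_of Xs Ys) y r" task_seeds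
proof
  fix y r
  show "finite (task_seeds y)" "task_seeds y \<noteq> {}"
    using finite_words[of "2 ^ task_time y"] words_nonempty[of "2 ^ task_time y"]
    unfolding task_seeds_def words_def by auto
  have "(4 :: nat) ^ 2 ^ task_time y \<le> 4 ^ 2 ^ length y"
    using task_time_le[of y] by (intro power_increasing) auto
  then show "simple (4 ^ 2 ^ length y) (\<lambda>Xs Ys. task_accepts (oracle_of Xs Ys) y r)"
    unfolding task_accepts_def by (rule simple_mono[OF simple_sim])
qed

text \<open>The threshold matches the promise: on a machine that decides a language in
  \<open>BPE\<close>, a wrong answer disagrees with at least \<open>2 / 3\<close> of the
  runs.\<close>

definition answers_tasks :: "nat \<Rightarrow> bool_oracle \<Rightarrow> bool" where
  "answers_tasks d A \<longleftrightarrow> (\<exists>w\<in>seeds d. \<exists>w'\<in>seeds d. \<forall>y\<in>words d.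
     disagreement (task_seeds y) (task_accepts A y) (A (False # y @ w) \<noteq> A (True # y @ w')) < 2 / 3)"

text \<open>Queries of tasks are shorter than their time \<open>2 ^ d\<close>, and
  \<open>101 * (d + 1) = 1 + d + 100 * (d + 1)\<close> is the length of the words that are looked
  up.\<close>

lemma answers_tasks_local:
  assumes A: "\<And>z. length z \<le> 2 ^ d + 101 * (d + 1) \<Longrightarrow> A z = A' z" and "answers_tasks d A"
  shows "answers_tasks d A'"
proof -
  obtain w w' where w: "w \<in> seeds d" "w' \<in> seeds d" "\<And>y. y \<in> words d \<Longrightarrow>
      disagreement (task_seeds y) (task_accepts A y) (A (False # y @ w) \<noteq> A (True # y @ w')) < 2 / 3"
    using assms(2) unfolding answers_tasks_def by blast
  have "disagreement (task_seeds y) (task_accepts A' y) (A' (False # y @ w) \<noteq> A' (True # y @ w')) < 2 / 3"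
    if y: "y \<in> words d" for y
  proof -
    have "A (False # y @ w) = A' (False # y @ w)" "A (True # y @ w') = A' (True # y @ w')"
      using w y by (auto intro!: A simp: seeds_def words_def)
    moreover have "task_accepts A y r = task_accepts A' y r" for r
      unfolding task_accepts_def
    proof (intro sim_cong mlin_oracle_cong A)
      fix v z assume "length v < 2 ^ task_time y" "length z \<le> length v"
      moreover have "(2 :: nat) ^ task_time y \<le> 2 ^ d"
        using y task_time_le[of y] by (intro power_increasing) (auto simp: words_def)
      ultimately show "length z \<le> 2 ^ d + 101 * (d + 1)" by linarith
    qed
    then have "task_accepts A y = task_accepts A' y" by blast
    ultimately show ?thesis using w(3)[OF y] by simp
  qed
  then show ?thesis using w(1,2) unfolding answers_tasks_def by blast
qed

lemma exists_oracle: "\<exists>A. \<forall>d. answers_tasks d A"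
proof (rule oracle_compactness[where N = "\<lambda>d. 2 ^ d + 101 * (d + 1)"])
  fix H
  obtain Xs Ys where "\<forall>d<H. \<exists>w\<in>seeds d. \<exists>w'\<in>seeds d. \<forall>y\<in>words d.
     tasks.err y ((y \<in> Xs w) \<noteq> (y \<in> Ys w')) (Xs, Ys) < 2 / 3" using tasks.exists_profiles[of H] by blast
  note XY = this
  let ?A = "oracle_of Xs Ys"
  have "answers_tasks d ?A" if d: "d < H" for d
  proof -
    obtain w w' where w: "w \<in> seeds d" "w' \<in> seeds d" and err: "\<And>y. y \<in> words d \<Longrightarrow>
      tasks.err y ((y \<in> Xs w) \<noteq> (y \<in> Ys w')) (Xs, Ys) < 2 / 3" using XY d by blast
    have "disagreement (task_seeds y) (task_accepts ?A y) (?A (False # y @ w) \<noteq> ?A (True # y @ w')) < 2 / 3"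
      if y: "y \<in> words d" for y
    proof -
      have "?A (False # y @ w) = (y \<in> Xs w)" "?A (True # y @ w') = (y \<in> Ys w')"
        using w y by (simp_all add: seeds_def words_def oracle_of_append[of y d])
      then show ?thesis using err[OF y] unfolding tasks.err_def by simp
    qed
    then show ?thesis using w unfolding answers_tasks_def by blast
  qed
  then show "\<exists>A. \<forall>d<H. answers_tasks d A" by blast
qed (rule answers_tasks_local)

section \<open>The circuits and the inclusion of classes\<close>

definition lookup_circuit :: "nat \<Rightarrow> nat \<Rightarrow> nat \<Rightarrow> bool list \<Rightarrow> bool list \<Rightarrow> circuit" where
  "lookup_circuit n e t w w' =
     (let y = map Constant (task e t []) @ map Input [0..<n] in
      ([ORACLE (Constant False # y @ map Constant w), ORACLE (Constant True # y @ map Constant w'),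
        NOT (Gate 0), NOT (Gate 1), AND (Gate 0) (Gate 3), AND (Gate 2) (Gate 1),
        OR (Gate 4) (Gate 5)], Gate 6))"

lemma lookup_circuit_value:
  assumes "length x = n"
  shows "circuit_value A (lookup_circuit n e t w w') x \<longleftrightarrow>
    A (False # task e t x @ w) \<noteq> A (True # task e t x @ w')"
proof -
  have const: "map (wire_value x vs) (map Constant v) = v" for vs v by (induction v) auto
  have inp: "map (wire_value x vs) (map Input [0..<n]) = x" for vs
    using assms by (intro nth_equalityI) auto
  define y where "y = map Constant (task e t []) @ map Input [0..<n]"
  have y: "map (wire_value x vs) y = task e t x" for vs
  proof -
    have "map (wire_value x vs) y = task e t [] @ x" unfolding y_def map_append const inp ..
    then show ?thesis by (simp add: task_def)
  qed
  have orc: "gate_value A x vs (ORACLE (Constant b # y @ map Constant v)) = A (b # task e t x @ v)" for vs b v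
    by (simp only: gate_value.simps list.map wire_value.simps map_append y const)
  show ?thesis
    unfolding circuit_value_def lookup_circuit_def gate_values_def Let_def y_def[symmetric] fst_conv snd_conv
    by (simp add: orc del: gate_value.simps(4)) blast
qed

lemma wf_lookup_circuit: "wf_circuit n (lookup_circuit n e t w w')"
proof -
  have orc: "wf_wire n k u"
    if "u \<in> set (Constant b # (map Constant v @ map Input [0..<n]) @ map Constant v')" for k u b v v'
    using that by auto
  have gates: "k = 0 \<or> k = 1 \<or> k = 2 \<or> k = 3 \<or> k = 4 \<or> k = 5 \<or> k = 6" if "k < 7" for k :: nat
    using that by linarith
  let ?gs = "fst (lookup_circuit n e t w w')"
  have len: "length ?gs = 7" and out: "snd (lookup_circuit n e t w w') = Gate 6"
    by (simp_all add: lookup_circuit_def Let_def)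
  have "wf_wire n k u" if k: "k < 7" and u: "u \<in> set (gate_wires (?gs ! k))" for k u
    using gates[OF k] u orc by (elim disjE) (auto simp: lookup_circuit_def Let_def)
  then show ?thesis unfolding wf_circuit_def len out by simp
qed

text \<open>With \<open>m = e + t + 2 + n\<close>, each of the two oracle gates counts
  \<open>102 + 101 * m\<close>, and the other five gates count 13 together.\<close>

lemma size_lookup_circuit:
  assumes "length w = 100 * (e + t + 2 + n + 1)" "length w' = 100 * (e + t + 2 + n + 1)"
  shows "circuit_size (lookup_circuit n e t w w') = 217 + 202 * (e + t + 2 + n)"
  using assms by (simp add: circuit_size_def lookup_circuit_def Let_def task_simps)

lemma linear_bound:
  fixes t :: "nat \<Rightarrow> nat"
  assumes "(\<lambda>n. real (t n)) \<in> O(\<lambda>n. real n)"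
  obtains c where "\<And>n. 1 \<le> n \<Longrightarrow> t n \<le> c * n"
proof -
  obtain C where "eventually (\<lambda>n. norm (real (t n)) \<le> C * norm (real n)) sequentially"
    using landau_o.bigE[OF assms] by metis
  then obtain N where N: "\<And>n. N \<le> n \<Longrightarrow> real (t n) \<le> C * real n"
    by (auto simp: eventually_sequentially)
  \<comment> \<open>The sum absorbs the finitely many exceptions below \<open>N\<close>; length 0 is
    excluded because the bound vanishes there.\<close>
  let ?c = "nat \<lceil>C\<rceil> + (\<Sum>i<N. t i)"
  show thesis
  proof (rule that)
    fix n :: nat assume n: "1 \<le> n"
    show "t n \<le> ?c * n"
    proof (cases "N \<le> n")
      case True
      have "C \<le> real (nat \<lceil>C\<rceil>)" by linarith
      then have "C * real n \<le> real (nat \<lceil>C\<rceil>) * real n" by (intro mult_right_mono) auto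
      then have "real (t n) \<le> real (nat \<lceil>C\<rceil> * n)" using N[OF True] by simp
      then have "t n \<le> nat \<lceil>C\<rceil> * n" by linarith
      then show ?thesis by (simp add: add_mult_distrib)
    next
      case False
      then have "t n \<le> (\<Sum>i<N. t i)" by (intro member_le_sum) auto
      also have "\<dots> \<le> (\<Sum>i<N. t i) * n" using n by simp
      finally show ?thesis by (simp add: add_mult_distrib)
    qed
  qed
qed

lemma BPE_subset_SIZE:
  assumes A: "\<And>d. answers_tasks d A"
  shows "BPE (mlin_oracle A) \<subseteq> (\<Union>c. SIZE A (\<lambda>n. c * n))"
proof
  fix L assume "L \<in> BPE (mlin_oracle A)"
  then obtain M t where M: "wf_ptm M" and t: "(\<lambda>n. real (t n)) \<in> O(\<lambda>n. real n)"
    and halts: "\<And>x. halts_within (mlin_oracle A) M x (2 ^ t (length x))"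
    and prob: "\<And>x. 2 / 3 \<le> measure_pmf.prob (pmf_of_set {r. length r = 2 ^ t (length x)})
      {r. accepts (mlin_oracle A) M x r \<longleftrightarrow> x \<in> L}"
    unfolding BPE_def Let_def by blast
  obtain e where e: "\<And>A B r x. sim (mlin_oracle A) (machine e) B r (init_config (machine e) x)
    = sim (mlin_oracle A) M B r (init_config M x)" using exists_machine[OF M] by metis
  obtain c where c: "\<And>n. 1 \<le> n \<Longrightarrow> t n \<le> c * n" using linear_bound[OF t] by metis
  have "\<exists>C. wf_circuit n C \<and> circuit_size C \<le> (217 + 202 * (e + c + 3)) * n \<and>
     (\<forall>x. length x = n \<longrightarrow> (circuit_value A C x \<longleftrightarrow> x \<in> L))" for n
  proof (cases "n = 0")
    case True
    \<comment> \<open>At length 0 the size bound is 0, which a constant output wire meets.\<close>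
    then show ?thesis
      by (intro exI[of _ "([], Constant ([] \<in> L))"]) (simp add: wf_circuit_def circuit_size_def circuit_value_def)
  next
    case False
    then have n: "1 \<le> n" by simp
    let ?d = "e + t n + 2 + n"
    obtain w w' where w: "w \<in> seeds ?d" "w' \<in> seeds ?d" and dis: "\<And>y. y \<in> words ?d \<Longrightarrow>
      disagreement (task_seeds y) (task_accepts A y) (A (False # y @ w) \<noteq> A (True # y @ w')) < 2 / 3"
      using A[of ?d] unfolding answers_tasks_def by blast
    let ?C = "lookup_circuit n e (t n) w w'"
    have "circuit_size ?C = 217 + 202 * ?d"
      using w by (intro size_lookup_circuit) (simp_all add: seeds_def words_def)
    also have "\<dots> \<le> (217 + 202 * (e + c + 3)) * n"
    proof -
      have "217 + 202 * ?d \<le> 217 * n + 202 * (e * n + c * n + 2 * n + n)"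
        using n c[OF n] by (intro add_mono mult_le_mono) auto
      then show ?thesis by (simp add: algebra_simps)
    qed
    finally have size: "circuit_size ?C \<le> (217 + 202 * (e + c + 3)) * n" .
    have correct: "circuit_value A ?C x \<longleftrightarrow> x \<in> L" if x: "length x = n" for x
    proof (rule ccontr)
      let ?y = "task e (t n) x" and ?T = "2 ^ t n :: nat"
      let ?b = "A (False # ?y @ w) \<noteq> A (True # ?y @ w')"
      assume "\<not> (circuit_value A ?C x \<longleftrightarrow> x \<in> L)"
      \<comment> \<open>A wrong output is the negation of \<open>x \<in> L\<close>, so the runs that
        disagree with it are exactly the correct ones.\<close>
      then have b: "?b \<noteq> (x \<in> L)" unfolding lookup_circuit_value[OF x] .
      have S: "task_seeds ?y = {r. length r = ?T}" by (simp add: task_seeds_def task_simps)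
      have acc: "task_accepts A ?y r \<longleftrightarrow> accepts (mlin_oracle A) M x r" if "r \<in> task_seeds ?y" for r
      proof -
        have "run_time (mlin_oracle A) M r (init_config M x) \<le> ?T"
          using halts[of x] that unfolding halts_within_def x S by blast
        then show ?thesis
          unfolding task_accepts_def task_simps e accepts_def by (rule sim_eq_run)
      qed
      have fin: "finite (task_seeds ?y)" "task_seeds ?y \<noteq> {}" by (rule tasks.finite_Rn, rule tasks.Rn_nonempty)
      have "disagreement (task_seeds ?y) (task_accepts A ?y) ?b
        = avg (task_seeds ?y) (\<lambda>r. of_bool (accepts (mlin_oracle A) M x r \<longleftrightarrow> x \<in> L))"
        unfolding disagreement_def avg_def using acc b
        by (intro arg_cong2[where f = "(/)"] sum.cong refl) auto
      also have "\<dots> = measure_pmf.prob (pmf_of_set (task_seeds ?y)) {r. accepts (mlin_oracle A) M x r \<longleftrightarrow> x \<in> L}"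
        unfolding avg_def using fin by (simp add: measure_pmf_of_set Int_def)
      also have "\<dots> \<ge> 2 / 3" using prob[of x] unfolding S x .
      finally have "2 / 3 \<le> disagreement (task_seeds ?y) (task_accepts A ?y) ?b" .
      moreover have "?y \<in> words ?d" using x by (simp add: words_def task_simps)
      ultimately show False using dis by fastforce
    qed
    show ?thesis using wf_lookup_circuit size correct by blast
  qed
  then have "L \<in> SIZE A (\<lambda>n. (217 + 202 * (e + c + 3)) * n)" unfolding SIZE_def by blast
  then show "L \<in> (\<Union>c. SIZE A (\<lambda>n. c * n))" by blast
qed

theorem theorem1p5:
  shows "\<exists>A :: bool_oracle. BPE (mlin_oracle A) \<subseteq> (\<Union>c :: nat. SIZE A (\<lambda>n. c * n))"
  using exists_oracle BPE_subset_SIZE by blast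

end
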